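(* There are absolute constants $c_0,c_1,c_2>0$ and, for every $q\ge 4$ and $L$, a constant $c_3=c_3(q,L)>0$ depending only on $q$ and $L$ such that the following holds. Let $X$ be a centred, isotropic random vector in $\mathbb{R}^d$ with law $\mu$, and assume that $\sup_{\theta\in S^{d-1}}\|\langle X,\theta\rangle\|_{L_q}\le L$. Let $0<\Delta\le c_0$ and $m\ge c_1\frac{d}{\Delta}$. Then with probability at least $1-\exp(-c_2\Delta m)$, $$\mathcal{SW}_2(\mu_m,\mu)\le c_3\begin{cases}\rho_{d,m}^{1/2}+\Delta^{1/4} & \text{if } q>4,\\[2pt] \rho_{d,m}^{1/2}+\Delta^{1/4}\log\left(\frac1\Delta\right) & \text{if } q=4.\end{cases}$$
   Context: Isotropic means the covariance is the identity, so (with $X$ centred) $\mathbb{E}\langle X,\theta\rangle^2=1$ for all $\theta\in S^{d-1}$, the Euclidean unit sphere of $\mathbb{R}^d$. $X_1,\dots,X_m$ are independent copies of $X$ and $\mu_m=\frac1m\sum_{i=1}^m\delta_{X_i}$ is the empirical measure. For a probability measure $\nu$ on $\mathbb{R}^d$ and $\theta\in S^{d-1}$, $\nu^\theta$ is the push-forward of $\nu$ under $x\mapsto\langle x,\theta\rangle$. $\mathcal{W}_2(\tau,\nu)=\inf_\Pi\left(\int\|x-y\|_2^2\,\Pi(dx,dy)\right)^{1/2}$, the infimum over all couplings $\Pi$ of $\tau$ and $\nu$. The max-sliced Wasserstein distance is $\mathcal{SW}_2(\mu,\nu)=\sup_{\theta\in S^{d-1}}\mathcal{W}_2(\mu^\theta,\nu^\theta)$.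 The random quantity $\rho_{d,m}$ is $\rho_{d,m}=\sup_{\theta\in S^{d-1}}\left|\frac1m\sum_{i=1}^m\langle X_i,\theta\rangle^2-1\right|$. *)

theory Defs
  imports "HOL-Probability.Probability"
begin

text \<open>
  The dimension \<open>d\<close> is quantified inside the theorem (the constants must not depend on it), so
  \<open>\<real>\<^sup>d\<close> is modelled as the product space over the index set \<open>{..<d}\<close>: points are the functions
  in \<open>extensional {..<d}\<close>, and the sigma-algebra is the (Borel) product sigma-algebra.
\<close>

abbreviation euc :: "nat \<Rightarrow> (nat \<Rightarrow> real) measure" where
  "euc d \<equiv> PiM {..<d} (\<lambda>_. borel)"

definition ip :: "nat \<Rightarrow> (nat \<Rightarrow> real) \<Rightarrow> (nat \<Rightarrow> real) \<Rightarrow> real" where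
  "ip d x y = (\<Sum>i<d. x i * y i)"

definition unit_sphere :: "nat \<Rightarrow> (nat \<Rightarrow> real) set" where
  "unit_sphere d = {\<theta> \<in> extensional {..<d}. (\<Sum>i<d. (\<theta> i)\<^sup>2) = 1}"

definition centred :: "nat \<Rightarrow> (nat \<Rightarrow> real) measure \<Rightarrow> bool" where
  "centred d \<mu> \<longleftrightarrow>
     (\<forall>i<d. integrable \<mu> (\<lambda>x. x i) \<and> (\<integral>x. x i \<partial>\<mu>) = 0)"

definition covariance :: "(nat \<Rightarrow> real) measure \<Rightarrow> nat \<Rightarrow> nat \<Rightarrow> real" where
  "covariance \<mu> i j =
     (\<integral>x. (x i - (\<integral>y. y i \<partial>\<mu>)) * (x j - (\<integral>y. y j \<partial>\<mu>)) \<partial>\<mu>)"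

definition isotropic :: "nat \<Rightarrow> (nat \<Rightarrow> real) measure \<Rightarrow> bool" where
  "isotropic d \<mu> \<longleftrightarrow>
     (\<forall>i<d. integrable \<mu> (\<lambda>x. (x i)\<^sup>2)) \<and>
     (\<forall>i<d. \<forall>j<d. covariance \<mu> i j = (if i = j then 1 else 0))"

text \<open>
  Moments and transport costs take values in \<open>[0,\<infinity>]\<close>, so that suprema and infima are
  unconditional and an infinite quantity is never read as \<open>0\<close>.
\<close>

definition enn_powr :: "ennreal \<Rightarrow> real \<Rightarrow> ennreal" where
  "enn_powr t p = (if t = \<infinity> then \<infinity> else ennreal (enn2real t powr p))"

definition Lnorm :: "'a measure \<Rightarrow> real \<Rightarrow> ('a \<Rightarrow> real) \<Rightarrow> ennreal" where
  "Lnorm M q f = enn_powr (\<integral>\<^sup>+x. ennreal (\<bar>f x\<bar> powr q) \<partial>M) (1 / q)"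

definition couplings :: "'a measure \<Rightarrow> 'b measure \<Rightarrow> ('a \<times> 'b) measure set" where
  "couplings \<tau> \<nu> =
     {K. sets K = sets (\<tau> \<Otimes>\<^sub>M \<nu>) \<and> distr K \<tau> fst = \<tau> \<and> distr K \<nu> snd = \<nu>}"

definition W2 :: "'a::euclidean_space measure \<Rightarrow> 'a measure \<Rightarrow> ennreal" where
  "W2 \<tau> \<nu> =
     (INF K\<in>couplings \<tau> \<nu>.
        enn_powr (\<integral>\<^sup>+z. ennreal ((norm (fst z - snd z))\<^sup>2) \<partial>K) (1 / 2))"

definition marginal :: "nat \<Rightarrow> (nat \<Rightarrow> real) measure \<Rightarrow> (nat \<Rightarrow> real) \<Rightarrow> real measure" where
  "marginal d \<nu> \<theta> = distr \<nu> borel (\<lambda>x. ip d x \<theta>)"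

definition SW2 :: "nat \<Rightarrow> (nat \<Rightarrow> real) measure \<Rightarrow> (nat \<Rightarrow> real) measure \<Rightarrow> ennreal" where
  "SW2 d \<mu> \<nu> = (SUP \<theta>\<in>unit_sphere d. W2 (marginal d \<mu> \<theta>) (marginal d \<nu> \<theta>))"

text \<open>
  The image of the uniform distribution on \<open>{..<m}\<close> under \<open>i \<mapsto> x i\<close>, that is,
  \<open>(1/m) \<Sum>\<^sub>i \<delta>(x i)\<close>; see \<open>emeasure_empirical\<close> below.
\<close>

definition empirical :: "nat \<Rightarrow> nat \<Rightarrow> (nat \<Rightarrow> nat \<Rightarrow> real) \<Rightarrow> (nat \<Rightarrow> real) measure" where
  "empirical d m x = distr (uniform_count_measure {..<m}) (euc d) x"

lemma emeasure_empirical: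
  assumes "m > 0" and "\<And>i. i < m \<Longrightarrow> x i \<in> space (euc d)" and "A \<in> sets (euc d)"
  shows "emeasure (empirical d m x) A =
           ennreal (1 / real m) * (\<Sum>i<m. emeasure (return (euc d) (x i)) A)"
proof -
  have "x \<in> measurable (uniform_count_measure {..<m}) (euc d)"
    using assms(2) by (simp add: uniform_count_measure_def)
  moreover have "(\<Sum>i<m. indicator A (x i) :: ennreal) = of_nat (card (x -` A \<inter> {..<m}))"
    by (simp add: indicator_def sum.If_cases Int_commute vimage_def)
  ultimately show ?thesis
    using assms
    by (simp add: empirical_def emeasure_distr emeasure_uniform_count_measure
        space_uniform_count_measure ennreal_of_nat_eq_real_of_nat ennreal_mult[symmetric]
        flip: divide_inverse)
qed

definition rho :: "nat \<Rightarrow> nat \<Rightarrow> (nat \<Rightarrow> nat \<Rightarrow> real) \<Rightarrow> real" where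
  "rho d m x = (SUP \<theta>\<in>unit_sphere d. \<bar>(1 / real m) * (\<Sum>i<m. (ip d (x i) \<theta>)\<^sup>2) - 1\<bar>)"

text \<open>
  The theorem speaks about a sample \<open>X\<^sub>0, \<dots>, X\<^sub>m\<^sub>-\<^sub>1\<close> only through its law, the \<open>m\<close>-fold product of
  \<open>\<mu>\<close>.  By the following lemma this covers independent copies on an arbitrary probability space.
\<close>

lemma prob_independent_copies:
  assumes P: "prob_space P" and m: "m > 0"
    and indep: "prob_space.indep_vars P (\<lambda>_. euc d) X {..<m}"
    and law: "\<And>i. i < m \<Longrightarrow> distr P (euc d) (X i) = \<mu>"
    and A: "A \<in> sets (PiM {..<m} (\<lambda>_. \<mu>))"
  shows "measure P {\<omega> \<in> space P. (\<lambda>i\<in>{..<m}. X i \<omega>) \<in> A} = measure (PiM {..<m} (\<lambda>_. \<mu>)) A"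
proof -
  interpret prob_space P by fact
  have rv: "random_variable (euc d) (X i)" if "i < m" for i
    using indep that by (auto simp: indep_vars_def)
  have s: "sets \<mu> = sets (euc d)"
    using law[OF m] by (metis sets_distr)
  have "distr P (PiM {..<m} (\<lambda>_. euc d)) (\<lambda>\<omega>. \<lambda>i\<in>{..<m}. X i \<omega>)
      = PiM {..<m} (\<lambda>i. distr P (euc d) (X i))"
    using indep m rv by (subst indep_vars_iff_distr_eq_PiM'[symmetric]) auto
  also have "\<dots> = PiM {..<m} (\<lambda>_. \<mu>)"
    by (intro PiM_cong) (auto simp: law)
  finally have eq: "distr P (PiM {..<m} (\<lambda>_. euc d)) (\<lambda>\<omega>. \<lambda>i\<in>{..<m}. X i \<omega>)
      = PiM {..<m} (\<lambda>_. \<mu>)" .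
  have A': "A \<in> sets (PiM {..<m} (\<lambda>_. euc d))"
    using A sets_PiM_cong[OF refl, of "{..<m}" "\<lambda>_. \<mu>" "\<lambda>_. euc d"] s by simp
  have meas: "(\<lambda>\<omega>. \<lambda>i\<in>{..<m}. X i \<omega>) \<in> measurable P (PiM {..<m} (\<lambda>_. euc d))"
    using rv by (intro measurable_restrict) auto
  show ?thesis
    unfolding eq[symmetric] using meas A'
    by (subst measure_distr) (auto intro!: arg_cong[where f = "measure P"])
qed

end

theory Submission
  imports Defs
begin

text \<open>
  \<^bold>\<open>From transport to survival functions.\<close>  On the line, the quantile coupling and the elementary
  inequality \<open>(a - b)\<^sup>2 \<le> 2 \<bar>a\<bar>a\<bar> - b\<bar>b\<bar>\<bar>\<close> bound \<open>W2(P, Q)\<^sup>2\<close> by twice the integral of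
  \<open>2\<bar>t\<bar> \<bar>S\<^sub>P(t) - S\<^sub>Q(t)\<bar>\<close>, where \<open>S\<close> denotes the survival function
  (\<open>W2_le_signed_square_transport\<close>).  So the squared distance is linear in the deviation of the
  empirical survival function, and no quantile has to be estimated.

  \<^bold>\<open>Truncation.\<close>  The integral is cut at \<open>\<bar>t\<bar> = R\<close>.  The tail of the law is at most
  \<open>L\<^sup>q\<close> times \<open>R\<close> to the power \<open>2 - q\<close>.  The tail of the empirical measure is never estimated
  directly: its whole second moment differs from that of the law by at most \<open>\<rho>\<close>, and the truncated
  second moment is itself an integral of the survival function over \<open>[-R, R]\<close>.  Hence
  everything reduces to \<open>\<rho>\<close>, the tail of the law, and the integral over \<open>[-R, R]\<close>
  (\<open>transport_le_bulk\<close>).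

  \<^bold>\<open>Uniformity over directions.\<close>  For two vectors \<open>v\<close> and \<open>w\<close>, the difference of the deviations of the
  two projections is an average of independent functions of \<open>t\<close>.  By Jensen's inequality the scalar
  Bernstein inequality passes to its integral against \<open>2\<bar>t\<bar> dt\<close> (\<open>integrated_bernstein\<close>); the
  variance term is the integral of \<open>2\<bar>t\<bar> sqrt h(t)\<close>, where \<open>h(t)\<close> is the probability that \<open>t\<close>
  separates \<open>\<langle>X, v\<rangle>\<close> from \<open>\<langle>X, w\<rangle>\<close>.  The moment assumption makes this integral of order
  \<open>sqrt \<bar>v - w\<bar>\<close> (\<open>integral_sqrt_gap_le\<close>), up to the factor that the weight
  \<open>(1 + \<bar>t\<bar>)\<close> to the power \<open>3 - q\<close> contributes on \<open>[-R, R]\<close>.  That factor is bounded for \<open>q > 4\<close> and logarithmic for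
  \<open>q = 4\<close>.
  Because of the decay in \<open>\<bar>v - w\<bar>\<close>, a chaining over nets of the unit ball of
  mesh \<open>2\<close> to the power \<open>-l\<close> loses no logarithm in its variance part (\<open>chain_event\<close>); the range part of
  Bernstein's inequality does lose \<open>log\<^sup>2 (1/\<Delta>)\<close>, with the factor \<open>R\<^sup>2 \<Delta>\<close>, which for \<open>q > 4\<close> is smaller than
  \<open>sqrt \<Delta>\<close> by a power of \<open>\<Delta>\<close> and for \<open>q = 4\<close> equals it.  The chain stops at
  mesh \<open>sqrt \<Delta>\<close>: if \<open>\<rho> \<le> 1\<close>, then the
  empirical measure has second moments at most \<open>2\<close> in every direction, and second moments alone control what is left
  (\<open>dev_residual\<close>).  If \<open>\<rho> > 1\<close>, the claim follows from \<open>W2\<^sup>2 \<le> 2 (2 + \<rho>)\<close>.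

  \<^bold>\<open>Measurability.\<close>  The event involves an uncountable supremum of infima over couplings.
  Both sides of its inequality have an explicit modulus of continuity in the sample, which makes them countable infima of
  measurable functions (\<open>sample_measurable_of_modulus\<close>).  For the distance this rests on
  the fact that moving the atoms of a uniform measure changes \<open>W2\<close> by at most their root mean square displacement
  (\<open>W2_unif_lipschitz\<close>).
\<close>

section \<open>Threshold functions and the signed square\<close>

definition step :: "real \<Rightarrow> real \<Rightarrow> real" where
  "step y t = (if t < y then 1 else 0)"

definition surv :: "real measure \<Rightarrow> real \<Rightarrow> real" where
  "surv P t = measure P {t<..}"

lemma step_measurable [measurable (raw)]:
  assumes [measurable]: "f \<in> borel_measurable M" "g \<in> borel_measurable M"
  shows "(\<lambda>x. step (f x) (g x)) \<in> borel_measurable M"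
  unfolding step_def by measurable

lemma abs_step_le_1: "\<bar>step y t\<bar> \<le> 1"
  and abs_step_diff_le_1: "\<bar>step y t - step z t\<bar> \<le> 1"
  by (auto simp: step_def)

lemma DERIV_signed_square: "((\<lambda>t::real. t * \<bar>t\<bar>) has_real_derivative 2 * \<bar>x\<bar>) (at x)"
proof -
  consider "x > 0" | "x < 0" | "x = 0" by linarith
  then show ?thesis
  proof cases
    case 1
    have "((\<lambda>t::real. t * t) has_real_derivative 2 * \<bar>x\<bar>) (at x)"
      using 1 by (auto intro!: derivative_eq_intros)
    then show ?thesis
      by (rule has_field_derivative_transform_within_open[where S="{0<..}"]) (use 1 in auto)
  next
    case 2
    have "((\<lambda>t::real. - (t * t)) has_real_derivative 2 * \<bar>x\<bar>) (at x)"
      using 2 by (auto intro!: derivative_eq_intros)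
    then show ?thesis
      by (rule has_field_derivative_transform_within_open[where S="{..<0}"]) (use 2 in auto)
  next
    case 3
    have "(\<lambda>h::real. \<bar>h\<bar>) \<midarrow>0\<rightarrow> 0" by (rule tendsto_rabs_zero) simp
    then have "(\<lambda>h::real. ((0 + h) * \<bar>0 + h\<bar> - 0 * \<bar>0\<bar>) / h) \<midarrow>0\<rightarrow> 0"
      by (rule Lim_transform_eventually) (auto simp: eventually_at_filter)
    then show ?thesis using 3 by (simp add: DERIV_def)
  qed
qed

text \<open>
  The signed square \<open>t\<bar>t\<bar>\<close> is the primitive of \<open>2\<bar>t\<bar>\<close>, so its increments are the
  weighted lengths of the intervals between two points.
\<close>

lemma nn_integral_step_diff:
  "(\<integral>\<^sup>+t. ennreal (2 * \<bar>t\<bar> * \<bar>step y t - step z t\<bar>) \<partial>lborel) = ennreal \<bar>y * \<bar>y\<bar> - z * \<bar>z\<bar>\<bar>"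
proof (induction y z rule: linorder_wlog)
  case (le y z)
  have "(\<integral>\<^sup>+t. ennreal (2 * \<bar>t\<bar> * \<bar>step y t - step z t\<bar>) \<partial>lborel)
      = (\<integral>\<^sup>+t. ennreal (2 * \<bar>t\<bar>) * indicator {y..z} t \<partial>lborel)"
    using AE_lborel_singleton[of z]
    by (intro nn_integral_cong_AE, eventually_elim) (use le in \<open>auto simp: step_def indicator_def\<close>)
  also have "\<dots> = ennreal (z * \<bar>z\<bar> - y * \<bar>y\<bar>)"
    using le DERIV_signed_square by (intro nn_integral_FTC_Icc) auto
  finally show ?case
  proof -
    assume *: "(\<integral>\<^sup>+t. ennreal (2 * \<bar>t\<bar> * \<bar>step y t - step z t\<bar>) \<partial>lborel) = ennreal (z * \<bar>z\<bar> - y * \<bar>y\<bar>)"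
    have "y * \<bar>y\<bar> \<le> z * \<bar>z\<bar>"
      using le by (rule DERIV_nonneg_imp_nondecreasing) (use DERIV_signed_square in \<open>force intro!: exI\<close>)
    with * show ?thesis by (simp add: abs_if)
  qed
next
  case (sym y z)
  then show ?case by (simp add: abs_minus_commute)
qed

lemma square_diff_le: "(a - b)\<^sup>2 \<le> 2 * \<bar>a * \<bar>a\<bar> - b * \<bar>b\<bar>\<bar>" for a b :: real
proof (induction a b rule: linorder_wlog)
  case (le a b)
  consider "0 \<le> a" | "b \<le> 0" | "a < 0" "0 < b" by linarith
  then show ?case
  proof cases
    case 1
    then have "(a - b)\<^sup>2 \<le> b\<^sup>2 - a\<^sup>2"
      using le mult_left_mono[of a b a] by (auto simp: power2_eq_square algebra_simps)
    with 1 le show ?thesis by (auto simp: power2_eq_square abs_if split: if_splits)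
  next
    case 2
    then have "(a - b)\<^sup>2 \<le> a\<^sup>2 - b\<^sup>2"
      using le mult_left_mono_neg[of a b b] by (auto simp: power2_eq_square algebra_simps)
    with 2 le show ?thesis by (auto simp: power2_eq_square abs_if split: if_splits)
  next
    case 3
    have "0 \<le> (a + b)\<^sup>2" by simp
    with 3 show ?thesis by (auto simp: power2_eq_square algebra_simps abs_if split: if_splits)
  qed
next
  case (sym a b)
  then show ?case by (simp add: abs_minus_commute power2_commute)
qed

lemma surv_eq_integral:
  assumes "prob_space P" "sets P = sets borel"
  shows "surv P t = (\<integral>y. step y t \<partial>P)"
proof -
  interpret prob_space P by fact
  have "(\<integral>y. step y t \<partial>P) = (\<integral>y. indicator {t<..} y \<partial>P)"
    by (intro Bochner_Integration.integral_cong) (auto simp: step_def)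
  then show ?thesis
    using assms(2) by (simp add: surv_def)
qed

lemma surv_measurable [measurable]:
  assumes "prob_space P" "sets P = sets borel"
  shows "surv P \<in> borel_measurable borel"
proof -
  interpret prob_space P by fact
  note assms(2)[measurable_cong]
  have "(\<lambda>t. (\<integral>y. step y t \<partial>P)) \<in> borel_measurable borel" by measurable
  then show ?thesis using surv_eq_integral[OF assms] by (simp cong: measurable_cong)
qed

lemma surv_bounds: "prob_space P \<Longrightarrow> 0 \<le> surv P t \<and> surv P t \<le> 1"
  by (auto simp: surv_def prob_space.prob_le_1)

lemma enn_powr_half_mono: "a \<le> b \<Longrightarrow> enn_powr a (1/2) \<le> enn_powr b (1/2)"
  by (cases a; cases b) (auto simp: enn_powr_def top_unique intro!: ennreal_leI powr_mono2)

lemma enn_powr_half_square: "0 \<le> r \<Longrightarrow> enn_powr (ennreal (r\<^sup>2)) (1/2) = ennreal r"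
  by (simp add: enn_powr_def powr_half_sqrt)

text \<open>
  The coupling is the quantile coupling, that is, the image of the uniform distribution on \<open>(0, 1)\<close> under
  both quantile functions.  Its cost is bounded by the distance of the signed squares; writing that
  as an integral over thresholds \<open>t\<close> and exchanging the integrals leaves, for each \<open>t\<close>, the
  length of the interval between the two values of the distribution functions at \<open>t\<close>.
\<close>

lemma W2_le_signed_square_transport:
  assumes P: "prob_space P" "sets P = sets borel" and Q: "prob_space Q" "sets Q = sets borel"
  shows "W2 P Q \<le> enn_powr (2 * (\<integral>\<^sup>+t. ennreal (2 * \<bar>t\<bar> * \<bar>surv P t - surv Q t\<bar>) \<partial>lborel)) (1 / 2)"
proof -
  interpret P: cdf_distribution P
    using P by (auto simp: cdf_distribution_def real_distribution_def real_distribution_axioms_def sets_eq_imp_space_eq)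
  interpret Q: cdf_distribution Q
    using Q by (auto simp: cdf_distribution_def real_distribution_def real_distribution_axioms_def sets_eq_imp_space_eq)
  let ?U = "restrict_space lborel {0<..<1} :: real measure"
  interpret U: prob_space ?U
    by (auto simp add: emeasure_restrict_space space_restrict_space intro!: prob_spaceI)
  have [measurable]: "P.I \<in> borel_measurable ?U" "Q.I \<in> borel_measurable ?U"
    using P.measurable_CI Q.measurable_CI by (auto cong: measurable_cong_sets simp: sets_restrict_space)
  have sets1: "sets (P \<Otimes>\<^sub>M Q) = sets (borel \<Otimes>\<^sub>M borel)"
    by (rule sets_pair_measure_cong) auto
  have mp [measurable]: "(\<lambda>u. (P.I u, Q.I u)) \<in> measurable ?U (P \<Otimes>\<^sub>M Q)"
    by (subst measurable_cong_sets[OF refl sets1]) measurable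
  have distrP: "distr ?U borel P.I = P" and distrQ: "distr ?U borel Q.I = Q"
    using P.distr_I_eq_M Q.distr_I_eq_M by auto
  define K where "K = distr ?U (P \<Otimes>\<^sub>M Q) (\<lambda>u. (P.I u, Q.I u))"
  have "distr K P fst = distr ?U P P.I" "distr K Q snd = distr ?U Q Q.I"
    unfolding K_def by (subst distr_distr; simp add: o_def)+
  moreover have "distr ?U P P.I = distr ?U borel P.I" "distr ?U Q Q.I = distr ?U borel Q.I"
    by (auto intro!: distr_cong)
  ultimately have K: "K \<in> couplings P Q"
    using distrP distrQ by (simp add: couplings_def K_def)
  have survC: "surv P t = 1 - cdf P t" "surv Q t = 1 - cdf Q t" for t
    using P.prob_compl[of "{..t}"] Q.prob_compl[of "{..t}"]
    by (auto simp: surv_def cdf_def Compl_eq_Diff_UNIV[symmetric])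
  have inner: "(\<integral>\<^sup>+u. ennreal (2 * \<bar>t\<bar> * \<bar>step (P.I u) t - step (Q.I u) t\<bar>) \<partial>?U)
      = ennreal (2 * \<bar>t\<bar> * \<bar>surv P t - surv Q t\<bar>)" for t
  proof -
    have le: "(\<integral>\<^sup>+u. ennreal (2 * \<bar>t\<bar> * \<bar>step (P.I u) t - step (Q.I u) t\<bar>) \<partial>?U) =
      ennreal (2 * \<bar>t\<bar>) * emeasure lborel {min (cdf P t) (cdf Q t)<..max (cdf P t) (cdf Q t)}"
    proof -
      have c: "cdf P t \<in> {0..1}" "cdf Q t \<in> {0..1}"
        using P.cdf_bounded_prob Q.cdf_bounded_prob P.cdf_nonneg Q.cdf_nonneg by auto
      have "(\<integral>\<^sup>+u. ennreal (2 * \<bar>t\<bar> * \<bar>step (P.I u) t - step (Q.I u) t\<bar>) \<partial>?U)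
          = (\<integral>\<^sup>+u. ennreal (2 * \<bar>t\<bar> * \<bar>step (P.I u) t - step (Q.I u) t\<bar>) * indicator {0<..<1} u \<partial>lborel)"
        by (subst nn_integral_restrict_space) auto
      also have "\<dots> = (\<integral>\<^sup>+u. ennreal (2 * \<bar>t\<bar>) * indicator {min (cdf P t) (cdf Q t)<..max (cdf P t) (cdf Q t)} u \<partial>lborel)"
      proof (rule nn_integral_cong_AE)
        have eq: "ennreal (2 * \<bar>t\<bar> * \<bar>step (P.I u) t - step (Q.I u) t\<bar>) * indicator {0<..<1} u
            = ennreal (2 * \<bar>t\<bar>) * indicator {min (cdf P t) (cdf Q t)<..max (cdf P t) (cdf Q t)} u"
          if "u \<noteq> 1" for u
        proof (cases "u \<in> {0<..<1}")
          case True
          then have "P.I u \<le> t \<longleftrightarrow> u \<le> cdf P t" "Q.I u \<le> t \<longleftrightarrow> u \<le> cdf Q t"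
            using P.pseudoinverse[of u t] Q.pseudoinverse[of u t] by auto
          then show ?thesis using True
            by (auto simp: step_def indicator_def not_le[symmetric] min_def max_def)
        next
          case False
          then have "u \<notin> {min (cdf P t) (cdf Q t)<..max (cdf P t) (cdf Q t)}"
            using c that by auto
          then show ?thesis using False by simp
        qed
        show "AE u in lborel. ennreal (2 * \<bar>t\<bar> * \<bar>step (P.I u) t - step (Q.I u) t\<bar>) * indicator {0<..<1} u
            = ennreal (2 * \<bar>t\<bar>) * indicator {min (cdf P t) (cdf Q t)<..max (cdf P t) (cdf Q t)} u"
          by (intro eventually_mono[OF AE_lborel_singleton[of "1::real"]] eq)
      qed
      finally show ?thesis by (simp add: nn_integral_cmult)
    qed
    show ?thesis unfolding le survC
      by (auto simp: min_def max_def ennreal_mult[symmetric] intro!: arg_cong[where f=ennreal])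
  qed
  have "(\<integral>\<^sup>+z. ennreal ((norm (fst z - snd z))\<^sup>2) \<partial>K) = (\<integral>\<^sup>+u. ennreal ((P.I u - Q.I u)\<^sup>2) \<partial>?U)"
    unfolding K_def by (subst nn_integral_distr) auto
  also have "\<dots> \<le> (\<integral>\<^sup>+u. 2 * ennreal \<bar>P.I u * \<bar>P.I u\<bar> - Q.I u * \<bar>Q.I u\<bar>\<bar> \<partial>?U)"
    by (intro nn_integral_mono)
       (use square_diff_le in \<open>auto simp: ennreal_mult'[symmetric] ennreal_numeral[symmetric] simp del: ennreal_numeral\<close>)
  also have "\<dots> = 2 * (\<integral>\<^sup>+u. (\<integral>\<^sup>+t. ennreal (2 * \<bar>t\<bar> * \<bar>step (P.I u) t - step (Q.I u) t\<bar>) \<partial>lborel) \<partial>?U)"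
    unfolding nn_integral_step_diff by (subst nn_integral_cmult) auto
  also have "(\<integral>\<^sup>+u. (\<integral>\<^sup>+t. ennreal (2 * \<bar>t\<bar> * \<bar>step (P.I u) t - step (Q.I u) t\<bar>) \<partial>lborel) \<partial>?U)
      = (\<integral>\<^sup>+t. (\<integral>\<^sup>+u. ennreal (2 * \<bar>t\<bar> * \<bar>step (P.I u) t - step (Q.I u) t\<bar>) \<partial>?U) \<partial>lborel)"
  proof -
    interpret pair_sigma_finite ?U "lborel :: real measure" ..
    show ?thesis by (subst Fubini') auto
  qed
  also have "\<dots> = (\<integral>\<^sup>+t. ennreal (2 * \<bar>t\<bar> * \<bar>surv P t - surv Q t\<bar>) \<partial>lborel)"
    unfolding inner ..
  finally have cost: "(\<integral>\<^sup>+z. ennreal ((norm (fst z - snd z))\<^sup>2) \<partial>K)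
    \<le> 2 * (\<integral>\<^sup>+t. ennreal (2 * \<bar>t\<bar> * \<bar>surv P t - surv Q t\<bar>) \<partial>lborel)" .
  show ?thesis
    unfolding W2_def by (rule INF_lower2[OF K]) (rule enn_powr_half_mono[OF cost])
qed

section \<open>Truncation at a finite level\<close>

text \<open>
  The restriction to \<open>[-R, R]\<close> of the weight that belongs to the signed square.
\<close>

definition wt :: "real \<Rightarrow> real measure" where
  "wt R = density lborel (\<lambda>t. ennreal (indicator {-R..R} t * (2 * \<bar>t\<bar>)))"

definition bulk :: "real \<Rightarrow> real measure \<Rightarrow> real measure \<Rightarrow> real" where
  "bulk R P Q = (\<integral>t. \<bar>surv P t - surv Q t\<bar> \<partial>wt R)"

lemma sets_wt [simp, measurable_cong]: "sets (wt R) = sets borel"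
  and space_wt [simp]: "space (wt R) = UNIV"
  by (auto simp: wt_def)

lemma nn_integral_wt:
  assumes [measurable]: "f \<in> borel_measurable borel" and "\<And>t. 0 \<le> f t"
  shows "(\<integral>\<^sup>+t. ennreal (f t) \<partial>wt R) = (\<integral>\<^sup>+t. ennreal (2 * \<bar>t\<bar> * f t) * indicator {-R..R} t \<partial>lborel)"
  unfolding wt_def using assms(2)
  by (subst nn_integral_density)
     (auto intro!: nn_integral_cong simp: ennreal_mult[symmetric] indicator_def)

lemma emeasure_wt: "R \<ge> 0 \<Longrightarrow> emeasure (wt R) UNIV = ennreal (2 * R\<^sup>2)"
proof -
  assume R: "R \<ge> 0"
  have "emeasure (wt R) UNIV = (\<integral>\<^sup>+t. ennreal (2 * \<bar>t\<bar>) * indicator {-R..R} t \<partial>lborel)"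
    using nn_integral_wt[of "\<lambda>_. 1" R] by simp
  also have "\<dots> = ennreal (R * \<bar>R\<bar> - (- R) * \<bar>- R\<bar>)"
    using R DERIV_signed_square by (intro nn_integral_FTC_Icc) auto
  finally show ?thesis using R by (simp add: power2_eq_square)
qed

lemma finite_measure_wt: "R \<ge> 0 \<Longrightarrow> finite_measure (wt R)"
  by (rule finite_measureI) (simp add: emeasure_wt)

lemma integrable_wt_bounded:
  fixes f :: "real \<Rightarrow> real"
  assumes "R \<ge> 0" "f \<in> borel_measurable borel" "\<And>t. \<bar>f t\<bar> \<le> B"
  shows "integrable (wt R) f"
  using assms by (intro finite_measure.integrable_const_bound[OF finite_measure_wt, where B=B]) auto

lemma integral_wt_step_diff:
  assumes R: "R \<ge> 0"
  shows "(\<integral>t. \<bar>step y t - step 0 t\<bar> \<partial>wt R) = min (y\<^sup>2) (R\<^sup>2)"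
proof -
  define z where "z = max (- R) (min y R)"
  have "(\<integral>\<^sup>+t. ennreal \<bar>step y t - step 0 t\<bar> \<partial>wt R)
      = (\<integral>\<^sup>+t. ennreal (2 * \<bar>t\<bar> * \<bar>step y t - step 0 t\<bar>) * indicator {-R..R} t \<partial>lborel)"
    by (rule nn_integral_wt) auto
  also have "\<dots> = (\<integral>\<^sup>+t. ennreal (2 * \<bar>t\<bar> * \<bar>step z t - step 0 t\<bar>) \<partial>lborel)"
  proof (rule nn_integral_cong_AE)
    have "ennreal (2 * \<bar>t\<bar> * \<bar>step y t - step 0 t\<bar>) * indicator {-R..R} t = ennreal (2 * \<bar>t\<bar> * \<bar>step z t - step 0 t\<bar>)"
      if "t \<noteq> R" for t
      using that R by (auto simp: z_def step_def indicator_def)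
    then show "AE t in lborel. ennreal (2 * \<bar>t\<bar> * \<bar>step y t - step 0 t\<bar>) * indicator {-R..R} t
        = ennreal (2 * \<bar>t\<bar> * \<bar>step z t - step 0 t\<bar>)"
      by (intro eventually_mono[OF AE_lborel_singleton[of R]])
  qed
  also have "\<dots> = ennreal \<bar>z * \<bar>z\<bar>\<bar>"
    using nn_integral_step_diff[of z 0] by simp
  also have "\<bar>z * \<bar>z\<bar>\<bar> = (min \<bar>y\<bar> R)\<^sup>2"
    using R by (auto simp: z_def power2_eq_square abs_mult min_def max_def)
  also have "\<dots> = min (y\<^sup>2) (R\<^sup>2)"
    using R by (auto simp: min_def abs_le_square_iff[symmetric])
  finally have "(\<integral>\<^sup>+t. ennreal \<bar>step y t - step 0 t\<bar> \<partial>wt R) = ennreal (min (y\<^sup>2) (R\<^sup>2))" .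
  then show ?thesis
    by (subst integral_eq_nn_integral) auto
qed

lemma nn_integral_step_diff_outside:
  assumes R: "R \<ge> 0"
  shows "(\<integral>\<^sup>+t. ennreal (2 * \<bar>t\<bar> * \<bar>step y t - step 0 t\<bar>) * indicator (- {-R..R}) t \<partial>lborel) \<le> ennreal (max 0 (y\<^sup>2 - R\<^sup>2))"
proof -
  define z where "z = max (- R) (min y R)"
  have "(\<integral>\<^sup>+t. ennreal (2 * \<bar>t\<bar> * \<bar>step y t - step 0 t\<bar>) * indicator (- {-R..R}) t \<partial>lborel)
      \<le> (\<integral>\<^sup>+t. ennreal (2 * \<bar>t\<bar> * \<bar>step y t - step z t\<bar>) \<partial>lborel)"
    using R by (intro nn_integral_mono) (auto simp: z_def step_def indicator_def)
  also have "\<dots> = ennreal \<bar>y * \<bar>y\<bar> - z * \<bar>z\<bar>\<bar>" by (rule nn_integral_step_diff)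
  also have "\<bar>y * \<bar>y\<bar> - z * \<bar>z\<bar>\<bar> = max 0 (y\<^sup>2 - R\<^sup>2)"
  proof -
    consider "\<bar>y\<bar> \<le> R" | "y > R" | "y < - R" by linarith
    then show ?thesis
    proof cases
      case 1
      then have "y\<^sup>2 \<le> R\<^sup>2" using R by (simp add: abs_le_square_iff[symmetric])
      with 1 show ?thesis by (auto simp: z_def)
    next
      case 2
      then have "R\<^sup>2 \<le> y\<^sup>2" using R by (simp add: power_mono)
      with 2 R show ?thesis by (auto simp: z_def power2_eq_square)
    next
      case 3
      then have "R\<^sup>2 \<le> y\<^sup>2" using R by (simp add: abs_le_square_iff[symmetric])
      with 3 R show ?thesis by (auto simp: z_def power2_eq_square)
    qed
  qed
  finally show ?thesis .
qed

text \<open>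
  The truncated second moment is a linear functional of the survival function on \<open>[-R, R]\<close>.  The sign
  turns \<open>\<bar>step y t - step 0 t\<bar>\<close> into a difference, which can be averaged over \<open>y\<close>.
\<close>

lemma integral_min_square_eq:
  assumes P: "prob_space P" "sets P = sets borel" and R: "R \<ge> 0"
  shows "(\<integral>y. min (y\<^sup>2) (R\<^sup>2) \<partial>P) = (\<integral>t. sgn t * (surv P t - step 0 t) \<partial>wt R)"
proof -
  interpret P: prob_space P by fact
  note P(2)[measurable_cong]
  interpret W: finite_measure "wt R" using R by (rule finite_measure_wt)
  interpret pair_sigma_finite P "wt R" ..
  interpret PW: finite_measure "P \<Otimes>\<^sub>M wt R"
    by (rule finite_measure_pair_measure) unfold_locales
  have abs_eq: "AE t in wt R. \<bar>step y t - step 0 t\<bar> = sgn t * (step y t - step 0 t)" for y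
  proof -
    have "AE t in lborel. t \<noteq> (0::real)" by (rule AE_lborel_singleton)
    then have "AE t in wt R. t \<noteq> 0"
      unfolding wt_def by (subst AE_density) (auto elim: eventually_mono)
    then show ?thesis
      by (rule eventually_mono) (auto simp: step_def sgn_if)
  qed
  have "(\<integral>y. min (y\<^sup>2) (R\<^sup>2) \<partial>P) = (\<integral>y. (\<integral>t. \<bar>step y t - step 0 t\<bar> \<partial>wt R) \<partial>P)"
    using integral_wt_step_diff[OF R] by simp
  also have "\<dots> = (\<integral>y. (\<integral>t. sgn t * (step y t - step 0 t) \<partial>wt R) \<partial>P)"
    using abs_eq by (intro Bochner_Integration.integral_cong refl integral_cong_AE) auto
  also have "\<dots> = (\<integral>t. (\<integral>y. sgn t * (step y t - step 0 t) \<partial>P) \<partial>wt R)"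
    by (rule Fubini_integral[symmetric], rule PW.integrable_const_bound[where B=1])
       (auto simp: step_def abs_mult sgn_if)
  also have "\<dots> = (\<integral>t. sgn t * (surv P t - step 0 t) \<partial>wt R)"
  proof (intro Bochner_Integration.integral_cong refl)
    fix t
    have "integrable P (\<lambda>y. step y t)"
      by (rule P.integrable_const_bound[where B=1]) (auto simp: step_def)
    then show "(\<integral>y. sgn t * (step y t - step 0 t) \<partial>P) = sgn t * (surv P t - step 0 t)"
      using surv_eq_integral[OF P] by (simp add: P.prob_space)
  qed
  finally show ?thesis .
qed

lemma bulk_nonneg: "0 \<le> bulk R P Q"
  by (simp add: bulk_def)

lemma min_square_gap_le_bulk:
  assumes P: "prob_space P" "sets P = sets borel" and Q: "prob_space Q" "sets Q = sets borel"
    and R: "R \<ge> 0"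
  shows "\<bar>(\<integral>y. min (y\<^sup>2) (R\<^sup>2) \<partial>P) - (\<integral>y. min (y\<^sup>2) (R\<^sup>2) \<partial>Q)\<bar> \<le> bulk R P Q"
proof -
  note [measurable] = surv_measurable[OF P] surv_measurable[OF Q]
  have b: "\<bar>surv P t - step 0 t\<bar> \<le> 1" "\<bar>surv Q t - step 0 t\<bar> \<le> 1" "\<bar>surv P t - surv Q t\<bar> \<le> 1" for t
    using surv_bounds[OF P(1), of t] surv_bounds[OF Q(1), of t] by (auto simp: step_def)
  have sg: "\<bar>sgn t * u\<bar> \<le> 1" if "\<bar>u\<bar> \<le> 1" for t u :: real
    using that by (auto simp: abs_mult sgn_if)
  have iP: "integrable (wt R) (\<lambda>t. sgn t * (surv P t - step 0 t))"
    and iQ: "integrable (wt R) (\<lambda>t. sgn t * (surv Q t - step 0 t))"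
    by (intro integrable_wt_bounded[OF R, where B=1] sg b; measurable)+
  have "(\<integral>y. min (y\<^sup>2) (R\<^sup>2) \<partial>P) - (\<integral>y. min (y\<^sup>2) (R\<^sup>2) \<partial>Q)
      = (\<integral>t. sgn t * (surv P t - surv Q t) \<partial>wt R)"
    unfolding integral_min_square_eq[OF P R] integral_min_square_eq[OF Q R]
    by (subst Bochner_Integration.integral_diff[symmetric, OF iP iQ]) (simp add: algebra_simps)
  also have "\<bar>\<dots>\<bar> \<le> (\<integral>t. \<bar>sgn t * (surv P t - surv Q t)\<bar> \<partial>wt R)"
    by (rule integral_abs_bound)
  also have "\<dots> \<le> bulk R P Q"
    unfolding bulk_def
    by (intro integral_mono integrable_wt_bounded[OF R, where B=1])
       (use b sg in \<open>auto simp: abs_mult sgn_if\<close>)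
  finally show ?thesis .
qed

lemma nn_integral_surv_diff_le:
  assumes P: "prob_space P" "sets P = sets borel" and Q: "prob_space Q" "sets Q = sets borel"
    and A [measurable]: "A \<in> sets borel"
  shows "(\<integral>\<^sup>+t. ennreal (2 * \<bar>t\<bar> * \<bar>surv P t - surv Q t\<bar>) * indicator A t \<partial>lborel)
    \<le> (\<integral>\<^sup>+y. (\<integral>\<^sup>+t. ennreal (2 * \<bar>t\<bar> * \<bar>step y t - step 0 t\<bar>) * indicator A t \<partial>lborel) \<partial>P)
     + (\<integral>\<^sup>+y. (\<integral>\<^sup>+t. ennreal (2 * \<bar>t\<bar> * \<bar>step y t - step 0 t\<bar>) * indicator A t \<partial>lborel) \<partial>Q)"
proof -
  interpret P: prob_space P by fact
  interpret Q: prob_space Q by fact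
  note P(2)[measurable_cong] Q(2)[measurable_cong]
  interpret PL: pair_sigma_finite P "lborel :: real measure" ..
  interpret QL: pair_sigma_finite Q "lborel :: real measure" ..
  have one: "ennreal \<bar>surv P t - step 0 t\<bar> \<le> (\<integral>\<^sup>+y. ennreal \<bar>step y t - step 0 t\<bar> \<partial>P)"
    if P: "prob_space P" "sets P = sets borel" for P t
  proof -
    interpret P': prob_space P by fact
    note P(2)[measurable_cong]
    have i: "integrable P (\<lambda>y. step y t)" 
      by (rule P'.integrable_const_bound[where B=1]) (auto simp: step_def)
    have "surv P t - step 0 t = (\<integral>y. step y t - step 0 t \<partial>P)"
      using surv_eq_integral[OF P] i by (simp add: P'.prob_space)
    then show ?thesis
      using integral_norm_bound_ennreal[of P "\<lambda>y. step y t - step 0 t"] i by simp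
  qed
  have "ennreal (2 * \<bar>t\<bar> * \<bar>surv P t - surv Q t\<bar>) * indicator A t
      \<le> (\<integral>\<^sup>+y. ennreal (2 * \<bar>t\<bar> * \<bar>step y t - step 0 t\<bar>) * indicator A t \<partial>P)
      + (\<integral>\<^sup>+y. ennreal (2 * \<bar>t\<bar> * \<bar>step y t - step 0 t\<bar>) * indicator A t \<partial>Q)" for t
  proof -
    have "ennreal \<bar>surv P t - surv Q t\<bar> \<le> ennreal \<bar>surv P t - step 0 t\<bar> + ennreal \<bar>surv Q t - step 0 t\<bar>"
      by (auto simp flip: ennreal_plus intro!: ennreal_leI)
    also have "\<dots> \<le> (\<integral>\<^sup>+y. ennreal \<bar>step y t - step 0 t\<bar> \<partial>P) + (\<integral>\<^sup>+y. ennreal \<bar>step y t - step 0 t\<bar> \<partial>Q)"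
      by (intro add_mono one P Q)
    finally have "ennreal (2 * \<bar>t\<bar>) * ennreal \<bar>surv P t - surv Q t\<bar> * indicator A t
      \<le> ennreal (2 * \<bar>t\<bar>) * ((\<integral>\<^sup>+y. ennreal \<bar>step y t - step 0 t\<bar> \<partial>P) + (\<integral>\<^sup>+y. ennreal \<bar>step y t - step 0 t\<bar> \<partial>Q)) * indicator A t"
      by (intro mult_mono) auto
    then show ?thesis
      by (simp add: ennreal_mult nn_integral_cmult nn_integral_multc distrib_left distrib_right)
  qed
  then have "(\<integral>\<^sup>+t. ennreal (2 * \<bar>t\<bar> * \<bar>surv P t - surv Q t\<bar>) * indicator A t \<partial>lborel)
    \<le> (\<integral>\<^sup>+t. (\<integral>\<^sup>+y. ennreal (2 * \<bar>t\<bar> * \<bar>step y t - step 0 t\<bar>) * indicator A t \<partial>P)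
      + (\<integral>\<^sup>+y. ennreal (2 * \<bar>t\<bar> * \<bar>step y t - step 0 t\<bar>) * indicator A t \<partial>Q) \<partial>lborel)"
    by (intro nn_integral_mono) auto
  also have "\<dots> = (\<integral>\<^sup>+t. (\<integral>\<^sup>+y. ennreal (2 * \<bar>t\<bar> * \<bar>step y t - step 0 t\<bar>) * indicator A t \<partial>P) \<partial>lborel)
      + (\<integral>\<^sup>+t. (\<integral>\<^sup>+y. ennreal (2 * \<bar>t\<bar> * \<bar>step y t - step 0 t\<bar>) * indicator A t \<partial>Q) \<partial>lborel)"
    by (rule nn_integral_add) measurable
  also have "\<dots> = (\<integral>\<^sup>+y. (\<integral>\<^sup>+t. ennreal (2 * \<bar>t\<bar> * \<bar>step y t - step 0 t\<bar>) * indicator A t \<partial>lborel) \<partial>P)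
     + (\<integral>\<^sup>+y. (\<integral>\<^sup>+t. ennreal (2 * \<bar>t\<bar> * \<bar>step y t - step 0 t\<bar>) * indicator A t \<partial>lborel) \<partial>Q)"
    by (intro arg_cong2[where f="(+)"] PL.Fubini' QL.Fubini'; measurable)
  finally show ?thesis .
qed

text \<open>
  A bound that remains useful when the second moments are far apart.
\<close>

lemma transport_le_second_moments:
  assumes P: "prob_space P" "sets P = sets borel" and Q: "prob_space Q" "sets Q = sets borel"
    and iP: "integrable P (\<lambda>y. y\<^sup>2)" and iQ: "integrable Q (\<lambda>y. y\<^sup>2)"
  shows "(\<integral>\<^sup>+t. ennreal (2 * \<bar>t\<bar> * \<bar>surv P t - surv Q t\<bar>) \<partial>lborel)
    \<le> ennreal ((\<integral>y. y\<^sup>2 \<partial>P) + (\<integral>y. y\<^sup>2 \<partial>Q))"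
proof -
  have "(\<integral>\<^sup>+t. ennreal (2 * \<bar>t\<bar> * \<bar>step y t - step 0 t\<bar>) \<partial>lborel) = ennreal (y\<^sup>2)" for y
    using nn_integral_step_diff[of y 0] by (simp add: abs_mult power2_eq_square)
  then show ?thesis
    using nn_integral_surv_diff_le[OF P Q, of UNIV] nn_integral_eq_integral[OF iP] nn_integral_eq_integral[OF iQ]
    by simp
qed

text \<open>
  Outside \<open>[-R, R]\<close> the integral is at most the sum of the two tails.  The tail of \<open>P\<close> is its second moment
  minus its truncated second moment, and each of these is compared with that of \<open>Q\<close>; so
  only the tail of \<open>Q\<close> remains, and \<open>P\<close> may be a random measure about whose tail nothing is known.
\<close>

lemma transport_le_bulk:
  assumes P: "prob_space P" "sets P = sets borel" and Q: "prob_space Q" "sets Q = sets borel"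
    and iP: "integrable P (\<lambda>y. y\<^sup>2)" and iQ: "integrable Q (\<lambda>y. y\<^sup>2)" and R: "R \<ge> 0"
  shows "(\<integral>\<^sup>+t. ennreal (2 * \<bar>t\<bar> * \<bar>surv P t - surv Q t\<bar>) \<partial>lborel)
    \<le> ennreal (2 * bulk R P Q + \<bar>(\<integral>y. y\<^sup>2 \<partial>P) - (\<integral>y. y\<^sup>2 \<partial>Q)\<bar> + 2 * (\<integral>y. max 0 (y\<^sup>2 - R\<^sup>2) \<partial>Q))"
proof -
  interpret P: prob_space P by fact
  interpret Q: prob_space Q by fact
  note P(2)[measurable_cong] Q(2)[measurable_cong]
  note [measurable] = surv_measurable[OF P] surv_measurable[OF Q]
  let ?f = "\<lambda>t. ennreal (2 * \<bar>t\<bar> * \<bar>surv P t - surv Q t\<bar>)"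
  have tail: "integrable M (\<lambda>y. max 0 (y\<^sup>2 - R\<^sup>2)) \<and> integrable M (\<lambda>y. min (y\<^sup>2) (R\<^sup>2)) \<and>
      (\<integral>y. max 0 (y\<^sup>2 - R\<^sup>2) \<partial>M) = (\<integral>y. y\<^sup>2 \<partial>M) - (\<integral>y. min (y\<^sup>2) (R\<^sup>2) \<partial>M)"
    if M: "prob_space M" "sets M = sets borel" "integrable M (\<lambda>y. y\<^sup>2)" for M
  proof -
    interpret M: prob_space M by fact
    note M(2)[measurable_cong]
    have i: "integrable M (\<lambda>y. min (y\<^sup>2) (R\<^sup>2))"
      by (rule M.integrable_const_bound[where B="R\<^sup>2"]) auto
    have eq: "max 0 (y\<^sup>2 - R\<^sup>2) = y\<^sup>2 - min (y\<^sup>2) (R\<^sup>2)" for y by auto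
    show ?thesis unfolding eq using i M(3) by simp
  qed
  have "(\<integral>\<^sup>+t. ?f t \<partial>lborel) = (\<integral>\<^sup>+t. ?f t * indicator {-R..R} t + ?f t * indicator (- {-R..R}) t \<partial>lborel)"
    by (intro nn_integral_cong) (auto simp: indicator_def)
  also have "\<dots> = (\<integral>\<^sup>+t. ?f t * indicator {-R..R} t \<partial>lborel) + (\<integral>\<^sup>+t. ?f t * indicator (- {-R..R}) t \<partial>lborel)"
    by (rule nn_integral_add) measurable
  also have "(\<integral>\<^sup>+t. ?f t * indicator {-R..R} t \<partial>lborel) = ennreal (bulk R P Q)"
  proof -
    have "\<bar>surv P t - surv Q t\<bar> \<le> 1" for t
      using surv_bounds[OF P(1), of t] surv_bounds[OF Q(1), of t] by auto
    then show ?thesis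
      unfolding bulk_def
      by (subst nn_integral_wt[symmetric])
         (auto intro!: nn_integral_eq_integral integrable_wt_bounded[OF R, where B=1])
  qed
  also have "(\<integral>\<^sup>+t. ?f t * indicator (- {-R..R}) t \<partial>lborel)
    \<le> (\<integral>\<^sup>+y. ennreal (max 0 (y\<^sup>2 - R\<^sup>2)) \<partial>P) + (\<integral>\<^sup>+y. ennreal (max 0 (y\<^sup>2 - R\<^sup>2)) \<partial>Q)"
    by (rule order_trans[OF nn_integral_surv_diff_le[OF P Q]])
       (simp, intro add_mono nn_integral_mono nn_integral_step_diff_outside R)
  also have "\<dots> = ennreal ((\<integral>y. max 0 (y\<^sup>2 - R\<^sup>2) \<partial>P) + (\<integral>y. max 0 (y\<^sup>2 - R\<^sup>2) \<partial>Q))"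
  proof -
    have "(\<integral>\<^sup>+y. ennreal (max 0 (y\<^sup>2 - R\<^sup>2)) \<partial>P) = ennreal (\<integral>y. max 0 (y\<^sup>2 - R\<^sup>2) \<partial>P)"
      "(\<integral>\<^sup>+y. ennreal (max 0 (y\<^sup>2 - R\<^sup>2)) \<partial>Q) = ennreal (\<integral>y. max 0 (y\<^sup>2 - R\<^sup>2) \<partial>Q)"
      using tail[OF P iP] tail[OF Q iQ] by (intro nn_integral_eq_integral; simp)+
    then show ?thesis by (simp only:) (rule ennreal_plus[symmetric]; simp)
  qed
  also have "ennreal (bulk R P Q) + \<dots> = ennreal (bulk R P Q + ((\<integral>y. max 0 (y\<^sup>2 - R\<^sup>2) \<partial>P) + (\<integral>y. max 0 (y\<^sup>2 - R\<^sup>2) \<partial>Q)))"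
    by (rule ennreal_plus[symmetric]) (auto simp: bulk_nonneg intro!: add_nonneg_nonneg)
  also have "\<dots> \<le> ennreal (2 * bulk R P Q + \<bar>(\<integral>y. y\<^sup>2 \<partial>P) - (\<integral>y. y\<^sup>2 \<partial>Q)\<bar> + 2 * (\<integral>y. max 0 (y\<^sup>2 - R\<^sup>2) \<partial>Q))"
    using tail[OF P iP] tail[OF Q iQ] min_square_gap_le_bulk[OF P Q R] by (intro ennreal_leI) linarith
  finally show ?thesis by (simp add: add_left_mono)
qed

section \<open>Two random variables on one probability space\<close>

lemma surv_distr:
  assumes "prob_space M" and [measurable]: "X \<in> borel_measurable M"
  shows "surv (distr M borel X) t = (\<integral>x. step (X x) t \<partial>M)"
proof -
  interpret prob_space M by fact
  have "prob_space (distr M borel X)" by (rule prob_space_distr) simp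
  then show ?thesis by (simp add: surv_eq_integral integral_distr)
qed

context prob_space
begin

definition gap :: "('a \<Rightarrow> real) \<Rightarrow> ('a \<Rightarrow> real) \<Rightarrow> real \<Rightarrow> real" where
  "gap X Y t = (\<integral>x. \<bar>step (X x) t - step (Y x) t\<bar> \<partial>M)"

lemma integrable_step_diff:
  assumes [measurable]: "X \<in> borel_measurable M" "Y \<in> borel_measurable M"
  shows "integrable M (\<lambda>x. step (X x) t)" "integrable M (\<lambda>x. \<bar>step (X x) t - step (Y x) t\<bar>)"
  by (rule integrable_const_bound[where B=1]; simp add: abs_step_le_1 abs_step_diff_le_1)+

lemma gap_bounds:
  assumes [measurable]: "X \<in> borel_measurable M" "Y \<in> borel_measurable M"
  shows "0 \<le> gap X Y t" "gap X Y t \<le> 1"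
  unfolding gap_def
  by (auto intro!: integral_le_const integrable_step_diff AE_I2 abs_step_diff_le_1)

lemma gap_measurable [measurable]:
  assumes [measurable]: "X \<in> borel_measurable M" "Y \<in> borel_measurable M"
  shows "gap X Y \<in> borel_measurable borel"
  unfolding gap_def by measurable

lemma surv_diff_le_gap:
  assumes [measurable]: "X \<in> borel_measurable M" "Y \<in> borel_measurable M"
  shows "\<bar>surv (distr M borel X) t - surv (distr M borel Y) t\<bar> \<le> gap X Y t"
proof -
  have "surv (distr M borel X) t - surv (distr M borel Y) t = (\<integral>x. step (X x) t - step (Y x) t \<partial>M)"
    using integrable_step_diff(1)[of X X] integrable_step_diff(1)[of Y Y]
    by (simp add: surv_distr[OF prob_space_axioms])
  then show ?thesis
    unfolding gap_def using integral_abs_bound[of M "\<lambda>x. step (X x) t - step (Y x) t"] by simp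
qed

lemma nn_integral_gap_le:
  assumes [measurable]: "X \<in> borel_measurable M" "Y \<in> borel_measurable M" "w \<in> borel_measurable borel"
    and w: "\<And>t. 0 \<le> w t"
    and B: "\<And>y z. (\<integral>\<^sup>+t. ennreal (w t * \<bar>step y t - step z t\<bar>) \<partial>lborel) \<le> ennreal (B y z)"
  shows "(\<integral>\<^sup>+t. ennreal (w t * gap X Y t) \<partial>lborel) \<le> (\<integral>\<^sup>+x. ennreal (B (X x) (Y x)) \<partial>M)"
proof -
  interpret pair_sigma_finite M "lborel :: real measure" ..
  have "ennreal (w t * gap X Y t) = (\<integral>\<^sup>+x. ennreal (w t * \<bar>step (X x) t - step (Y x) t\<bar>) \<partial>M)" for t
    unfolding gap_def using w integrable_step_diff[of X Y]
    by (subst nn_integral_eq_integral) auto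
  then have "(\<integral>\<^sup>+t. ennreal (w t * gap X Y t) \<partial>lborel)
      = (\<integral>\<^sup>+t. (\<integral>\<^sup>+x. ennreal (w t * \<bar>step (X x) t - step (Y x) t\<bar>) \<partial>M) \<partial>lborel)" by simp
  also have "\<dots> = (\<integral>\<^sup>+x. (\<integral>\<^sup>+t. ennreal (w t * \<bar>step (X x) t - step (Y x) t\<bar>) \<partial>lborel) \<partial>M)"
    by (rule Fubini') measurable
  also have "\<dots> \<le> (\<integral>\<^sup>+x. ennreal (B (X x) (Y x)) \<partial>M)"
    by (intro nn_integral_mono B)
  finally show ?thesis .
qed

text \<open>
  A bound for the weighted difference of two survival functions from second moments alone: the
  signed squares of \<open>X\<close> and \<open>Y\<close> differ by at most \<open>\<bar>X - Y\<bar> (\<bar>X\<bar> + \<bar>Y\<bar>)\<close>, which is split by the inequality of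
  arithmetic and geometric means with weight \<open>e\<close>.
\<close>

lemma surv_diff_wt_le:
  assumes [measurable]: "X \<in> borel_measurable M" "Y \<in> borel_measurable M"
    and i: "integrable M (\<lambda>x. (X x)\<^sup>2)" "integrable M (\<lambda>x. (Y x)\<^sup>2)" "integrable M (\<lambda>x. (X x - Y x)\<^sup>2)"
    and c: "expectation (\<lambda>x. (X x)\<^sup>2) \<le> c" "expectation (\<lambda>x. (Y x)\<^sup>2) \<le> c"
    and e: "e > 0" "expectation (\<lambda>x. (X x - Y x)\<^sup>2) \<le> c * e\<^sup>2" and R: "R \<ge> 0"
  shows "(\<integral>t. \<bar>surv (distr M borel X) t - surv (distr M borel Y) t\<bar> \<partial>wt R) \<le> 5 / 2 * c * e"
proof -
  have pX: "prob_space (distr M borel X)" and pY: "prob_space (distr M borel Y)"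
    by (auto intro: prob_space_distr)
  note [measurable] = surv_measurable[OF pX] surv_measurable[OF pY]
  have B: "\<bar>y * \<bar>y\<bar> - z * \<bar>z\<bar>\<bar> \<le> ((y - z)\<^sup>2 / e + e * (2 * y\<^sup>2 + 2 * z\<^sup>2)) / 2" for y z :: real
  proof -
    have "\<bar>y * \<bar>y\<bar> - z * \<bar>z\<bar>\<bar> \<le> \<bar>y - z\<bar> * (\<bar>y\<bar> + \<bar>z\<bar>)"
    proof -
      have "y * \<bar>y\<bar> - z * \<bar>z\<bar> = (y - z) * \<bar>y\<bar> + z * (\<bar>y\<bar> - \<bar>z\<bar>)" by (simp add: algebra_simps)
      also have "\<bar>\<dots>\<bar> \<le> \<bar>y - z\<bar> * \<bar>y\<bar> + \<bar>z\<bar> * \<bar>y - z\<bar>"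
        by (rule order_trans[OF abs_triangle_ineq]) (auto simp: abs_mult intro!: add_mono mult_left_mono abs_triangle_ineq3)
      finally show ?thesis by (simp add: algebra_simps)
    qed
    moreover have "2 * (\<bar>y - z\<bar> * (\<bar>y\<bar> + \<bar>z\<bar>)) \<le> (y - z)\<^sup>2 / e + e * (\<bar>y\<bar> + \<bar>z\<bar>)\<^sup>2"
    proof -
      have "0 \<le> (\<bar>y - z\<bar> - e * (\<bar>y\<bar> + \<bar>z\<bar>))\<^sup>2 / e" using e by simp
      also have "\<dots> = (y - z)\<^sup>2 / e + e * (\<bar>y\<bar> + \<bar>z\<bar>)\<^sup>2 - 2 * (\<bar>y - z\<bar> * (\<bar>y\<bar> + \<bar>z\<bar>))"
        using e by (simp add: power2_diff field_simps) (simp add: power2_eq_square algebra_simps)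
      finally show ?thesis by simp
    qed
    moreover have "e * (\<bar>y\<bar> + \<bar>z\<bar>)\<^sup>2 \<le> e * (2 * y\<^sup>2 + 2 * z\<^sup>2)"
    proof -
      have "0 \<le> (\<bar>y\<bar> - \<bar>z\<bar>)\<^sup>2" by simp
      then have "(\<bar>y\<bar> + \<bar>z\<bar>)\<^sup>2 \<le> 2 * y\<^sup>2 + 2 * z\<^sup>2" by (simp add: power2_sum power2_diff)
      then show ?thesis using e by simp
    qed
    ultimately show ?thesis by simp
  qed
  have "(\<integral>\<^sup>+t. ennreal \<bar>surv (distr M borel X) t - surv (distr M borel Y) t\<bar> \<partial>wt R)
      \<le> (\<integral>\<^sup>+t. ennreal (2 * \<bar>t\<bar> * gap X Y t) \<partial>lborel)"
    by (subst nn_integral_wt)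
       (auto intro!: nn_integral_mono ennreal_leI mult_left_mono surv_diff_le_gap simp: indicator_def)
  also have "\<dots> \<le> (\<integral>\<^sup>+x. ennreal (((X x - Y x)\<^sup>2 / e + e * (2 * (X x)\<^sup>2 + 2 * (Y x)\<^sup>2)) / 2) \<partial>M)"
    by (rule nn_integral_gap_le[where B="\<lambda>y z. ((y - z)\<^sup>2 / e + e * (2 * y\<^sup>2 + 2 * z\<^sup>2)) / 2"])
       (auto simp: nn_integral_step_diff intro!: ennreal_leI B)
  also have "\<dots> = ennreal (\<integral>x. ((X x - Y x)\<^sup>2 / e + e * (2 * (X x)\<^sup>2 + 2 * (Y x)\<^sup>2)) / 2 \<partial>M)"
    using i e by (intro nn_integral_eq_integral) auto
  also have "(\<integral>x. ((X x - Y x)\<^sup>2 / e + e * (2 * (X x)\<^sup>2 + 2 * (Y x)\<^sup>2)) / 2 \<partial>M)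
      = (expectation (\<lambda>x. (X x - Y x)\<^sup>2) / e + e * (2 * expectation (\<lambda>x. (X x)\<^sup>2) + 2 * expectation (\<lambda>x. (Y x)\<^sup>2))) / 2"
    using i by simp
  also have "\<dots> \<le> (c * e\<^sup>2 / e + e * (2 * c + 2 * c)) / 2"
    using c e by (intro divide_right_mono add_mono mult_left_mono) auto
  also have "\<dots> = 5 / 2 * c * e" using e by (simp add: power2_eq_square)
  finally have le: "(\<integral>\<^sup>+t. ennreal \<bar>surv (distr M borel X) t - surv (distr M borel Y) t\<bar> \<partial>wt R) \<le> ennreal (5 / 2 * c * e)"
    by (simp add: ennreal_leI)
  have "0 \<le> c" using c(1) by (rule order_trans[rotated]) simp
  then have "enn2real (\<integral>\<^sup>+t. ennreal \<bar>surv (distr M borel X) t - surv (distr M borel Y) t\<bar> \<partial>wt R) \<le> 5 / 2 * c * e"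
    using le e by (intro enn2real_leI) auto
  then show ?thesis
    by (subst integral_eq_nn_integral) auto
qed

end

lemma powr_weight_step_diff:
  assumes p: "p \<ge> 0"
  shows "(\<integral>\<^sup>+t. ennreal ((1 + \<bar>t\<bar>) powr p * \<bar>step y t - step z t\<bar>) \<partial>lborel)
      \<le> ennreal (\<bar>y - z\<bar> * (1 + \<bar>y\<bar> + \<bar>z\<bar>) powr p)"
proof -
  have "(\<integral>\<^sup>+t. ennreal ((1 + \<bar>t\<bar>) powr p * \<bar>step y t - step z t\<bar>) \<partial>lborel)
      \<le> (\<integral>\<^sup>+t. ennreal ((1 + \<bar>y\<bar> + \<bar>z\<bar>) powr p) * indicator {min y z..max y z} t \<partial>lborel)"
    using p by (intro nn_integral_mono) (auto simp: step_def indicator_def intro!: powr_mono2 ennreal_leI)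
  also have "\<dots> = ennreal (\<bar>y - z\<bar> * (1 + \<bar>y\<bar> + \<bar>z\<bar>) powr p)"
    by (auto simp: nn_integral_cmult ennreal_mult[symmetric] min_def max_def mult.commute)
  finally show ?thesis .
qed

lemma mult_powr_le_sum:
  fixes a b q :: real
  assumes "0 \<le> a" "0 \<le> b" "q \<ge> 1"
  shows "a * b powr (q - 1) \<le> a powr q + b powr q"
proof -
  define c where "c = max a b"
  have c: "a \<le> c" "b \<le> c" "0 \<le> c" using assms by (auto simp: c_def)
  have "a * b powr (q - 1) \<le> c * c powr (q - 1)"
    using c assms by (intro mult_mono powr_mono2) auto
  also have "\<dots> = c powr q"
    using c assms by (cases "c = 0") (auto simp: powr_diff)
  also have "\<dots> \<le> a powr q + b powr q" by (auto simp: c_def max_def)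
  finally show ?thesis .
qed

lemma powr_sum3_le:
  fixes a b q :: real
  assumes "0 \<le> a" "0 \<le> b" "q \<ge> 0"
  shows "(1 + a + b) powr q \<le> 3 powr q * (1 + a powr q + b powr q)"
proof -
  define c where "c = max 1 (max a b)"
  have "(1 + a + b) powr q \<le> (3 * c) powr q"
    using assms by (intro powr_mono2) (auto simp: c_def)
  also have "\<dots> = 3 powr q * c powr q" using assms by (subst powr_mult) (auto simp: c_def)
  also have "c powr q \<le> 1 + a powr q + b powr q" by (auto simp: c_def max_def)
  finally show ?thesis by simp
qed

context prob_space
begin

text \<open>
  The standard deviation term of the Bernstein inequality below.  With
  \<open>w(t) = (1 + \<bar>t\<bar>)\<close> to the power \<open>q - 1\<close>, Fubini gives
  \<open>\<integral> w h \<le> E \<bar>X - Y\<bar> (1 + \<bar>X\<bar> + \<bar>Y\<bar>)\<close> to the power \<open>q - 1\<close> in the last factor, where \<open>h\<close> is the gap; this is of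
  order \<open>e\<close>, because \<open>(X - Y) / e\<close> has bounded moments of order \<open>q\<close>.  The
  square root is then removed by \<open>2\<bar>t\<bar> sqrt h \<le> sqrt e (1 + \<bar>t\<bar>)\<^sup>2 / w + w h / sqrt e\<close>, whose first term has integral
  at most \<open>sqrt e K\<close>.
\<close>

lemma integral_sqrt_gap_le:
  assumes [measurable]: "X \<in> borel_measurable M" "Y \<in> borel_measurable M"
    and q: "q \<ge> 1" and e: "e > 0" and R: "R \<ge> 0" and K: "K \<ge> 0" and A: "A \<ge> 0"
    and i: "integrable M (\<lambda>x. \<bar>X x\<bar> powr q)" "integrable M (\<lambda>x. \<bar>Y x\<bar> powr q)" "integrable M (\<lambda>x. \<bar>X x - Y x\<bar> powr q)"
    and b: "expectation (\<lambda>x. \<bar>X x\<bar> powr q) \<le> A" "expectation (\<lambda>x. \<bar>Y x\<bar> powr q) \<le> A" "expectation (\<lambda>x. \<bar>X x - Y x\<bar> powr q) \<le> A * e powr q"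
    and weight: "(\<integral>\<^sup>+t. ennreal ((1 + \<bar>t\<bar>) powr (3 - q)) * indicator {-R..R} t \<partial>lborel) \<le> ennreal K"
  shows "(\<integral>t. sqrt (gap X Y t) \<partial>wt R) \<le> sqrt e * (K + (A + 3 powr q * (1 + 2 * A)))"
proof -
  define w where "w = (\<lambda>t::real. (1 + \<bar>t\<bar>) powr (q - 1))"
  define BB where "BB = A + 3 powr q * (1 + 2 * A)"
  have BB: "BB \<ge> 0" using A by (simp add: BB_def)
  have w0: "w t > 0" for t by (simp add: w_def)
  have [measurable]: "w \<in> borel_measurable borel" unfolding w_def by measurable
  let ?D = "\<lambda>x. e * ((\<bar>X x - Y x\<bar> powr q) / e powr q) + e * (3 powr q * (1 + \<bar>X x\<bar> powr q + \<bar>Y x\<bar> powr q))"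
  have "(\<integral>\<^sup>+t. ennreal (w t * gap X Y t) \<partial>lborel) \<le> (\<integral>\<^sup>+x. ennreal (\<bar>X x - Y x\<bar> * (1 + \<bar>X x\<bar> + \<bar>Y x\<bar>) powr (q - 1)) \<partial>M)"
    by (rule nn_integral_gap_le[where B="\<lambda>y z. \<bar>y - z\<bar> * (1 + \<bar>y\<bar> + \<bar>z\<bar>) powr (q - 1)"])
       (use q powr_weight_step_diff[of "q - 1"] in \<open>auto simp: w_def\<close>)
  also have "\<dots> \<le> (\<integral>\<^sup>+x. ennreal (?D x) \<partial>M)"
  proof (intro nn_integral_mono ennreal_leI)
    fix x
    have "\<bar>X x - Y x\<bar> * (1 + \<bar>X x\<bar> + \<bar>Y x\<bar>) powr (q - 1) = e * ((\<bar>X x - Y x\<bar> / e) * (1 + \<bar>X x\<bar> + \<bar>Y x\<bar>) powr (q - 1))"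
      using e by simp
    also have "\<dots> \<le> e * ((\<bar>X x - Y x\<bar> / e) powr q + (1 + \<bar>X x\<bar> + \<bar>Y x\<bar>) powr q)"
      using e q by (intro mult_left_mono mult_powr_le_sum) auto
    also have "\<dots> \<le> ?D x"
      using e q by (subst distrib_left) (intro add_mono mult_left_mono powr_sum3_le; simp add: powr_divide)
    finally show "\<bar>X x - Y x\<bar> * (1 + \<bar>X x\<bar> + \<bar>Y x\<bar>) powr (q - 1) \<le> ?D x" .
  qed
  also have "\<dots> = ennreal (\<integral>x. ?D x \<partial>M)"
    using i e by (intro nn_integral_eq_integral) (auto intro!: AE_I2 add_nonneg_nonneg mult_nonneg_nonneg)
  also have "(\<integral>x. ?D x \<partial>M) = e * (expectation (\<lambda>x. \<bar>X x - Y x\<bar> powr q) / e powr q)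
      + e * (3 powr q * (1 + expectation (\<lambda>x. \<bar>X x\<bar> powr q) + expectation (\<lambda>x. \<bar>Y x\<bar> powr q)))"
    using i by (simp add: prob_space)
  also have "\<dots> \<le> e * (A * e powr q / e powr q) + e * (3 powr q * (1 + A + A))"
    using b e by (intro add_mono mult_left_mono divide_right_mono) auto
  also have "\<dots> = e * BB" using e by (simp add: BB_def algebra_simps)
  finally have wgap: "(\<integral>\<^sup>+t. ennreal (w t * gap X Y t) \<partial>lborel) \<le> ennreal (e * BB)"
    by (simp add: ennreal_leI)
  have pt: "2 * \<bar>t\<bar> * sqrt (gap X Y t) \<le> sqrt e * (1 + \<bar>t\<bar>) powr (3 - q) + w t * gap X Y t / sqrt e" for t
  proof -
    define h where "h = gap X Y t"
    have h: "0 \<le> h" using gap_bounds[of X Y t] by (simp add: h_def)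
    define u where "u = sqrt (sqrt e * (1 + \<bar>t\<bar>) powr (3 - q))"
    define v where "v = sqrt (w t * h / sqrt e)"
    have uv: "u * v = (1 + \<bar>t\<bar>) * sqrt h"
    proof -
      have "sqrt e * (1 + \<bar>t\<bar>) powr (3 - q) * (w t * h / sqrt e) = ((1 + \<bar>t\<bar>) powr (3 - q) * w t) * h"
        using e by simp
      also have "(1 + \<bar>t\<bar>) powr (3 - q) * w t = (1 + \<bar>t\<bar>) powr 2"
        by (simp add: w_def powr_add[symmetric])
      also have "\<dots> = (1 + \<bar>t\<bar>)\<^sup>2" by (simp add: powr_numeral)
      finally show ?thesis by (simp add: u_def v_def real_sqrt_mult[symmetric]) (simp add: real_sqrt_mult)
    qed
    have "2 * \<bar>t\<bar> * sqrt h \<le> 2 * (u * v)" using h unfolding uv by (simp add: algebra_simps)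
    also have "\<dots> \<le> u\<^sup>2 + v\<^sup>2" using sum_squares_bound[of u v] by simp
    also have "u\<^sup>2 = sqrt e * (1 + \<bar>t\<bar>) powr (3 - q)" using e by (simp add: u_def)
    also have "v\<^sup>2 = w t * h / sqrt e" using e h w0[of t] by (simp add: v_def less_imp_le)
    finally show ?thesis unfolding h_def .
  qed
  have "(\<integral>\<^sup>+t. ennreal (sqrt (gap X Y t)) \<partial>wt R)
     = (\<integral>\<^sup>+t. ennreal (2 * \<bar>t\<bar> * sqrt (gap X Y t)) * indicator {-R..R} t \<partial>lborel)"
    by (rule nn_integral_wt) (auto simp: gap_bounds)
  also have "\<dots> \<le> (\<integral>\<^sup>+t. ennreal (sqrt e) * (ennreal ((1 + \<bar>t\<bar>) powr (3 - q)) * indicator {-R..R} t) + ennreal (1 / sqrt e) * ennreal (w t * gap X Y t) \<partial>lborel)"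
  proof (intro nn_integral_mono)
    fix t
    have "ennreal (2 * \<bar>t\<bar> * sqrt (gap X Y t)) \<le> ennreal (sqrt e * (1 + \<bar>t\<bar>) powr (3 - q) + w t * gap X Y t / sqrt e)"
      using pt by (rule ennreal_leI)
    also have "\<dots> = ennreal (sqrt e) * ennreal ((1 + \<bar>t\<bar>) powr (3 - q)) + ennreal (1 / sqrt e) * ennreal (w t * gap X Y t)"
      using e w0[of t] gap_bounds[of X Y t] by (simp add: ennreal_mult[symmetric] ennreal_plus[symmetric] less_imp_le del: ennreal_plus)
    finally show "ennreal (2 * \<bar>t\<bar> * sqrt (gap X Y t)) * indicator {-R..R} t
      \<le> ennreal (sqrt e) * (ennreal ((1 + \<bar>t\<bar>) powr (3 - q)) * indicator {-R..R} t) + ennreal (1 / sqrt e) * ennreal (w t * gap X Y t)"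
      by (auto simp: indicator_def)
  qed
  also have "\<dots> = ennreal (sqrt e) * (\<integral>\<^sup>+t. ennreal ((1 + \<bar>t\<bar>) powr (3 - q)) * indicator {-R..R} t \<partial>lborel)
      + ennreal (1 / sqrt e) * (\<integral>\<^sup>+t. ennreal (w t * gap X Y t) \<partial>lborel)"
    by (subst nn_integral_add) (auto simp: nn_integral_cmult)
  also have "\<dots> \<le> ennreal (sqrt e) * ennreal K + ennreal (1 / sqrt e) * ennreal (e * BB)"
    by (intro add_mono mult_left_mono weight wgap) auto
  also have "\<dots> = ennreal (sqrt e * K + (1 / sqrt e) * (e * BB))"
    using e K BB by (simp add: ennreal_mult[symmetric] ennreal_plus[symmetric] del: ennreal_plus)
  also have "(1 / sqrt e) * (e * BB) = sqrt e * BB"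
  proof -
    have "(1 / sqrt e) * (e * BB) = (e / sqrt e) * BB" by simp
    then show ?thesis using e by (simp only: real_div_sqrt[OF less_imp_le])
  qed
  finally have "(\<integral>\<^sup>+t. ennreal (sqrt (gap X Y t)) \<partial>wt R) \<le> ennreal (sqrt e * (K + BB))"
    by (simp add: distrib_left)
  then show ?thesis
    using e K BB unfolding BB_def[symmetric]
    by (subst integral_eq_nn_integral) (auto intro!: enn2real_leI simp: gap_bounds)
qed

end

section \<open>Numerical bounds for weights and geometric sums\<close>

lemma weight_integral_le:
  assumes G: "\<And>t. 0 \<le> t \<Longrightarrow> (G has_real_derivative (1 + t) powr p) (at t)" and R: "R \<ge> 0"
  shows "(\<integral>\<^sup>+t. ennreal ((1 + \<bar>t\<bar>) powr p) * indicator {-R..R} t \<partial>lborel) \<le> ennreal (2 * (G R - G 0))"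
proof -
  have mono: "G 0 \<le> G R"
    using R by (rule DERIV_nonneg_imp_nondecreasing) (use G in \<open>force intro!: exI\<close>)
  have "(\<integral>\<^sup>+t. ennreal ((1 + \<bar>t\<bar>) powr p) * indicator {-R..R} t \<partial>lborel)
      \<le> (\<integral>\<^sup>+t. ennreal ((1 + t) powr p) * indicator {0..R} t + ennreal ((1 - t) powr p) * indicator {-R..0} t \<partial>lborel)"
    by (intro nn_integral_mono) (auto simp: indicator_def)
  also have "\<dots> = (\<integral>\<^sup>+t. ennreal ((1 + t) powr p) * indicator {0..R} t \<partial>lborel) + (\<integral>\<^sup>+t. ennreal ((1 - t) powr p) * indicator {-R..0} t \<partial>lborel)"
    by (rule nn_integral_add) measurable
  also have "(\<integral>\<^sup>+t. ennreal ((1 + t) powr p) * indicator {0..R} t \<partial>lborel) = ennreal (G R - G 0)"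
    using R G by (intro nn_integral_FTC_Icc) auto
  also have "(\<integral>\<^sup>+t. ennreal ((1 - t) powr p) * indicator {-R..0} t \<partial>lborel) = ennreal (- G (- 0) - - G (- (- R)))"
  proof (intro nn_integral_FTC_Icc[where F="\<lambda>t. - G (- t)"])
    fix t :: real assume t: "t \<in> {-R..0}"
    then have "(G has_real_derivative (1 + (- t)) powr p) (at (- t))" by (intro G) auto
    then have "((\<lambda>t. G (- t)) has_real_derivative ((1 + (- t)) powr p * (- 1))) (at t)"
      by (rule DERIV_chain2) (auto intro!: derivative_eq_intros)
    from DERIV_minus[OF this] show "((\<lambda>t. - G (- t)) has_real_derivative (1 - t) powr p) (at t)" by simp
  qed (use R in auto)
  finally show ?thesis using mono by (simp flip: ennreal_plus)
qed

lemma weight_integral_critical: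
  assumes R: "R \<ge> 0"
  shows "(\<integral>\<^sup>+t. ennreal ((1 + \<bar>t\<bar>) powr (3 - 4)) * indicator {-R..R} t \<partial>lborel) \<le> ennreal (2 * ln (1 + R))"
proof -
  have "((\<lambda>t. ln (1 + t)) has_real_derivative (1 + t) powr (3 - 4)) (at t)" if "0 \<le> t" for t :: real
    using that by (auto intro!: derivative_eq_intros simp: powr_minus field_simps)
  from weight_integral_le[OF this R] show ?thesis by simp
qed

lemma weight_integral_supercritical:
  assumes R: "R \<ge> 0" and q: "q > 4"
  shows "(\<integral>\<^sup>+t. ennreal ((1 + \<bar>t\<bar>) powr (3 - q)) * indicator {-R..R} t \<partial>lborel) \<le> ennreal (2 / (q - 4))"
proof -
  let ?G = "\<lambda>t::real. - ((1 + t) powr (4 - q) / (q - 4))"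
  have "(?G has_real_derivative (1 + t) powr (3 - q)) (at t)" if "0 \<le> t" for t :: real
  proof -
    have "((\<lambda>t. (1 + t) powr (4 - q)) has_real_derivative (4 - q) * (1 + t) powr (4 - q - 1)) (at t)"
      using that by (auto intro!: derivative_eq_intros)
    from DERIV_minus[OF DERIV_cdivide[OF this, of "q - 4"]]
    have "(?G has_real_derivative - ((4 - q) * (1 + t) powr (4 - q - 1) / (q - 4))) (at t)" .
    moreover have "- ((4 - q) * a / (q - 4)) = a" for a :: real
      using q by (simp add: field_simps)
    ultimately show ?thesis by simp
  qed
  from weight_integral_le[OF this R]
  have "(\<integral>\<^sup>+t. ennreal ((1 + \<bar>t\<bar>) powr (3 - q)) * indicator {-R..R} t \<partial>lborel) \<le> ennreal (2 * (?G R - ?G 0))" .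
  also have "\<dots> \<le> ennreal (2 / (q - 4))"
    using q R by (intro ennreal_leI) simp
  finally show ?thesis .
qed

lemma chain_weights_summable:
  "(\<Sum>l<n. sqrt (real (l + 1) * (2 * (1/2) ^ l))) \<le> 15"
proof -
  have "sqrt (real (l + 1) * (2 * (1/2) ^ l)) \<le> 3 * (4/5) ^ l" for l :: nat
  proof (rule real_le_lsqrt)
    \<comment> \<open>the factor \<open>(5/4)\<^sup>l\<close> beats \<open>(l + 1) / 4\<close> and leaves the ratio \<open>5/8 \<le> (4/5)\<^sup>2\<close> under the root\<close>
    have "1 + real l * (1/4) \<le> (1 + 1/4) ^ l" by (rule Bernoulli_inequality) simp
    then have "real (l + 1) \<le> 4 * (5/4) ^ l" by simp
    then have "real (l + 1) * (2 * (1/2) ^ l) \<le> (4 * (5/4) ^ l) * (2 * (1/2) ^ l)"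
      by (intro mult_right_mono) auto
    also have "\<dots> = 8 * (5/8) ^ l" by (simp add: power_mult_distrib[symmetric])
    also have "\<dots> \<le> 9 * (16/25) ^ l" by (intro mult_mono power_mono) auto
    also have "\<dots> = (3 * (4/5) ^ l)\<^sup>2"
      by (simp add: power_mult_distrib power2_eq_square flip: power_mult_distrib)
    finally show "real (l + 1) * (2 * (1/2) ^ l) \<le> (3 * (4/5) ^ l)\<^sup>2" .
  qed auto
  then have "(\<Sum>l<n. sqrt (real (l + 1) * (2 * (1/2) ^ l))) \<le> (\<Sum>l<n. 3 * (4/5) ^ l)"
    by (intro sum_mono)
  also have "\<dots> = 3 * (\<Sum>l<n. (4/5) ^ l)" by (simp add: sum_distrib_left)
  also have "(\<Sum>l<n. (4/5 :: real) ^ l) \<le> 5"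
    by (simp add: sum_gp_strict)
  finally show ?thesis by simp
qed

lemma sum_succ_le_square: "(\<Sum>l<n. real (l + 1)) \<le> (real n)\<^sup>2"
proof -
  have "(\<Sum>l<n. real (l + 1)) \<le> (\<Sum>l<n. real n)" by (intro sum_mono) auto
  then show ?thesis by (simp add: power2_eq_square)
qed

section \<open>A Bernstein inequality for integrated deviations\<close>

lemma exp_le_quadratic: "\<bar>z\<bar> \<le> 1 \<Longrightarrow> exp z \<le> 1 + z + z\<^sup>2" for z :: real
proof (cases "z \<ge> 0")
  case True
  then show "\<bar>z\<bar> \<le> 1 \<Longrightarrow> exp z \<le> 1 + z + z\<^sup>2" using exp_bound[of z] by auto
next
  case False
  have "1 - z \<le> exp (- z)" using exp_ge_add_one_self[of "- z"] by simp
  then have "exp z \<le> 1 / (1 - z)"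
    using False by (simp add: exp_minus field_simps)
  also have "\<dots> \<le> 1 + z + z\<^sup>2"
  proof -
    have "1 \<le> (1 + z + z\<^sup>2) * (1 - z)"
    proof -
      have "z ^ 3 \<le> 0" using False by (simp add: power_le_zero_eq)
      then show ?thesis by (simp add: algebra_simps power2_eq_square power3_eq_cube)
    qed
    then show ?thesis using False by (simp add: divide_le_eq)
  qed
  finally show ?thesis .
qed

lemma (in prob_space) bernstein_mgf:
  fixes g :: "'a \<Rightarrow> real"
  assumes [measurable]: "g \<in> borel_measurable M" and g: "\<And>x. \<bar>g x\<bar> \<le> 1" and y: "\<bar>y\<bar> \<le> 1"
  shows "(\<integral>\<^sup>+x. ennreal (exp (y * (g x - expectation g))) \<partial>M) \<le> ennreal (exp (y\<^sup>2 * expectation (\<lambda>x. (g x)\<^sup>2)))"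
proof -
  have ig: "integrable M g" by (rule integrable_const_bound[where B=1]) (use g in auto)
  have ig2: "integrable M (\<lambda>x. (g x)\<^sup>2)"
    by (rule integrable_const_bound[where B=1]) (use g in \<open>auto simp: abs_square_le_1\<close>)
  have yg: "\<bar>y * g x\<bar> \<le> 1" for x
    using mult_mono[OF y g[of x]] by (simp add: abs_mult)
  have "(\<integral>\<^sup>+x. ennreal (exp (y * (g x - expectation g))) \<partial>M)
      = (\<integral>\<^sup>+x. ennreal (exp (- y * expectation g)) * ennreal (exp (y * g x)) \<partial>M)"
    by (intro nn_integral_cong) (simp add: ennreal_mult[symmetric] mult_exp_exp algebra_simps)
  also have "\<dots> = ennreal (exp (- y * expectation g)) * (\<integral>\<^sup>+x. ennreal (exp (y * g x)) \<partial>M)"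
    by (rule nn_integral_cmult) measurable
  also have "\<dots> \<le> ennreal (exp (- y * expectation g)) * (\<integral>\<^sup>+x. ennreal (1 + y * g x + y\<^sup>2 * (g x)\<^sup>2) \<partial>M)"
    using exp_le_quadratic[OF yg] by (intro mult_left_mono nn_integral_mono ennreal_leI) (auto simp: power_mult_distrib)
  also have "(\<integral>\<^sup>+x. ennreal (1 + y * g x + y\<^sup>2 * (g x)\<^sup>2) \<partial>M) = ennreal (1 + y * expectation g + y\<^sup>2 * expectation (\<lambda>x. (g x)\<^sup>2))"
  proof (subst nn_integral_eq_integral)
    show "AE x in M. 0 \<le> 1 + y * g x + y\<^sup>2 * (g x)\<^sup>2"
    proof (rule AE_I2)
      fix x show "0 \<le> 1 + y * g x + y\<^sup>2 * (g x)\<^sup>2"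
        using yg[of x] zero_le_power2[of "y * g x"] by (simp add: power_mult_distrib abs_le_iff)
    qed
  qed (use ig ig2 in \<open>auto simp: prob_space\<close>)
  also have "ennreal (exp (- y * expectation g)) * \<dots> \<le> ennreal (exp (- y * expectation g)) * ennreal (exp (y * expectation g + y\<^sup>2 * expectation (\<lambda>x. (g x)\<^sup>2)))"
    using exp_ge_add_one_self[of "y * expectation g + y\<^sup>2 * expectation (\<lambda>x. (g x)\<^sup>2)"]
    by (intro mult_left_mono ennreal_leI) (auto simp: algebra_simps)
  also have "\<dots> = ennreal (exp (y\<^sup>2 * expectation (\<lambda>x. (g x)\<^sup>2)))"
    by (simp add: ennreal_mult[symmetric] mult_exp_exp)
  finally show ?thesis .
qed

lemma (in prob_space) bernstein_mgf_average:
  fixes g :: "'a \<Rightarrow> real"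
  assumes [measurable]: "g \<in> borel_measurable M" and g: "\<And>x. \<bar>g x\<bar> \<le> 1"
    and m: "m > 0" and l: "\<bar>l\<bar> \<le> real m"
  shows "(\<integral>\<^sup>+x. ennreal (exp (l * ((1 / real m) * (\<Sum>i<m. g (x i)) - expectation g))) \<partial>(PiM {..<m} (\<lambda>_. M)))
    \<le> ennreal (exp (l\<^sup>2 * expectation (\<lambda>x. (g x)\<^sup>2) / real m))"
proof -
  interpret P: product_prob_space "\<lambda>_::nat. M" "{..<m}" by unfold_locales
  have "(\<integral>\<^sup>+x. ennreal (exp (l * ((1 / real m) * (\<Sum>i<m. g (x i)) - expectation g))) \<partial>(PiM {..<m} (\<lambda>_. M)))
      = (\<integral>\<^sup>+x. (\<Prod>i<m. ennreal (exp (l / real m * (g (x i) - expectation g)))) \<partial>(PiM {..<m} (\<lambda>_. M)))"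
  proof (intro nn_integral_cong)
    fix x :: "nat \<Rightarrow> 'a"
    have "l * ((1 / real m) * (\<Sum>i<m. g (x i)) - expectation g) = (\<Sum>i<m. l / real m * (g (x i) - expectation g))"
      using m by (simp add: sum_subtractf sum_distrib_left right_diff_distrib)
    then show "ennreal (exp (l * ((1 / real m) * (\<Sum>i<m. g (x i)) - expectation g)))
        = (\<Prod>i<m. ennreal (exp (l / real m * (g (x i) - expectation g))))"
      by (simp add: exp_sum prod_ennreal)
  qed
  also have "\<dots> = (\<Prod>i<m. (\<integral>\<^sup>+x. ennreal (exp (l / real m * (g x - expectation g))) \<partial>M))"
    by (rule P.product_nn_integral_prod) auto
  also have "\<dots> \<le> (\<Prod>i<m. ennreal (exp ((l / real m)\<^sup>2 * expectation (\<lambda>x. (g x)\<^sup>2))))"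
    using m l by (intro prod_mono_ennreal bernstein_mgf g) auto
  also have "\<dots> = ennreal (exp (l\<^sup>2 * expectation (\<lambda>x. (g x)\<^sup>2) / real m))"
    using m by (simp add: ennreal_power exp_of_nat_mult[symmetric] power2_eq_square)
  finally show ?thesis .
qed

lemma (in prob_space) bernstein_mgf_abs:
  fixes g :: "'a \<Rightarrow> real"
  assumes [measurable]: "g \<in> borel_measurable M" and g: "\<And>x. \<bar>g x\<bar> \<le> 1"
    and m: "m > 0" and l: "0 \<le> l" "l \<le> real m"
  shows "(\<integral>\<^sup>+x. ennreal (exp (l * \<bar>(1 / real m) * (\<Sum>i<m. g (x i)) - expectation g\<bar>)) \<partial>(PiM {..<m} (\<lambda>_. M)))
    \<le> ennreal (2 * exp (l\<^sup>2 * expectation (\<lambda>x. (g x)\<^sup>2) / real m))"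
proof -
  let ?G = "\<lambda>x. (1 / real m) * (\<Sum>i<m. g (x i)) - expectation g"
  have "(\<integral>\<^sup>+x. ennreal (exp (l * \<bar>?G x\<bar>)) \<partial>(PiM {..<m} (\<lambda>_. M)))
      \<le> (\<integral>\<^sup>+x. ennreal (exp (l * ?G x)) + ennreal (exp (- l * ?G x)) \<partial>(PiM {..<m} (\<lambda>_. M)))"
    by (intro nn_integral_mono) (auto simp: abs_if minus_mult_right simp flip: ennreal_plus)
  also have "\<dots> = (\<integral>\<^sup>+x. ennreal (exp (l * ?G x)) \<partial>(PiM {..<m} (\<lambda>_. M))) + (\<integral>\<^sup>+x. ennreal (exp (- l * ?G x)) \<partial>(PiM {..<m} (\<lambda>_. M)))"
    by (rule nn_integral_add) measurable
  also have "\<dots> \<le> ennreal (exp (l\<^sup>2 * expectation (\<lambda>x. (g x)\<^sup>2) / real m)) + ennreal (exp ((-l)\<^sup>2 * expectation (\<lambda>x. (g x)\<^sup>2) / real m))"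
    using m l by (intro add_mono bernstein_mgf_average g) auto
  finally show ?thesis by (simp flip: ennreal_plus)
qed

lemma (in prob_space) average_deviation_measurable:
  fixes g :: "'a \<Rightarrow> 'b \<Rightarrow> real" and N :: "'b measure"
  assumes g_meas: "(\<lambda>(x, t). g x t) \<in> borel_measurable (M \<Otimes>\<^sub>M N)"
  shows "(\<lambda>(x, t). (1 / real m) * (\<Sum>i<m. g (x i) t) - (\<integral>x. g x t \<partial>M))
    \<in> borel_measurable (PiM {..<m} (\<lambda>_. M) \<Otimes>\<^sub>M N)"
proof -
  let ?P = "PiM {..<m} (\<lambda>_. M)"
  have [measurable]: "(\<lambda>(t, x). g x t) \<in> borel_measurable (N \<Otimes>\<^sub>M M)"
    using measurable_pair_swap[OF g_meas] by (simp add: case_prod_unfold)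
  have "(\<lambda>z. g (fst z i) (snd z)) \<in> borel_measurable (?P \<Otimes>\<^sub>M N)" if "i < m" for i
  proof -
    have pm: "(\<lambda>z. (fst z i, snd z)) \<in> measurable (?P \<Otimes>\<^sub>M N) (M \<Otimes>\<^sub>M N)"
      using that by (intro measurable_Pair measurable_compose[OF measurable_fst] measurable_component_singleton measurable_snd) auto
    show ?thesis using measurable_compose[OF pm g_meas] by simp
  qed
  moreover have "(\<lambda>t. \<integral>x. g x t \<partial>M) \<in> borel_measurable N" by measurable
  ultimately show ?thesis unfolding case_prod_unfold
    by (intro borel_measurable_diff borel_measurable_times borel_measurable_sum borel_measurable_const) auto
qed

text \<open>
  The threshold \<open>c t\<close> is the size of a deviation at the parameter \<open>t\<close> that Bernstein's inequality allows with
  probability \<open>exp (- s)\<close>.  Under the probability measure with density \<open>c / C\<close>, the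
  normalised integral \<open>D / C\<close> is the mean of \<open>\<bar>G t\<bar> / c t\<close>, so Jensen's inequality bounds \<open>exp (s D / C)\<close>
  by an average of scalar exponential moments, each of which is at most \<open>2 exp s\<close>.  No supremum over \<open>t\<close>
  is taken, and hence no union bound over thresholds is paid.
\<close>

lemma (in prob_space) integrated_bernstein:
  fixes g :: "'a \<Rightarrow> 'b \<Rightarrow> real" and N :: "'b measure"
  assumes N: "finite_measure N"
    and g_meas: "(\<lambda>(x, t). g x t) \<in> borel_measurable (M \<Otimes>\<^sub>M N)" and g: "\<And>x t. \<bar>g x t\<bar> \<le> 1"
    and m: "m > 0" and s: "s > 0"
  shows "measure (PiM {..<m} (\<lambda>_. M)) {x \<in> space (PiM {..<m} (\<lambda>_. M)).
      2 * (\<integral>t. (sqrt (s / real m * (\<integral>x. (g x t)\<^sup>2 \<partial>M)) + s / real m) \<partial>N)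
        < (\<integral>t. \<bar>(1 / real m) * (\<Sum>i<m. g (x i) t) - (\<integral>x. g x t \<partial>M)\<bar> \<partial>N)} \<le> 2 * exp (- s)"
proof -
  interpret N: finite_measure N by fact
  let ?P = "PiM {..<m} (\<lambda>_. M)"
  interpret P: product_prob_space "\<lambda>_::nat. M" "{..<m}" by unfold_locales
  define G where "G = (\<lambda>(x::nat \<Rightarrow> 'a) t. (1 / real m) * (\<Sum>i<m. g (x i) t) - (\<integral>x. g x t \<partial>M))"
  define v where "v = (\<lambda>t. \<integral>x. (g x t)\<^sup>2 \<partial>M)"
  define c where "c = (\<lambda>t. sqrt (s / real m * v t) + s / real m)"
  define C where "C = (\<integral>t. c t \<partial>N)"
  have gsq: "(g x t)\<^sup>2 \<le> 1" for x t using g[of x t] by (simp add: abs_square_le_1)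
  have [measurable]: "(\<lambda>(t, x). g x t) \<in> borel_measurable (N \<Otimes>\<^sub>M M)"
    using measurable_pair_swap[OF g_meas] by (simp add: case_prod_unfold)
  have gt [measurable]: "(\<lambda>x. g x t) \<in> borel_measurable M" if "t \<in> space N" for t
    using measurable_Pair1[OF g_meas that] by simp
  have [measurable]: "v \<in> borel_measurable N" "(\<lambda>t. \<integral>x. g x t \<partial>M) \<in> borel_measurable N"
    unfolding v_def by measurable
  have [measurable]: "c \<in> borel_measurable N" unfolding c_def by measurable
  have Gm [measurable]: "(\<lambda>(x, t). G x t) \<in> borel_measurable (?P \<Otimes>\<^sub>M N)"
    unfolding G_def by (rule average_deviation_measurable[OF g_meas])
  have Gx: "G x \<in> borel_measurable N" if "x \<in> space ?P" for x
    using measurable_Pair2[OF Gm that] by simp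
  have v01: "0 \<le> v t" "v t \<le> 1" for t
  proof -
    show "0 \<le> v t" by (simp add: v_def)
    show "v t \<le> 1"
    proof (cases "integrable M (\<lambda>x. (g x t)\<^sup>2)")
      case True
      then show ?thesis unfolding v_def by (rule integral_le_const) (simp add: gsq)
    qed (simp add: v_def not_integrable_integral_eq)
  qed
  have sm: "s / real m > 0" using s m by simp
  have c_lb: "s / real m \<le> c t" and c_sq: "s / real m * v t \<le> (c t)\<^sup>2" for t
  proof -
    show "s / real m \<le> c t" using s m v01[of t] by (simp add: c_def)
    have "s / real m * v t = (sqrt (s / real m * v t))\<^sup>2" using s m v01[of t] by simp
    also have "\<dots> \<le> (c t)\<^sup>2" using s m v01[of t] unfolding c_def by (intro power_mono) auto
    finally show "s / real m * v t \<le> (c t)\<^sup>2" .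
  qed
  have cpos: "c t > 0" for t using c_lb[of t] sm by linarith
  have c_ub: "c t \<le> sqrt (s / real m) + s / real m" for t
    using mult_left_mono[OF v01(2)[of t], of "s / real m"] sm by (simp add: c_def)
  have ic: "integrable N c"
    by (rule N.integrable_const_bound[where B="sqrt (s / real m) + s / real m"])
       (use c_ub cpos in \<open>auto simp: less_imp_le abs_of_pos\<close>)
  show ?thesis
  proof (cases "C > 0")
    case False
    have "0 \<le> C" unfolding C_def using cpos by (intro integral_nonneg_AE) (auto simp: less_imp_le)
    with False have "C = 0" by simp
    then have "AE t in N. c t = 0"
      using integral_nonneg_eq_0_iff_AE[OF ic] cpos unfolding C_def by (auto simp: less_imp_le)
    then have "AE t in N. False" by (rule eventually_mono) (use cpos in \<open>auto simp: less_le\<close>)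
    then have "(\<integral>t. f t \<partial>N) = 0" for f :: "'b \<Rightarrow> real"
      by (intro integral_eq_zero_AE) (auto elim: eventually_mono)
    then show ?thesis by simp
  next
    case True
    define N' where "N' = density N (\<lambda>t. ennreal (c t / C))"
    have "emeasure N' (space N') = (\<integral>\<^sup>+t. ennreal (c t / C) \<partial>N)"
      unfolding N'_def by (subst emeasure_density) (auto intro!: nn_integral_cong)
    also have "\<dots> = 1"
      using True cpos ic by (subst nn_integral_eq_integral) (auto simp: less_imp_le C_def)
    finally interpret N': prob_space N' by (rule prob_spaceI)
    have [simp, measurable_cong]: "sets N' = sets N" and [simp]: "space N' = space N" by (auto simp: N'_def)
    have jensen: "ennreal (exp (s / C * (\<integral>t. \<bar>G x t\<bar> \<partial>N))) \<le> (\<integral>\<^sup>+t. ennreal (exp (s / c t * \<bar>G x t\<bar>)) \<partial>N')"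
      if x: "x \<in> space ?P" for x
    proof -
      note [measurable] = Gx[OF x]
      have Gb: "\<bar>G x t\<bar> \<le> 2" for t
      proof -
        have "\<bar>\<Sum>i<m. g (x i) t\<bar> \<le> real m * 1"
          using sum_norm_bound[of "{..<m}" "\<lambda>i. g (x i) t" 1] g by simp
        then have "\<bar>(1 / real m) * (\<Sum>i<m. g (x i) t)\<bar> \<le> 1" using m by (simp add: abs_mult)
        moreover have "\<bar>\<integral>x. g x t \<partial>M\<bar> \<le> 1"
        proof (cases "integrable M (\<lambda>x. g x t)")
          case True
          have "\<bar>\<integral>x. g x t \<partial>M\<bar> \<le> (\<integral>x. \<bar>g x t\<bar> \<partial>M)" by (rule integral_abs_bound)
          also have "\<dots> \<le> 1" using True by (intro integral_le_const) (use g in auto)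
          finally show ?thesis .
        qed (simp add: not_integrable_integral_eq)
        ultimately show ?thesis unfolding G_def by linarith
      qed
      have B: "s / c t * \<bar>G x t\<bar> \<le> 2 * real m" for t
      proof -
        have "s / c t \<le> real m" using c_lb[of t] cpos[of t] m by (simp add: field_simps)
        from mult_mono[OF this Gb[of t]] show ?thesis by simp
      qed
      have B0: "0 \<le> s / c t * \<bar>G x t\<bar>" for t using s cpos[of t] by simp
      have i1: "integrable N' (\<lambda>t. s / c t * \<bar>G x t\<bar>)"
        by (rule N'.integrable_const_bound[where B="2 * real m"], rule AE_I2, unfold real_norm_def abs_of_nonneg[OF B0], rule B) measurable
      have i2: "integrable N' (\<lambda>t. exp (s / c t * \<bar>G x t\<bar>))"
        by (rule N'.integrable_const_bound[where B="exp (2 * real m)"]) (use B in auto)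
      have "(\<integral>t. s / c t * \<bar>G x t\<bar> \<partial>N') = (\<integral>t. (c t / C) * (s / c t * \<bar>G x t\<bar>) \<partial>N)"
        unfolding N'_def using cpos True by (subst integral_density) (auto simp: less_imp_le)
      also have "\<dots> = (\<integral>t. s / C * \<bar>G x t\<bar> \<partial>N)"
      proof (intro Bochner_Integration.integral_cong refl)
        fix t show "(c t / C) * (s / c t * \<bar>G x t\<bar>) = s / C * \<bar>G x t\<bar>"
          using cpos[of t] by simp
      qed
      finally have eq: "(\<integral>t. s / c t * \<bar>G x t\<bar> \<partial>N') = s / C * (\<integral>t. \<bar>G x t\<bar> \<partial>N)" by simp
      have "exp (\<integral>t. s / c t * \<bar>G x t\<bar> \<partial>N') \<le> (\<integral>t. exp (s / c t * \<bar>G x t\<bar>) \<partial>N')"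
        by (rule N'.jensens_inequality[OF i1 _ _ i2, where I=UNIV]) (auto simp: exp_convex)
      then show ?thesis unfolding eq
        by (subst nn_integral_eq_integral[OF i2]) (auto intro!: ennreal_leI)
    qed
    have mgf: "(\<integral>\<^sup>+x. ennreal (exp (s / c t * \<bar>G x t\<bar>)) \<partial>?P) \<le> ennreal (2 * exp s)" if t: "t \<in> space N" for t
    proof -
      have "s / c t \<le> real m" using c_lb[of t] cpos[of t] m by (simp add: field_simps)
      then have "(\<integral>\<^sup>+x. ennreal (exp (s / c t * \<bar>G x t\<bar>)) \<partial>?P) \<le> ennreal (2 * exp ((s / c t)\<^sup>2 * v t / real m))"
        unfolding G_def v_def using s m cpos[of t] by (intro bernstein_mgf_abs gt t g) auto
      also have "(s / c t)\<^sup>2 * v t / real m \<le> s"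
      proof -
        have "(s / c t)\<^sup>2 * v t / real m = s * (s / real m * v t) / (c t)\<^sup>2"
          by (simp add: power2_eq_square ac_simps)
        also have "\<dots> \<le> s * (c t)\<^sup>2 / (c t)\<^sup>2"
          using c_sq[of t] s by (intro divide_right_mono mult_left_mono) auto
        also have "\<dots> = s" using cpos[of t] by simp
        finally show ?thesis .
      qed
      finally show ?thesis by (simp add: ennreal_leI)
    qed
    interpret pair_sigma_finite ?P N' ..
    let ?D = "\<lambda>x. \<integral>t. \<bar>G x t\<bar> \<partial>N"
    have [measurable]: "?D \<in> borel_measurable ?P" by measurable
    have "(\<integral>\<^sup>+x. ennreal (exp (s / C * ?D x)) \<partial>?P) \<le> (\<integral>\<^sup>+x. (\<integral>\<^sup>+t. ennreal (exp (s / c t * \<bar>G x t\<bar>)) \<partial>N') \<partial>?P)"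
      by (intro nn_integral_mono jensen) auto
    also have "\<dots> = (\<integral>\<^sup>+t. (\<integral>\<^sup>+x. ennreal (exp (s / c t * \<bar>G x t\<bar>)) \<partial>?P) \<partial>N')"
      by (rule Fubini'[symmetric]) measurable
    also have "\<dots> \<le> (\<integral>\<^sup>+t. ennreal (2 * exp s) \<partial>N')"
      by (intro nn_integral_mono mgf) simp
    also have "\<dots> = ennreal (2 * exp s)" using N'.emeasure_space_1 by simp
    finally have exp_bound: "(\<integral>\<^sup>+x. ennreal (exp (s / C * ?D x)) \<partial>?P) \<le> ennreal (2 * exp s)" .
    have "emeasure ?P {x \<in> space ?P. 2 * C < ?D x} \<le> emeasure ?P {x \<in> space ?P. 1 \<le> ennreal (exp (- 2 * s)) * ennreal (exp (s / C * ?D x))}"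
    proof (intro emeasure_mono subsetI)
      fix x assume x: "x \<in> {x \<in> space ?P. 2 * C < ?D x}"
      then have "2 * s \<le> s / C * ?D x" using True s by (simp add: field_simps)
      then have "1 \<le> exp (- 2 * s) * exp (s / C * ?D x)"
        by (simp add: mult_exp_exp)
      then have "1 \<le> ennreal (exp (- 2 * s)) * ennreal (exp (s / C * ?D x))"
        by (simp flip: ennreal_mult ennreal_1)
      with x show "x \<in> {x \<in> space ?P. 1 \<le> ennreal (exp (- 2 * s)) * ennreal (exp (s / C * ?D x))}" by simp
    qed measurable
    also have "\<dots> \<le> ennreal (exp (- 2 * s)) * (\<integral>\<^sup>+x. ennreal (exp (s / C * ?D x)) * indicator (space ?P) x \<partial>?P)"
      by (rule nn_integral_Markov_inequality) measurable
    also have "(\<integral>\<^sup>+x. ennreal (exp (s / C * ?D x)) * indicator (space ?P) x \<partial>?P) = (\<integral>\<^sup>+x. ennreal (exp (s / C * ?D x)) \<partial>?P)"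
      by (intro nn_integral_cong) auto
    also have "ennreal (exp (- 2 * s)) * \<dots> \<le> ennreal (exp (- 2 * s)) * ennreal (2 * exp s)"
      by (intro mult_left_mono exp_bound) auto
    also have "\<dots> = ennreal (2 * exp (- s))"
      by (simp add: ennreal_mult[symmetric] mult_exp_exp)
    finally have "measure ?P {x \<in> space ?P. 2 * C < ?D x} \<le> 2 * exp (- s)"
      by (simp add: P.emeasure_eq_measure)
    then show ?thesis unfolding C_def c_def v_def G_def .
  qed
qed

section \<open>Nets of the unit ball\<close>

lemma ip_diff: "ip d x v - ip d x w = ip d x (\<lambda>i. v i - w i)"
  by (simp add: ip_def sum_subtractf[symmetric] right_diff_distrib)

lemma abs_ip_le: "\<bar>ip d x v\<bar> \<le> L2_set x {..<d} * L2_set v {..<d}"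
  using L2_set_mult_ineq[of x v "{..<d}"] sum_abs[of "\<lambda>i. x i * v i" "{..<d}"]
  by (simp add: ip_def abs_mult)

lemma L2_set_triangle3:
  "L2_set (\<lambda>i. u i - w i) A \<le> L2_set (\<lambda>i. u i - v i) A + L2_set (\<lambda>i. v i - w i) A"
  using L2_set_triangle_ineq[of "\<lambda>i. u i - v i" "\<lambda>i. v i - w i" A] by simp

definition trunc :: "real \<Rightarrow> int" where
  "trunc r = (if 0 \<le> r then \<lfloor>r\<rfloor> else \<lceil>r\<rceil>)"

lemma abs_trunc_le: "\<bar>real_of_int (trunc r)\<bar> \<le> \<bar>r\<bar>"
  and abs_trunc_diff_le: "\<bar>r - real_of_int (trunc r)\<bar> \<le> 1"
proof -
  have c: "r \<le> 0 \<Longrightarrow> real_of_int \<lceil>r\<rceil> \<le> 0" by simp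
  have f: "0 \<le> r \<Longrightarrow> 0 \<le> real_of_int \<lfloor>r\<rfloor>" by simp
  note fc = floor_correct[of r] ceiling_correct[of r]
  show "\<bar>real_of_int (trunc r)\<bar> \<le> \<bar>r\<bar>" "\<bar>r - real_of_int (trunc r)\<bar> \<le> 1"
    using fc c f by (cases "0 \<le> r"; simp add: trunc_def; linarith)+
qed

lemma geometric_sum_two_sided:
  fixes r :: real
  assumes "0 \<le> r" "r < 1"
  shows "(\<Sum>k\<in>{-int N..int N}. r ^ nat \<bar>k\<bar>) \<le> 2 / (1 - r)"
proof -
  have half: "(\<Sum>k\<le>N. r ^ k) \<le> 1 / (1 - r)"
    using sum_le_suminf[of "\<lambda>k. r ^ k" "{..N}"] assms by (simp add: suminf_geometric summable_geometric)
  have "(\<Sum>k\<in>{-int N..int N}. r ^ nat \<bar>k\<bar>) \<le> (\<Sum>k\<in>int ` {..N} \<union> (\<lambda>k. - int k) ` {..N}. r ^ nat \<bar>k\<bar>)"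
  proof (rule sum_mono2)
    show "{-int N..int N} \<subseteq> int ` {..N} \<union> (\<lambda>k. - int k) ` {..N}"
    proof
      fix k assume k: "k \<in> {-int N..int N}"
      then have "k = int (nat k) \<and> nat k \<le> N \<or> k = - int (nat (- k)) \<and> nat (- k) \<le> N" by auto
      then show "k \<in> int ` {..N} \<union> (\<lambda>k. - int k) ` {..N}" by blast
    qed
  qed (use assms in auto)
  also have "\<dots> \<le> (\<Sum>k\<in>int ` {..N}. r ^ nat \<bar>k\<bar>) + (\<Sum>k\<in>(\<lambda>k. - int k) ` {..N}. r ^ nat \<bar>k\<bar>)"
    using assms by (subst sum_Un) (auto intro: sum_nonneg)
  also have "\<dots> = 2 * (\<Sum>k\<le>N. r ^ k)"
    by (subst (1 2) sum.reindex) (auto simp: inj_on_def)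
  finally show ?thesis using half by simp
qed

text \<open>
  The net consists of the points of a cubic lattice of mesh \<open>2\<close> to the power \<open>-l\<close>, divided by \<open>sqrt d\<close>; coordinates are rounded
  towards \<open>0\<close>, so that the rounded vector stays in the ball.  The lattice points in question have coordinates with
  \<open>\<Sum> \<bar>k i\<bar> \<le> d 2\<^sup>l\<close>, and weighting each of them by \<open>exp (d - \<Sum> \<bar>k i\<bar> / 2\<^sup>l) \<ge> 1\<close> turns
  the count into a product of geometric sums.
\<close>

lemma ball_net:
  assumes d: "d \<ge> 1"
  shows "\<exists>A. finite A \<and> real (card A) \<le> exp (real d * real (l + 3)) \<and> 
     (\<forall>v\<in>A. L2_set v {..<d} \<le> 1) \<and>
     (\<forall>v. L2_set v {..<d} \<le> 1 \<longrightarrow> (\<exists>w\<in>A. L2_set (\<lambda>i. v i - w i) {..<d} \<le> (1/2) ^ l))"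
proof -
  define e where "e = (1/2) ^ l / sqrt (real d)"
  have e: "e > 0" using d by (simp add: e_def)
  define N where "N = d * 2 ^ l"
  define Z where "Z = {k \<in> PiE {..<d} (\<lambda>_. {-int N..int N}). (\<Sum>i<d. \<bar>k i\<bar>) \<le> int N}"
  define A0 where "A0 = (\<lambda>k i. if i < d then e * real_of_int (k i) else 0) ` Z"
  define A where "A = {v \<in> A0. L2_set v {..<d} \<le> 1}"
  have finZ: "finite Z"
    unfolding Z_def by (rule finite_subset[OF Collect_restrict finite_PiE]) simp_all
  then have finA: "finite A" by (simp add: A_def A0_def)
  define r where "r = exp (- ((1/2::real) ^ l))"
  have r: "0 \<le> r" "r < 1" by (auto simp: r_def)
  have r_lb: "(1/2) ^ l / 2 \<le> 1 - r"
  proof -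
    have x: "0 \<le> (1/2::real) ^ l" "(1/2::real) ^ l \<le> 1" by (auto simp: power_le_one)
    define x where "x = (1/2::real) ^ l"
    have "exp (- x) \<le> 1 / (1 + x)"
      using exp_ge_add_one_self[of x] x unfolding x_def[symmetric] by (simp add: exp_minus field_simps)
    also have "\<dots> \<le> 1 - x / 2"
    proof -
      have "1 \<le> (1 - x / 2) * (1 + x)" using x mult_left_mono[of x 1 x] unfolding x_def[symmetric]
        by (simp add: algebra_simps)
      then show ?thesis using x unfolding x_def[symmetric] by (simp add: divide_le_eq)
    qed
    finally show ?thesis by (simp add: r_def x_def)
  qed
  have "real (card A) \<le> real (card Z)"
  proof -
    have "card A \<le> card A0" using finZ by (intro card_mono) (auto simp: A_def A0_def)
    also have "\<dots> \<le> card Z" unfolding A0_def using finZ by (rule card_image_le)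
    finally show ?thesis by simp
  qed
  also have "\<dots> = (\<Sum>k\<in>Z. 1)" by simp
  also have "\<dots> \<le> (\<Sum>k\<in>Z. exp (real d) * (\<Prod>i<d. r ^ nat \<bar>k i\<bar>))"
  proof (rule sum_mono)
    fix k assume k: "k \<in> Z"
    have "(\<Prod>i<d. r ^ nat \<bar>k i\<bar>) = r ^ (\<Sum>i<d. nat \<bar>k i\<bar>)" by (simp add: power_sum)
    also have "\<dots> = exp (- ((1/2) ^ l * (\<Sum>i<d. real (nat \<bar>k i\<bar>))))"
      unfolding r_def by (subst exp_of_nat_mult[symmetric]) (simp add: mult.commute)
    finally have *: "exp (real d) * (\<Prod>i<d. r ^ nat \<bar>k i\<bar>) = exp (real d - (1/2) ^ l * (\<Sum>i<d. real (nat \<bar>k i\<bar>)))"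
      by (simp add: exp_add[symmetric])
    have "(\<Sum>i<d. real (nat \<bar>k i\<bar>)) = real_of_int (\<Sum>i<d. \<bar>k i\<bar>)" by simp
    also have "\<dots> \<le> real N" using k by (simp add: Z_def del: of_int_sum)
    finally have "(1/2) ^ l * (\<Sum>i<d. real (nat \<bar>k i\<bar>)) \<le> (1/2) ^ l * real N" by (rule mult_left_mono) simp
    also have "\<dots> = real d" by (simp add: N_def power_divide)
    finally show "1 \<le> exp (real d) * (\<Prod>i<d. r ^ nat \<bar>k i\<bar>)" unfolding * by simp
  qed
  also have "\<dots> \<le> (\<Sum>k\<in>PiE {..<d} (\<lambda>_. {-int N..int N}). exp (real d) * (\<Prod>i<d. r ^ nat \<bar>k i\<bar>))"
  proof (rule sum_mono2)
    show "finite (PiE {..<d} (\<lambda>_. {-int N..int N}))" by (rule finite_PiE) simp_all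
    show "Z \<subseteq> PiE {..<d} (\<lambda>_. {-int N..int N})" unfolding Z_def by (rule Collect_restrict)
    show "0 \<le> exp (real d) * (\<Prod>i<d. r ^ nat \<bar>k i\<bar>)" for k
      using r(1) by (intro mult_nonneg_nonneg prod_nonneg zero_le_power ballI) simp
  qed
  also have "\<dots> = exp (real d) * (\<Prod>i<d. \<Sum>k\<in>{-int N..int N}. r ^ nat \<bar>k\<bar>)"
    by (subst prod_sum_PiE) (auto simp: sum_distrib_left)
  also have "\<dots> = exp (real d) * (\<Sum>k\<in>{-int N..int N}. r ^ nat \<bar>k\<bar>) ^ d" by simp
  also have "\<dots> \<le> exp (real d) * exp (real (l + 2)) ^ d"
  proof (intro mult_left_mono power_mono)
    have "(\<Sum>k\<in>{-int N..int N}. r ^ nat \<bar>k\<bar>) \<le> 2 / (1 - r)" by (rule geometric_sum_two_sided[OF r])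
    also have "\<dots> \<le> 2 / ((1/2) ^ l / 2)" using r_lb r by (intro divide_left_mono) auto
    also have "\<dots> = 2 ^ (l + 2)" by (simp add: power_divide)
    also have "\<dots> \<le> exp 1 ^ (l + 2)" using exp_ge_add_one_self[of 1] by (intro power_mono) auto
    also have "\<dots> = exp (real (l + 2))" using exp_of_nat_mult[of "l + 2" "1::real"] by simp
    finally show "(\<Sum>k\<in>{-int N..int N}. r ^ nat \<bar>k\<bar>) \<le> exp (real (l + 2))" .
  qed (use r in \<open>auto intro: sum_nonneg\<close>)
  also have "\<dots> = exp (real d * real (l + 3))"
  proof -
    have "exp (real (l + 2)) ^ d = exp (real d * real (l + 2))" by (rule exp_of_nat_mult[symmetric])
    moreover have "real d + real d * real (l + 2) = real d * real (l + 3)" by (simp add: algebra_simps)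
    ultimately show ?thesis by (metis exp_add)
  qed
  finally have card: "real (card A) \<le> exp (real d * real (l + 3))" .
  have "\<exists>w\<in>A. L2_set (\<lambda>i. v i - w i) {..<d} \<le> (1/2) ^ l" if v: "L2_set v {..<d} \<le> 1" for v
  proof -
    define k where "k = (\<lambda>i\<in>{..<d}. trunc (v i / e))"
    define w where "w = (\<lambda>i. if i < d then e * real_of_int (k i) else 0)"
    have kv: "\<bar>real_of_int (k i)\<bar> \<le> \<bar>v i\<bar> / e" if "i < d" for i
      using abs_trunc_le[of "v i / e"] that e by (simp add: k_def)
    have wv: "\<bar>w i\<bar> \<le> \<bar>v i\<bar>" if "i < d" for i
      using kv[OF that] e that by (simp add: w_def abs_mult field_simps)
    have vw: "\<bar>v i - w i\<bar> \<le> e" if "i < d" for i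
    proof -
      have "\<bar>v i - w i\<bar> = e * \<bar>v i / e - real_of_int (k i)\<bar>"
      proof -
        have "v i - w i = e * (v i / e - real_of_int (k i))"
          using that e by (simp add: w_def right_diff_distrib)
        then show ?thesis using e by (simp add: abs_mult)
      qed
      also have "\<dots> \<le> e * 1" using abs_trunc_diff_le[of "v i / e"] that e by (intro mult_left_mono) (auto simp: k_def)
      finally show ?thesis by simp
    qed
    have w1: "L2_set w {..<d} \<le> 1"
      using L2_set_mono[of "{..<d}" "\<lambda>i. \<bar>w i\<bar>" "\<lambda>i. \<bar>v i\<bar>"] wv v by (simp add: L2_set_def)
    have "L2_set (\<lambda>i. v i - w i) {..<d} \<le> L2_set (\<lambda>i. e) {..<d}"
      using L2_set_mono[of "{..<d}" "\<lambda>i. \<bar>v i - w i\<bar>" "\<lambda>i. e"] vw by (simp add: L2_set_def)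
    also have "\<dots> = (1/2) ^ l" using d by (simp add: L2_set_constant e_def abs_mult)
    finally have near: "L2_set (\<lambda>i. v i - w i) {..<d} \<le> (1/2) ^ l" .
    have "k \<in> Z"
    proof -
      have "(\<Sum>i<d. \<bar>v i\<bar>) \<le> L2_set v {..<d} * L2_set (\<lambda>_. 1) {..<d}"
        using L2_set_mult_ineq[of v "\<lambda>_. 1" "{..<d}"] by simp
      also have "\<dots> \<le> 1 * sqrt (real d)"
        using v by (intro mult_mono) (auto simp: L2_set_constant)
      finally have "(\<Sum>i<d. \<bar>v i\<bar>) / e \<le> sqrt (real d) / e" using e by (simp add: divide_right_mono)
      also have "\<dots> = real N" using d by (simp add: e_def N_def power_divide)
      finally have "(\<Sum>i<d. \<bar>v i\<bar> / e) \<le> real N" by (simp add: sum_divide_distrib)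
      moreover have "(\<Sum>i<d. \<bar>real_of_int (k i)\<bar>) \<le> (\<Sum>i<d. \<bar>v i\<bar> / e)"
        by (intro sum_mono kv) auto
      ultimately have "real_of_int (\<Sum>i<d. \<bar>k i\<bar>) \<le> real_of_int (int N)" by simp
      then have S: "(\<Sum>i<d. \<bar>k i\<bar>) \<le> int N" by (simp only: of_int_le_iff)
      have "\<bar>k i\<bar> \<le> int N" if "i < d" for i
        using member_le_sum[of i "{..<d}" "\<lambda>i. \<bar>k i\<bar>"] that S by simp
      then have "k i \<in> {-int N..int N}" if "i < d" for i
        using that by (simp add: abs_le_iff minus_le_iff)
      then have "k \<in> PiE {..<d} (\<lambda>_. {-int N..int N})"
        by (intro PiE_I) (simp_all add: k_def)
      with S show ?thesis by (simp add: Z_def)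
    qed
    then have "w \<in> A" unfolding A_def A0_def using w1 by (auto simp: w_def[abs_def])
    with near show ?thesis by blast
  qed
  then show ?thesis using finA card by (intro exI[of _ A]) (auto simp: A_def)
qed

section \<open>Transport from a moving set of atoms\<close>

definition unif :: "nat \<Rightarrow> (nat \<Rightarrow> real) \<Rightarrow> real measure" where
  "unif m y = distr (uniform_count_measure {..<m}) borel y"

lemma sets_unif [simp, measurable_cong]: "sets (unif m y) = sets borel"
  and space_unif [simp]: "space (unif m y) = UNIV"
  by (simp_all add: unif_def)

lemma uniform_index:
  fixes f :: "nat \<Rightarrow> real"
  assumes m: "m > 0"
  shows "prob_space (uniform_count_measure {..<m})"
    and "f \<in> borel_measurable (uniform_count_measure {..<m})"
    and "integrable (uniform_count_measure {..<m}) f"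
proof -
  show U: "prob_space (uniform_count_measure {..<m})"
    using m by (intro prob_space_uniform_count_measure) (auto simp: lessThan_empty_iff)
  show meas: "f \<in> borel_measurable (uniform_count_measure {..<m})"
    by (simp add: uniform_count_measure_def)
  show "integrable (uniform_count_measure {..<m}) f"
  proof (rule finite_measure.integrable_const_bound[where B="\<Sum>i<m. \<bar>f i\<bar>"])
    show "finite_measure (uniform_count_measure {..<m})" using U by (rule prob_space.axioms)
    show "AE i in uniform_count_measure {..<m}. norm (f i) \<le> (\<Sum>i<m. \<bar>f i\<bar>)"
      by (rule AE_I2) (auto simp: space_uniform_count_measure intro: member_le_sum)
  qed (rule meas)
qed

lemma prob_space_unif: "m > 0 \<Longrightarrow> prob_space (unif m y)"
  unfolding unif_def by (intro prob_space.prob_space_distr uniform_index)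

lemma nn_integral_unif:
  assumes [measurable]: "f \<in> borel_measurable borel"
  shows "(\<integral>\<^sup>+a. f a \<partial>unif m y) = (\<Sum>j<m. ennreal (1 / real m) * f (y j))"
  unfolding unif_def uniform_count_measure_def
  by (subst nn_integral_distr) (auto simp: nn_integral_point_measure_finite)

lemma weighted_square_le:
  fixes u v a b :: real
  assumes "a > 0" "b > 0"
  shows "(u + v)\<^sup>2 \<le> (a + b) * (u\<^sup>2 / a + v\<^sup>2 / b)"
proof -
  have "0 \<le> (u * b - v * a)\<^sup>2 / (a * b)" using assms by simp
  also have "\<dots> = (a + b) * (u\<^sup>2 / a + v\<^sup>2 / b) - (u + v)\<^sup>2"
    using assms by (simp add: field_simps power2_eq_square)
  finally show ?thesis by simp
qed

text \<open>
  A coupling with the uniform measure on \<open>y 0, \<dots>, y (m - 1)\<close> is lifted to the indices: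
  an atom that occurs \<open>n\<close> times among the \<open>y i\<close> hands the fraction \<open>1/n\<close> of its mass to each of its
  indices.  Replacing \<open>y i\<close> by \<open>y' i\<close> in the lift couples the moved atoms with \<open>\<nu>\<close>.  The
  inequality \<open>(u + v)\<^sup>2 \<le> (a + b) (u\<^sup>2 / a + v\<^sup>2 / b)\<close> takes the place of Minkowski's inequality.
\<close>

lemma move_atoms_coupling:
  assumes m: "m > 0" and nu: "prob_space \<nu>" "sets \<nu> = sets borel"
    and K: "K \<in> couplings (unif m y) \<nu>"
    and ab: "a > 0" "b > 0"
    and cost: "(\<integral>\<^sup>+z. ennreal ((norm (fst z - snd z))\<^sup>2) \<partial>K) \<le> ennreal (a\<^sup>2)"
    and move: "(1 / real m) * (\<Sum>i<m. (y i - y' i)\<^sup>2) \<le> b\<^sup>2"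
  shows "W2 (unif m y') \<nu> \<le> ennreal (a + b)"
proof -
  have Ksets: "sets K = sets (borel \<Otimes>\<^sub>M borel)"
    using K sets_pair_measure_cong[OF sets_unif nu(2)] by (simp add: couplings_def)
  note [measurable_cong] = Ksets nu(2)
  have K1: "distr K (unif m y) fst = unif m y" and K2: "distr K \<nu> snd = \<nu>"
    using K by (auto simp: couplings_def)
  have f1: "fst \<in> measurable K (unif m y)" and f2: "snd \<in> measurable K \<nu>"
    by measurable
  interpret E: prob_space "unif m y" using m by (rule prob_space_unif)
  have "emeasure K (space K) = emeasure (distr K (unif m y) fst) UNIV"
    by (subst emeasure_distr[OF f1]) (auto intro!: arg_cong[where f="emeasure K"])
  then have "emeasure K (space K) = 1"
    using E.emeasure_space_1 by (simp add: K1)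
  then interpret K: prob_space K by (rule prob_spaceI)
  \<comment> \<open>the multiplicity of an atom\<close>
  define n where "n = (\<lambda>r. card {j\<in>{..<m}. y j = r})"
  \<comment> \<open>the share of the atom \<open>r\<close> that is handed to the index \<open>i\<close>\<close>
  define w where "w = (\<lambda>i r. if r = y i then 1 / real (n (y i)) else 0)"
  have npos: "n (y i) > 0" if "i < m" for i
    using that by (auto simp: n_def card_gt_0_iff)
  have w0: "0 \<le> w i r" for i r by (simp add: w_def)
  have [measurable]: "w i \<in> borel_measurable borel" for i unfolding w_def by measurable
  have sum1: "(\<Sum>i<m. w i (y j)) = 1" if "j < m" for j
  proof -
    have "(\<Sum>i<m. w i (y j)) = (\<Sum>i\<in>{i\<in>{..<m}. y i = y j}. 1 / real (n (y j)))"
      unfolding w_def by (subst sum.inter_filter) (auto intro!: sum.cong)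
    also have "\<dots> = 1" using npos[OF that] that by (auto simp: n_def)
    finally show ?thesis .
  qed
  have sum2: "(\<Sum>j<m. w i (y j)) = 1" if "i < m" for i
  proof -
    have "(\<Sum>j<m. w i (y j)) = (\<Sum>j\<in>{j\<in>{..<m}. y j = y i}. 1 / real (n (y i)))"
      unfolding w_def by (subst sum.inter_filter) (auto intro!: sum.cong)
    also have "\<dots> = 1" using npos[OF that] that by (auto simp: n_def)
    finally show ?thesis .
  qed
  have int1: "(\<integral>\<^sup>+z. f (fst z) \<partial>K) = (\<Sum>j<m. ennreal (1 / real m) * f (y j))"
    if [measurable]: "f \<in> borel_measurable borel" for f
    using nn_integral_distr[OF f1, of f] nn_integral_unif[of f m y] K1 by simp
  have "(\<integral>\<^sup>+z. indicator (- (y ` {..<m})) (fst z) \<partial>K) = 0"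
  proof -
    have [measurable]: "- (y ` {..<m}) \<in> sets borel" by (intro borel_comp borel_closed finite_imp_closed) simp
    show ?thesis by (subst int1) auto
  qed
  then have "AE z in K. indicator (- (y ` {..<m})) (fst z) = (0::ennreal)"
  proof (subst (asm) nn_integral_0_iff_AE)
    have [measurable]: "- (y ` {..<m}) \<in> sets borel" by (intro borel_comp borel_closed finite_imp_closed) simp
    show "(\<lambda>z. indicator (- (y ` {..<m})) (fst z)) \<in> borel_measurable K" by measurable
  qed
  then have atoms: "AE z in K. fst z \<in> y ` {..<m}"
    by (rule eventually_mono) (auto simp: indicator_def split: if_splits)
  let ?C = "count_space {..<m}"
  interpret C: sigma_finite_measure ?C by (rule sigma_finite_measure_count_space_finite) simp
  let ?E' = "unif m y' \<Otimes>\<^sub>M \<nu>"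
  have pm: "(\<lambda>p. (y' (snd p), snd (fst p))) \<in> measurable (K \<Otimes>\<^sub>M ?C) ?E'"
    by (intro measurable_Pair measurable_compose[OF measurable_snd] measurable_compose[OF measurable_fst f2]) simp
  have wm: "(\<lambda>p. ennreal (w (snd p) (fst (fst p)))) \<in> borel_measurable (K \<Otimes>\<^sub>M ?C)"
    by (rule measurable_compose_countable'[where I="{..<m}" and g=snd]) auto
  define K' where "K' = distr (density (K \<Otimes>\<^sub>M ?C) (\<lambda>p. ennreal (w (snd p) (fst (fst p))))) ?E' (\<lambda>p. (y' (snd p), snd (fst p)))"
  have int': "(\<integral>\<^sup>+z. F z \<partial>K') = (\<integral>\<^sup>+z. (\<Sum>i<m. ennreal (w i (fst z)) * F (y' i, snd z)) \<partial>K)"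
    if F: "F \<in> borel_measurable ?E'" for F
  proof -
    have "(\<integral>\<^sup>+z. F z \<partial>K') = (\<integral>\<^sup>+p. ennreal (w (snd p) (fst (fst p))) * F (y' (snd p), snd (fst p)) \<partial>(K \<Otimes>\<^sub>M ?C))"
      unfolding K'_def using pm wm measurable_compose[OF pm F]
      by (subst nn_integral_distr) (simp_all add: F nn_integral_density)
    also have "\<dots> = (\<integral>\<^sup>+z. (\<integral>\<^sup>+i. ennreal (w i (fst z)) * F (y' i, snd z) \<partial>?C) \<partial>K)"
      using wm measurable_compose[OF pm F]
      by (subst C.nn_integral_fst[symmetric]) (simp_all add: borel_measurable_times_ennreal)
    also have "\<dots> = (\<integral>\<^sup>+z. (\<Sum>i<m. ennreal (w i (fst z)) * F (y' i, snd z)) \<partial>K)"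
      by (simp add: nn_integral_count_space_finite)
    finally show ?thesis .
  qed
  have sE: "sets ?E' = sets (borel \<Otimes>\<^sub>M borel)"
    by (rule sets_pair_measure_cong) (simp_all add: nu)
  have g1: "fst \<in> measurable K' (unif m y')" and g2: "snd \<in> measurable K' \<nu>"
    unfolding K'_def by simp_all
  have marg1: "distr K' (unif m y') fst = unif m y'"
  proof (rule measure_eqI)
    fix B assume "B \<in> sets (distr K' (unif m y') fst)"
    then have B [measurable]: "B \<in> sets borel" by simp
    have "emeasure (distr K' (unif m y') fst) B = (\<integral>\<^sup>+z. indicator B (fst z) \<partial>K')"
      using g1 by (subst nn_integral_indicator[symmetric], simp) (subst nn_integral_distr, auto)
    also have "\<dots> = (\<integral>\<^sup>+z. (\<Sum>i<m. ennreal (w i (fst z)) * indicator B (y' i)) \<partial>K)"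
      by (subst int') auto
    also have "\<dots> = (\<Sum>j<m. ennreal (1 / real m) * (\<Sum>i<m. ennreal (w i (y j)) * indicator B (y' i)))"
      by (subst int1) auto
    also have "\<dots> = (\<Sum>i<m. ennreal (1 / real m) * indicator B (y' i) * (\<Sum>j<m. ennreal (w i (y j))))"
      unfolding sum_distrib_left by (subst sum.swap) (simp add: mult_ac)
    also have "\<dots> = (\<Sum>i<m. ennreal (1 / real m) * indicator B (y' i))"
      by (intro sum.cong refl) (simp add: sum_ennreal w0 sum2)
    also have "\<dots> = emeasure (unif m y') B"
      by (subst nn_integral_indicator[symmetric], simp) (subst nn_integral_unif, auto)
    finally show "emeasure (distr K' (unif m y') fst) B = emeasure (unif m y') B" .
  qed simp
  have marg2: "distr K' \<nu> snd = \<nu>"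
  proof (rule measure_eqI)
    fix B assume "B \<in> sets (distr K' \<nu> snd)"
    then have B: "B \<in> sets \<nu>" by simp
    then have B' [measurable]: "B \<in> sets borel" by (simp add: nu)
    have "emeasure (distr K' \<nu> snd) B = (\<integral>\<^sup>+z. indicator B (snd z) \<partial>K')"
      using g2 B by (subst nn_integral_indicator[symmetric], simp) (subst nn_integral_distr, auto)
    also have "\<dots> = (\<integral>\<^sup>+z. (\<Sum>i<m. ennreal (w i (fst z)) * indicator B (snd z)) \<partial>K)"
      using B by (subst int') auto
    also have "\<dots> = (\<integral>\<^sup>+z. indicator B (snd z) \<partial>K)"
    proof (rule nn_integral_cong_AE)
      show "AE z in K. (\<Sum>i<m. ennreal (w i (fst z)) * indicator B (snd z)) = indicator B (snd z)"
        using atoms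
      proof (rule eventually_mono)
        fix z :: "real \<times> real" assume "fst z \<in> y ` {..<m}"
        then obtain j where j: "j < m" "fst z = y j" by auto
        have "(\<Sum>i<m. ennreal (w i (fst z)) * indicator B (snd z)) = (\<Sum>i<m. ennreal (w i (y j))) * indicator B (snd z)"
          by (simp add: j sum_distrib_right)
        then show "(\<Sum>i<m. ennreal (w i (fst z)) * indicator B (snd z)) = indicator B (snd z)"
          by (simp add: sum_ennreal w0 sum1[OF j(1)])
      qed
    qed
    also have "\<dots> = emeasure (distr K \<nu> snd) B"
      using f2 B by (subst nn_integral_indicator[symmetric], simp) (subst nn_integral_distr, auto)
    finally show "emeasure (distr K' \<nu> snd) B = emeasure \<nu> B" by (simp add: K2)
  qed simp
  have K': "K' \<in> couplings (unif m y') \<nu>"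
    using marg1 marg2 by (simp add: couplings_def K'_def)
  have "(\<integral>\<^sup>+z. ennreal ((norm (fst z - snd z))\<^sup>2) \<partial>K')
      = (\<integral>\<^sup>+z. (\<Sum>i<m. ennreal (w i (fst z)) * ennreal ((y' i - snd z)\<^sup>2)) \<partial>K)"
    by (subst int') (simp_all cong: measurable_cong_sets[OF sE refl])
  also have "\<dots> \<le> (\<integral>\<^sup>+z. ennreal ((a + b) / a) * ennreal ((fst z - snd z)\<^sup>2)
      + ennreal ((a + b) / b) * (\<Sum>i<m. ennreal (w i (fst z)) * ennreal ((y i - y' i)\<^sup>2)) \<partial>K)"
  proof (rule nn_integral_mono_AE)
    show "AE z in K. (\<Sum>i<m. ennreal (w i (fst z)) * ennreal ((y' i - snd z)\<^sup>2))
      \<le> ennreal ((a + b) / a) * ennreal ((fst z - snd z)\<^sup>2)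
      + ennreal ((a + b) / b) * (\<Sum>i<m. ennreal (w i (fst z)) * ennreal ((y i - y' i)\<^sup>2))"
      using atoms
    proof (rule eventually_mono)
      fix z :: "real \<times> real" assume "fst z \<in> y ` {..<m}"
      then obtain j where j: "j < m" "fst z = y j" by auto
      have "(\<Sum>i<m. w i (fst z) * (y' i - snd z)\<^sup>2)
        \<le> (\<Sum>i<m. w i (fst z) * ((a + b) / a * (fst z - snd z)\<^sup>2 + (a + b) / b * (y i - y' i)\<^sup>2))"
      proof (rule sum_mono)
        fix i
        show "w i (fst z) * (y' i - snd z)\<^sup>2
          \<le> w i (fst z) * ((a + b) / a * (fst z - snd z)\<^sup>2 + (a + b) / b * (y i - y' i)\<^sup>2)"
        proof (cases "fst z = y i")
          case True
          have "(y' i - snd z)\<^sup>2 = ((fst z - snd z) + (y' i - y i))\<^sup>2" by (simp add: True)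
          also have "\<dots> \<le> (a + b) * ((fst z - snd z)\<^sup>2 / a + (y' i - y i)\<^sup>2 / b)"
            using ab by (rule weighted_square_le)
          also have "\<dots> = (a + b) / a * (fst z - snd z)\<^sup>2 + (a + b) / b * (y i - y' i)\<^sup>2"
            by (simp add: distrib_left power2_commute[of "y' i"])
          finally show ?thesis by (intro mult_left_mono w0)
        qed (simp add: w_def)
      qed
      also have "\<dots> = (\<Sum>i<m. w i (y j)) * ((a + b) / a * (fst z - snd z)\<^sup>2) + (a + b) / b * (\<Sum>i<m. w i (fst z) * (y i - y' i)\<^sup>2)"
      proof -
        have "(\<Sum>i<m. u i * (r + e * v i)) = (\<Sum>i<m. u i) * r + e * (\<Sum>i<m. u i * v i)"
          for u v :: "nat \<Rightarrow> real" and r e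
          by (simp add: distrib_left sum.distrib sum_distrib_right sum_distrib_left mult_ac)
        then show ?thesis by (simp only: j)
      qed
      finally have "(\<Sum>i<m. w i (fst z) * (y' i - snd z)\<^sup>2)
          \<le> (a + b) / a * (fst z - snd z)\<^sup>2 + (a + b) / b * (\<Sum>i<m. w i (fst z) * (y i - y' i)\<^sup>2)"
        by (simp only: sum1[OF j(1)] mult_1)
      then have "ennreal (\<Sum>i<m. w i (fst z) * (y' i - snd z)\<^sup>2)
          \<le> ennreal ((a + b) / a * (fst z - snd z)\<^sup>2 + (a + b) / b * (\<Sum>i<m. w i (fst z) * (y i - y' i)\<^sup>2))"
        by (rule ennreal_leI)
      also have "\<dots> = ennreal ((a + b) / a) * ennreal ((fst z - snd z)\<^sup>2)
          + ennreal ((a + b) / b) * ennreal (\<Sum>i<m. w i (fst z) * (y i - y' i)\<^sup>2)"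
      proof -
        have split: "ennreal (p * u + r * v) = ennreal p * ennreal u + ennreal r * ennreal v"
          if "0 \<le> p" "0 \<le> u" "0 \<le> r" "0 \<le> v" for p u r v :: real
          using that by (simp add: ennreal_mult)
        show ?thesis
          using ab w0 by (intro split) (auto intro!: sum_nonneg mult_nonneg_nonneg)
      qed
      finally show "(\<Sum>i<m. ennreal (w i (fst z)) * ennreal ((y' i - snd z)\<^sup>2))
        \<le> ennreal ((a + b) / a) * ennreal ((fst z - snd z)\<^sup>2)
        + ennreal ((a + b) / b) * (\<Sum>i<m. ennreal (w i (fst z)) * ennreal ((y i - y' i)\<^sup>2))"
        using w0 by (simp add: ennreal_mult[symmetric] sum_ennreal)
    qed
  qed
  also have "\<dots> = ennreal ((a + b) / a) * (\<integral>\<^sup>+z. ennreal ((fst z - snd z)\<^sup>2) \<partial>K)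
      + ennreal ((a + b) / b) * (\<integral>\<^sup>+z. (\<Sum>i<m. ennreal (w i (fst z)) * ennreal ((y i - y' i)\<^sup>2)) \<partial>K)"
    by (subst nn_integral_add) (auto simp: nn_integral_cmult)
  also have "(\<integral>\<^sup>+z. (\<Sum>i<m. ennreal (w i (fst z)) * ennreal ((y i - y' i)\<^sup>2)) \<partial>K)
      = (\<Sum>j<m. ennreal (1 / real m) * (\<Sum>i<m. ennreal (w i (y j)) * ennreal ((y i - y' i)\<^sup>2)))"
    by (subst int1) auto
  also have "\<dots> = (\<Sum>i<m. ennreal (1 / real m) * ennreal ((y i - y' i)\<^sup>2) * (\<Sum>j<m. ennreal (w i (y j))))"
    unfolding sum_distrib_left by (subst sum.swap) (simp add: mult_ac)
  also have "\<dots> = (\<Sum>i<m. ennreal (1 / real m) * ennreal ((y i - y' i)\<^sup>2))"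
    by (intro sum.cong refl) (simp add: sum_ennreal w0 sum2)
  also have "\<dots> = ennreal ((1 / real m) * (\<Sum>i<m. (y i - y' i)\<^sup>2))"
    by (simp add: ennreal_mult[symmetric] sum_distrib_left sum_ennreal del: times_divide_eq_left)
  also have "ennreal ((a + b) / a) * (\<integral>\<^sup>+z. ennreal ((fst z - snd z)\<^sup>2) \<partial>K) + ennreal ((a + b) / b) * \<dots>
      \<le> ennreal ((a + b) / a) * ennreal (a\<^sup>2) + ennreal ((a + b) / b) * ennreal (b\<^sup>2)"
    using cost move by (intro add_mono mult_left_mono ennreal_leI) auto
  also have "\<dots> = ennreal ((a + b)\<^sup>2)"
  proof -
    have "(a + b) / a * a\<^sup>2 + (a + b) / b * b\<^sup>2 = (a + b)\<^sup>2"
      using ab by (simp add: power2_eq_square field_simps)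
    then show ?thesis
      using ab by (simp add: ennreal_mult[symmetric] ennreal_plus[symmetric] del: ennreal_plus)
  qed
  finally have "(\<integral>\<^sup>+z. ennreal ((norm (fst z - snd z))\<^sup>2) \<partial>K') \<le> ennreal ((a + b)\<^sup>2)" .
  then have "enn_powr (\<integral>\<^sup>+z. ennreal ((norm (fst z - snd z))\<^sup>2) \<partial>K') (1/2) \<le> ennreal (a + b)"
    using enn_powr_half_mono enn_powr_half_square[of "a + b"] ab by (metis add_pos_pos less_imp_le)
  then show ?thesis
    unfolding W2_def by (rule INF_lower2[OF K'])
qed

lemma W2_unif_lipschitz:
  assumes m: "m > 0" and nu: "prob_space \<nu>" "sets \<nu> = sets borel"
    and b: "b \<ge> 0" "(1 / real m) * (\<Sum>i<m. (y i - y' i)\<^sup>2) \<le> b\<^sup>2"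
  shows "W2 (unif m y') \<nu> \<le> W2 (unif m y) \<nu> + ennreal b"
proof (rule ennreal_le_epsilon)
  fix e :: real assume fin: "W2 (unif m y) \<nu> + ennreal b < top" and e: "0 < e"
  then obtain r where r: "r \<ge> 0" "W2 (unif m y) \<nu> = ennreal r"
    by (cases "W2 (unif m y) \<nu>") auto
  have "W2 (unif m y) \<nu> < ennreal (r + e / 2)" using r e by (simp add: ennreal_less_iff)
  then obtain K where K: "K \<in> couplings (unif m y) \<nu>"
      and lt: "enn_powr (\<integral>\<^sup>+z. ennreal ((norm (fst z - snd z))\<^sup>2) \<partial>K) (1/2) < ennreal (r + e / 2)"
    unfolding W2_def INF_less_iff by blast
  have cost: "(\<integral>\<^sup>+z. ennreal ((norm (fst z - snd z))\<^sup>2) \<partial>K) \<le> ennreal ((r + e / 2)\<^sup>2)"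
  proof (rule ccontr)
    assume "\<not> ?thesis"
    then have "ennreal (r + e / 2) \<le> enn_powr (\<integral>\<^sup>+z. ennreal ((norm (fst z - snd z))\<^sup>2) \<partial>K) (1/2)"
      using enn_powr_half_mono[of "ennreal ((r + e / 2)\<^sup>2)"] enn_powr_half_square[of "r + e / 2"] r e by auto
    with lt show False by simp
  qed
  have "W2 (unif m y') \<nu> \<le> ennreal ((r + e / 2) + (b + e / 2))"
  proof (rule move_atoms_coupling[OF m nu K _ _ cost])
    show "(1 / real m) * (\<Sum>i<m. (y i - y' i)\<^sup>2) \<le> (b + e / 2)\<^sup>2"
      using b(2) by (rule order_trans) (use b e in \<open>auto intro!: power_mono\<close>)
  qed (use r b e in auto)
  also have "\<dots> = W2 (unif m y) \<nu> + ennreal b + ennreal e"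
    using r b e by (simp add: ennreal_plus[symmetric] del: ennreal_plus)
  finally show "W2 (unif m y') \<nu> \<le> W2 (unif m y) \<nu> + ennreal b + ennreal e" .
qed

section \<open>Measurability in the sample\<close>

text \<open>
  Under these assumptions \<open>f\<close> is the infimum over the countable set \<open>D\<close> of the functions
  \<open>f z + \<delta> x z\<close>.
\<close>

lemma measurable_of_modulus:
  fixes f :: "'a \<Rightarrow> ennreal" and \<delta> :: "'a \<Rightarrow> 'a \<Rightarrow> real"
  assumes D: "countable D" "D \<subseteq> space M"
    and meas: "\<And>z. z \<in> D \<Longrightarrow> (\<lambda>x. \<delta> x z) \<in> borel_measurable M"
    and le: "\<And>x z. x \<in> space M \<Longrightarrow> z \<in> D \<Longrightarrow> f x \<le> f z + ennreal (\<delta> x z) \<and> f z \<le> f x + ennreal (\<delta> x z)"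
    and dense: "\<And>x e. x \<in> space M \<Longrightarrow> e > 0 \<Longrightarrow> \<exists>z\<in>D. \<delta> x z \<le> e"
  shows "f \<in> borel_measurable M"
proof -
  have "f x = (INF z\<in>D. f z + ennreal (\<delta> x z))" if x: "x \<in> space M" for x
  proof (rule antisym)
    show "f x \<le> (INF z\<in>D. f z + ennreal (\<delta> x z))"
      using le[OF x] by (intro INF_greatest) auto
    show "(INF z\<in>D. f z + ennreal (\<delta> x z)) \<le> f x"
    proof (rule ennreal_le_epsilon)
      fix e :: real assume "0 < e"
      then obtain z where z: "z \<in> D" "\<delta> x z \<le> e / 2" using dense[OF x, of "e / 2"] by auto
      have "(INF z\<in>D. f z + ennreal (\<delta> x z)) \<le> f z + ennreal (\<delta> x z)" using z(1) by (rule INF_lower)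
      also have "\<dots> \<le> f x + ennreal (\<delta> x z) + ennreal (\<delta> x z)"
        using le[OF x z(1)] by (intro add_right_mono) simp
      also have "\<dots> \<le> f x + ennreal (e / 2) + ennreal (e / 2)"
        using z(2) by (intro add_mono ennreal_leI) auto
      also have "\<dots> = f x + ennreal e"
        using \<open>0 < e\<close> by (simp add: add.assoc ennreal_plus[symmetric] del: ennreal_plus)
      finally show "(INF z\<in>D. f z + ennreal (\<delta> x z)) \<le> f x + ennreal e" .
    qed
  qed
  moreover have "(\<lambda>x. INF z\<in>D. f z + ennreal (\<delta> x z)) \<in> borel_measurable M"
    using D(1) meas by (intro borel_measurable_INF) auto
  ultimately show ?thesis by (simp cong: measurable_cong)
qed

definition sdist :: "nat \<Rightarrow> nat \<Rightarrow> (nat \<Rightarrow> nat \<Rightarrow> real) \<Rightarrow> (nat \<Rightarrow> nat \<Rightarrow> real) \<Rightarrow> real" where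
  "sdist d m x z = (\<Sum>i<m. \<Sum>k<d. \<bar>x i k - z i k\<bar>)"

text \<open>
  The quantity \<open>\<rho>\<close> is quadratic in the sample, so its modulus of continuity has to grow with the
  sample; the same modulus serves for the sliced distance, which is Lipschitz.
\<close>

definition modulus :: "nat \<Rightarrow> nat \<Rightarrow> (nat \<Rightarrow> nat \<Rightarrow> real) \<Rightarrow> (nat \<Rightarrow> nat \<Rightarrow> real) \<Rightarrow> real" where
  "modulus d m x z = sdist d m x z * (1 + 2 * sdist d m x (\<lambda>_ _. 0) + sdist d m x z)"

lemma sdist_nonneg [simp]: "0 \<le> sdist d m x z"
  unfolding sdist_def by (intro sum_nonneg) auto

lemma sdist_le_modulus: "sdist d m x z \<le> modulus d m x z"
  using mult_left_mono[of 1 "1 + 2 * sdist d m x (\<lambda>_ _. 0) + sdist d m x z" "sdist d m x z"]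
  by (simp add: modulus_def)

lemma sample_measurable_of_modulus:
  fixes f :: "(nat \<Rightarrow> nat \<Rightarrow> real) \<Rightarrow> ennreal"
  assumes mu: "sets \<mu> = sets (euc d)"
    and le: "\<And>x z. x \<in> space (PiM {..<m} (\<lambda>_. \<mu>)) \<Longrightarrow> z \<in> space (PiM {..<m} (\<lambda>_. \<mu>)) \<Longrightarrow>
      f x \<le> f z + ennreal (modulus d m x z) \<and> f z \<le> f x + ennreal (modulus d m x z)"
  shows "f \<in> borel_measurable (PiM {..<m} (\<lambda>_. \<mu>))"
proof (rule measurable_of_modulus)
  let ?P = "PiM {..<m} (\<lambda>_. \<mu>)"
  let ?D = "PiE {..<m} (\<lambda>_. PiE {..<d} (\<lambda>_. \<rat> :: real set))"
  have space: "space ?P = PiE {..<m} (\<lambda>_. PiE {..<d} (\<lambda>_. UNIV))"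
    using sets_eq_imp_space_eq[OF mu] by (simp add: space_PiM)
  show "countable ?D" by (intro countable_PiE countable_rat) auto
  show D: "?D \<subseteq> space ?P" unfolding space by (intro PiE_mono) auto
  have [measurable]: "(\<lambda>x. x i k) \<in> borel_measurable ?P" if "i < m" "k < d" for i k
  proof -
    have "(\<lambda>w. w k) \<in> borel_measurable \<mu>"
      using that measurable_component_singleton[of k "{..<d}" "\<lambda>_. borel :: real measure"]
      by (simp add: measurable_cong_sets[OF mu refl])
    then show ?thesis
      using measurable_compose[OF measurable_component_singleton[of i "{..<m}" "\<lambda>_. \<mu>"]] that by simp
  qed
  show "(\<lambda>x. modulus d m x z) \<in> borel_measurable ?P" for z
    unfolding modulus_def sdist_def by measurable
  show "f x \<le> f z + ennreal (modulus d m x z) \<and> f z \<le> f x + ennreal (modulus d m x z)"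
    if "x \<in> space ?P" "z \<in> ?D" for x z
    using le that D by blast
  show "\<exists>z\<in>?D. modulus d m x z \<le> e" if x: "x \<in> space ?P" and e: "e > 0" for x e
  proof -
    define N where "N = sdist d m x (\<lambda>_ _. 0)"
    have N: "N \<ge> 0" by (simp add: N_def)
    \<comment> \<open>with distance at most \<open>u \<le> 1\<close> the second factor of the modulus is at most \<open>2 + 2 N\<close>\<close>
    define u where "u = min 1 (e / (2 + 2 * N))"
    have u: "u > 0" using e N by (simp add: u_def)
    define h where "h = u / (real m * real d + 1)"
    have h: "h > 0" using u by (simp add: h_def add_nonneg_pos)
    have "\<exists>r\<in>\<rat>. \<bar>x i k - r\<bar> < h" for i k
    proof -
      obtain r where "r \<in> \<rat>" "x i k < r" "r < x i k + h"
        using Rats_dense_in_real[of "x i k" "x i k + h"] h by auto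
      then show ?thesis by (intro bexI[of _ r]) auto
    qed
    then obtain r where r: "\<And>i k. r i k \<in> \<rat>" "\<And>i k. \<bar>x i k - r i k\<bar> < h" by metis
    define z where "z = (\<lambda>i\<in>{..<m}. \<lambda>k\<in>{..<d}. r i k)"
    have "z \<in> ?D" unfolding z_def using r(1) by (intro restrict_PiE_iff[THEN iffD2] ballI) auto
    have "sdist d m x z \<le> (\<Sum>i<m. \<Sum>k<d. h)"
      unfolding sdist_def z_def using r(2) by (intro sum_mono) (auto simp: less_imp_le)
    also have "\<dots> = real m * real d * h" by simp
    also have "\<dots> \<le> (real m * real d + 1) * h" using h by (intro mult_right_mono) auto
    also have "\<dots> = u"
      using add_nonneg_pos[of "real m * real d" 1] by (simp add: h_def)
    finally have S: "sdist d m x z \<le> u" .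
    have "modulus d m x z \<le> u * (1 + 2 * N + 1)"
      unfolding modulus_def N_def[symmetric] using S N u by (intro mult_mono add_mono) (auto simp: u_def)
    also have "\<dots> \<le> e / (2 + 2 * N) * (1 + 2 * N + 1)"
      using N by (intro mult_right_mono) (auto simp: u_def)
    also have "\<dots> = e" using N by (simp add: add_nonneg_eq_0_iff)
    finally show ?thesis using \<open>z \<in> ?D\<close> by blast
  qed
qed

lemma unit_sphere_nonempty: "d \<ge> 1 \<Longrightarrow> unit_sphere d \<noteq> {}"
proof -
  assume d: "d \<ge> 1"
  let ?t = "\<lambda>i\<in>{..<d}. if i = 0 then 1 else 0 :: real"
  have "(\<Sum>i<d. (?t i)\<^sup>2) = (\<Sum>i<d. if i = 0 then 1 else 0)" by (intro sum.cong) auto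
  also have "\<dots> = 1" using d by (subst sum.delta) auto
  finally have "?t \<in> unit_sphere d" by (simp add: unit_sphere_def)
  then show ?thesis by blast
qed

lemma unit_sphere_L2: "\<theta> \<in> unit_sphere d \<Longrightarrow> L2_set \<theta> {..<d} = 1"
  by (simp add: unit_sphere_def L2_set_def)

lemma abs_ip_unit_le:
  assumes "\<theta> \<in> unit_sphere d"
  shows "\<bar>ip d x \<theta>\<bar> \<le> (\<Sum>k<d. \<bar>x k\<bar>)"
  using abs_ip_le[of d x \<theta>] L2_set_le_sum_abs[of x "{..<d}"] unit_sphere_L2[OF assms] by simp

lemma ip_eq_scaled_unit:
  assumes "L2_set v {..<d} \<noteq> 0"
  shows "\<exists>w\<in>unit_sphere d. \<forall>y. ip d y v = L2_set v {..<d} * ip d y w"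
proof -
  have lv: "L2_set v {..<d} > 0" using assms L2_set_nonneg[of v "{..<d}"] by linarith
  define w where "w = (\<lambda>i\<in>{..<d}. v i / L2_set v {..<d})"
  have "(\<Sum>i<d. (w i)\<^sup>2) = (\<Sum>i<d. (v i)\<^sup>2) / (L2_set v {..<d})\<^sup>2"
    by (simp add: w_def power_divide sum_divide_distrib)
  also have "(\<Sum>i<d. (v i)\<^sup>2) = (L2_set v {..<d})\<^sup>2" by (simp add: L2_set_def sum_nonneg)
  finally have "w \<in> unit_sphere d" using lv by (simp add: unit_sphere_def w_def)
  moreover have "ip d y v = L2_set v {..<d} * ip d y w" for y
    unfolding ip_def w_def using lv by (simp add: sum_distrib_left)
  ultimately show ?thesis by blast
qed

lemma ip_diff_left: "ip d x v - ip d z v = ip d (\<lambda>i. x i - z i) v"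
  by (simp add: ip_def sum_subtractf[symmetric] left_diff_distrib)

lemma sample_space_euc:
  assumes mu: "sets \<mu> = sets (euc d)" and x: "x \<in> space (PiM {..<m} (\<lambda>_. \<mu>))"
  shows "x \<in> measurable (uniform_count_measure {..<m}) (euc d)"
  using x sets_eq_imp_space_eq[OF mu]
  by (auto simp: uniform_count_measure_def space_PiM)

lemma ip_measurable [measurable]: "(\<lambda>x. ip d x v) \<in> borel_measurable (euc d)"
  unfolding ip_def by measurable

lemma marginal_empirical:
  assumes "sets \<mu> = sets (euc d)" "x \<in> space (PiM {..<m} (\<lambda>_. \<mu>))"
  shows "marginal d (empirical d m x) \<theta> = unif m (\<lambda>i. ip d (x i) \<theta>)"
  unfolding marginal_def empirical_def unif_def
  using sample_space_euc[OF assms] by (subst distr_distr) (auto simp: o_def)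

lemma prob_space_marginal:
  assumes "prob_space \<mu>" "sets \<mu> = sets (euc d)"
  shows "prob_space (marginal d \<mu> \<theta>)"
  unfolding marginal_def
  by (rule prob_space.prob_space_distr[OF assms(1)]) (simp add: measurable_cong_sets[OF assms(2) refl])

lemma sets_marginal [simp, measurable_cong]: "sets (marginal d \<mu> \<theta>) = sets borel"
  by (simp add: marginal_def)

lemma SW2_measurable:
  assumes p: "prob_space \<mu>" and mu: "sets \<mu> = sets (euc d)" and m: "m > 0"
  shows "(\<lambda>x. SW2 d (empirical d m x) \<mu>) \<in> borel_measurable (PiM {..<m} (\<lambda>_. \<mu>))"
proof (rule sample_measurable_of_modulus[OF mu])
  let ?P = "PiM {..<m} (\<lambda>_. \<mu>)"
  have *: "SW2 d (empirical d m x) \<mu> \<le> SW2 d (empirical d m z) \<mu> + ennreal (sdist d m x z)"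
    if xz: "x \<in> space ?P" "z \<in> space ?P" for x z
    unfolding SW2_def
  proof (rule SUP_least)
    fix \<theta> assume t: "\<theta> \<in> unit_sphere d"
    have "W2 (unif m (\<lambda>i. ip d (x i) \<theta>)) (marginal d \<mu> \<theta>)
        \<le> W2 (unif m (\<lambda>i. ip d (z i) \<theta>)) (marginal d \<mu> \<theta>) + ennreal (sdist d m x z)"
    proof (rule W2_unif_lipschitz[OF m prob_space_marginal[OF p mu] sets_marginal])
      have "(1 / real m) * (\<Sum>i<m. (ip d (z i) \<theta> - ip d (x i) \<theta>)\<^sup>2) \<le> 1 * (\<Sum>i<m. (ip d (z i) \<theta> - ip d (x i) \<theta>)\<^sup>2)"
        using m by (intro mult_right_mono sum_nonneg) auto
      also have "\<dots> = (L2_set (\<lambda>i. ip d (z i) \<theta> - ip d (x i) \<theta>) {..<m})\<^sup>2"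
        by (simp add: L2_set_def sum_nonneg)
      also have "\<dots> \<le> (\<Sum>i<m. \<bar>ip d (z i) \<theta> - ip d (x i) \<theta>\<bar>)\<^sup>2"
        by (intro power_mono L2_set_le_sum_abs) simp
      also have "\<dots> \<le> (sdist d m x z)\<^sup>2"
      proof (intro power_mono sum_nonneg)
        show "(\<Sum>i<m. \<bar>ip d (z i) \<theta> - ip d (x i) \<theta>\<bar>) \<le> sdist d m x z"
          unfolding sdist_def
          by (intro sum_mono, subst abs_minus_commute, unfold ip_diff_left, rule abs_ip_unit_le[OF t])
      qed simp
      finally show "(1 / real m) * (\<Sum>i<m. (ip d (z i) \<theta> - ip d (x i) \<theta>)\<^sup>2) \<le> (sdist d m x z)\<^sup>2" .
    qed simp
    also have "\<dots> \<le> (SUP \<theta>\<in>unit_sphere d. W2 (marginal d (empirical d m z) \<theta>) (marginal d \<mu> \<theta>)) + ennreal (sdist d m x z)"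
      unfolding marginal_empirical[OF mu xz(2)] using t by (intro add_right_mono SUP_upper)
    finally show "W2 (marginal d (empirical d m x) \<theta>) (marginal d \<mu> \<theta>)
      \<le> (SUP \<theta>\<in>unit_sphere d. W2 (marginal d (empirical d m z) \<theta>) (marginal d \<mu> \<theta>)) + ennreal (sdist d m x z)"
      unfolding marginal_empirical[OF mu xz(1)] .
  qed
  have sym: "sdist d m z x = sdist d m x z" for x z
    by (simp add: sdist_def abs_minus_commute)
  show "SW2 d (empirical d m x) \<mu> \<le> SW2 d (empirical d m z) \<mu> + ennreal (modulus d m x z) \<and>
        SW2 d (empirical d m z) \<mu> \<le> SW2 d (empirical d m x) \<mu> + ennreal (modulus d m x z)"
    if xz: "x \<in> space ?P" "z \<in> space ?P" for x z
    using *[OF xz] *[OF xz(2,1)] ennreal_leI[OF sdist_le_modulus[of d m x z]]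
    by (auto simp: sym intro: order_trans add_left_mono)
qed

lemma rho_bdd_above:
  assumes m: "m > 0"
  shows "bdd_above ((\<lambda>\<theta>. \<bar>(1 / real m) * (\<Sum>i<m. (ip d (x i) \<theta>)\<^sup>2) - 1\<bar>) ` unit_sphere d)"
proof (rule bdd_aboveI2)
  fix \<theta> assume t: "\<theta> \<in> unit_sphere d"
  have "\<bar>(1 / real m) * (\<Sum>i<m. (ip d (x i) \<theta>)\<^sup>2) - 1\<bar> \<le> (1 / real m) * (\<Sum>i<m. (ip d (x i) \<theta>)\<^sup>2) + 1"
  proof -
    have "0 \<le> (1 / real m) * (\<Sum>i<m. (ip d (x i) \<theta>)\<^sup>2)" by (intro mult_nonneg_nonneg sum_nonneg) auto
    then show ?thesis by linarith
  qed
  also have "\<dots> \<le> (1 / real m) * (\<Sum>i<m. (\<Sum>k<d. \<bar>x i k\<bar>)\<^sup>2) + 1"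
    using abs_ip_unit_le[OF t] by (intro add_right_mono mult_left_mono sum_mono) (auto simp: abs_le_square_iff[symmetric] sum_nonneg)
  finally show "\<bar>(1 / real m) * (\<Sum>i<m. (ip d (x i) \<theta>)\<^sup>2) - 1\<bar> \<le> (1 / real m) * (\<Sum>i<m. (\<Sum>k<d. \<bar>x i k\<bar>)\<^sup>2) + 1" .
qed

lemma rho_upper:
  assumes "m > 0" "\<theta> \<in> unit_sphere d"
  shows "\<bar>(1 / real m) * (\<Sum>i<m. (ip d (x i) \<theta>)\<^sup>2) - 1\<bar> \<le> rho d m x"
  unfolding rho_def using assms(2) rho_bdd_above[OF assms(1)] by (rule cSUP_upper)

lemma rho_nonneg:
  assumes "m > 0" "d \<ge> 1"
  shows "0 \<le> rho d m x"
proof -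
  obtain \<theta> where "\<theta> \<in> unit_sphere d" using unit_sphere_nonempty[OF assms(2)] by blast
  from rho_upper[OF assms(1) this, of x] show ?thesis by linarith
qed

text \<open>
  Uniformly over the sphere, \<open>\<langle>x i, \<theta>\<rangle>\<^sup>2 - \<langle>z i, \<theta>\<rangle>\<^sup>2\<close> is at most \<open>s (2 n + s)\<close> with \<open>s\<close> and \<open>n\<close> the
  \<open>l\<^sub>1\<close> norms of \<open>x i - z i\<close> and \<open>x i\<close>.
\<close>

lemma rho_modulus:
  assumes m: "m > 0" and d: "d \<ge> 1"
  shows "rho d m x \<le> rho d m z + modulus d m x z" "rho d m z \<le> rho d m x + modulus d m x z"
proof -
  define F where "F = (\<lambda>x \<theta>. (1 / real m) * (\<Sum>i<m. (ip d (x i) \<theta>)\<^sup>2))"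
  have F: "\<bar>F x \<theta> - F z \<theta>\<bar> \<le> modulus d m x z" if t: "\<theta> \<in> unit_sphere d" for \<theta>
  proof -
    define s where "s = (\<lambda>i. \<Sum>k<d. \<bar>x i k - z i k\<bar>)"
    define n where "n = (\<lambda>i. \<Sum>k<d. \<bar>x i k\<bar>)"
    have s: "s i \<ge> 0" "n i \<ge> 0" for i by (auto simp: s_def n_def sum_nonneg)
    have S: "sdist d m x z = (\<Sum>i<m. s i)" and N: "sdist d m x (\<lambda>_ _. 0) = (\<Sum>i<m. n i)"
      by (simp_all add: sdist_def s_def n_def)
    have one: "\<bar>(ip d (x i) \<theta>)\<^sup>2 - (ip d (z i) \<theta>)\<^sup>2\<bar> \<le> s i * (2 * sdist d m x (\<lambda>_ _. 0) + sdist d m x z)"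
      if i: "i < m" for i
    proof -
      let ?a = "ip d (x i) \<theta>" and ?b = "ip d (z i) \<theta>"
      have ab: "\<bar>?a - ?b\<bar> \<le> s i"
        unfolding ip_diff_left s_def by (rule abs_ip_unit_le[OF t])
      have a: "\<bar>?a\<bar> \<le> n i" unfolding n_def by (rule abs_ip_unit_le[OF t])
      have "\<bar>?a\<^sup>2 - ?b\<^sup>2\<bar> = \<bar>?a - ?b\<bar> * \<bar>?a + ?b\<bar>"
        by (simp add: power2_eq_square algebra_simps flip: abs_mult)
      also have "\<dots> \<le> s i * (2 * n i + s i)"
        using ab a s by (intro mult_mono) auto
      also have "\<dots> \<le> s i * (2 * sdist d m x (\<lambda>_ _. 0) + sdist d m x z)"
        unfolding S N using s i by (intro mult_left_mono add_mono member_le_sum) auto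
      finally show ?thesis .
    qed
    have "\<bar>F x \<theta> - F z \<theta>\<bar> = (1 / real m) * \<bar>\<Sum>i<m. (ip d (x i) \<theta>)\<^sup>2 - (ip d (z i) \<theta>)\<^sup>2\<bar>"
      using m by (simp add: F_def sum_subtractf diff_divide_distrib[symmetric])
    also have "\<dots> \<le> 1 * \<bar>\<Sum>i<m. (ip d (x i) \<theta>)\<^sup>2 - (ip d (z i) \<theta>)\<^sup>2\<bar>"
      using m by (intro mult_right_mono) auto
    also have "\<dots> \<le> (\<Sum>i<m. s i * (2 * sdist d m x (\<lambda>_ _. 0) + sdist d m x z))"
      using one by (simp, intro order_trans[OF sum_abs] sum_mono) auto
    also have "\<dots> = sdist d m x z * (2 * sdist d m x (\<lambda>_ _. 0) + sdist d m x z)"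
      by (simp add: S sum_distrib_right)
    also have "\<dots> \<le> modulus d m x z"
      unfolding modulus_def by (intro mult_left_mono) auto
    finally show ?thesis .
  qed
  have rhoF: "rho d m y = (SUP \<theta>\<in>unit_sphere d. \<bar>F y \<theta> - 1\<bar>)" for y by (simp add: rho_def F_def)
  show "rho d m x \<le> rho d m z + modulus d m x z"
    unfolding rhoF[of x]
  proof (rule cSUP_least[OF unit_sphere_nonempty[OF d]])
    fix \<theta> assume t: "\<theta> \<in> unit_sphere d"
    show "\<bar>F x \<theta> - 1\<bar> \<le> rho d m z + modulus d m x z"
      using F[OF t] rho_upper[OF m t, of z] unfolding F_def by linarith
  qed
  show "rho d m z \<le> rho d m x + modulus d m x z"
    unfolding rhoF[of z]
  proof (rule cSUP_least[OF unit_sphere_nonempty[OF d]])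
    fix \<theta> assume t: "\<theta> \<in> unit_sphere d"
    show "\<bar>F z \<theta> - 1\<bar> \<le> rho d m x + modulus d m x z"
      using F[OF t] rho_upper[OF m t, of x] unfolding F_def by linarith
  qed
qed

lemma rho_measurable:
  assumes mu: "sets \<mu> = sets (euc d)" and m: "m > 0" and d: "d \<ge> 1"
  shows "rho d m \<in> borel_measurable (PiM {..<m} (\<lambda>_. \<mu>))"
proof -
  have m0: "0 \<le> modulus d m x z" for x z
    using sdist_le_modulus[of d m x z] sdist_nonneg[of d m x z] by linarith
  have "(\<lambda>x. ennreal (rho d m x)) \<in> borel_measurable (PiM {..<m} (\<lambda>_. \<mu>))"
    by (rule sample_measurable_of_modulus[OF mu])
       (use rho_modulus[OF m d] rho_nonneg[OF m d] m0 in \<open>auto simp flip: ennreal_plus intro!: ennreal_leI\<close>)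
  then have "(\<lambda>x. enn2real (ennreal (rho d m x))) \<in> borel_measurable (PiM {..<m} (\<lambda>_. \<mu>))"
    by measurable
  then show ?thesis
    using rho_nonneg[OF m d] by simp
qed

section \<open>Deviations of the projections of a sample\<close>

lemma surv_unif:
  assumes m: "m > 0"
  shows "surv (unif m y) t = (1 / real m) * (\<Sum>i<m. step (y i) t)"
  unfolding unif_def using uniform_index[OF m] by (simp add: surv_distr integral_uniform_count_measure)

text \<open>
  The assumptions of the theorem in homogeneous form: they hold for every vector and not only on the
  sphere, since the nets consist of vectors of the unit ball.  The constant \<open>A\<close> stands for \<open>L\<^sup>q\<close>.
\<close>

locale isotropic_law =
  fixes d :: nat and \<mu> :: "(nat \<Rightarrow> real) measure" and q A :: real
  assumes d: "d \<ge> 1"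
    and prob: "prob_space \<mu>" and sets_mu: "sets \<mu> = sets (euc d)"
    and q: "q \<ge> 4" and A: "A \<ge> 0"
    and second_integrable: "\<And>v. integrable \<mu> (\<lambda>x. (ip d x v)\<^sup>2)"
    and second_moment: "\<And>v. (\<integral>x. (ip d x v)\<^sup>2 \<partial>\<mu>) = (L2_set v {..<d})\<^sup>2"
    and moment_integrable: "\<And>v. integrable \<mu> (\<lambda>x. \<bar>ip d x v\<bar> powr q)"
    and moment: "\<And>v. (\<integral>x. \<bar>ip d x v\<bar> powr q \<partial>\<mu>) \<le> A * L2_set v {..<d} powr q"
begin

sublocale prob_space \<mu> by (rule prob)

abbreviation sample :: "nat \<Rightarrow> (nat \<Rightarrow> nat \<Rightarrow> real) measure" where
  "sample m \<equiv> PiM {..<m} (\<lambda>_. \<mu>)"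

abbreviation len :: "(nat \<Rightarrow> real) \<Rightarrow> real" where
  "len v \<equiv> L2_set v {..<d}"

lemma ip_measurable_mu [measurable]: "(\<lambda>x. ip d x v) \<in> borel_measurable \<mu>"
  by (simp add: measurable_cong_sets[OF sets_mu refl])

definition err :: "nat \<Rightarrow> (nat \<Rightarrow> nat \<Rightarrow> real) \<Rightarrow> (nat \<Rightarrow> real) \<Rightarrow> real \<Rightarrow> real" where
  "err m x v t = surv (unif m (\<lambda>i. ip d (x i) v)) t - surv (marginal d \<mu> v) t"

text \<open>
  The increments of the chain.  Since the deviation vanishes at \<open>w = 0\<close>, where both projections are the
  point mass at \<open>0\<close>, the chain can start from the zero vector, and \<open>dev m R x v 0\<close> is the quantity to be bounded.
\<close>

definition dev :: "nat \<Rightarrow> real \<Rightarrow> (nat \<Rightarrow> nat \<Rightarrow> real) \<Rightarrow> (nat \<Rightarrow> real) \<Rightarrow> (nat \<Rightarrow> real) \<Rightarrow> real" where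
  "dev m R x v w = (\<integral>t. \<bar>err m x v t - err m x w t\<bar> \<partial>wt R)"

lemma surv_marginal: "surv (marginal d \<mu> v) t = (\<integral>x. step (ip d x v) t \<partial>\<mu>)"
  unfolding marginal_def by (rule surv_distr[OF prob]) measurable

lemma err_diff_eq:
  assumes m: "m > 0"
  shows "err m x v t - err m x w t
    = (1 / real m) * (\<Sum>i<m. step (ip d (x i) v) t - step (ip d (x i) w) t) - (\<integral>x. step (ip d x v) t - step (ip d x w) t \<partial>\<mu>)"
proof -
  have "(\<integral>x. step (ip d x v) t - step (ip d x w) t \<partial>\<mu>) = (\<integral>x. step (ip d x v) t \<partial>\<mu>) - (\<integral>x. step (ip d x w) t \<partial>\<mu>)"
    by (intro Bochner_Integration.integral_diff integrable_step_diff(1)[where Y="\<lambda>_. 0"]) measurable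
  then show ?thesis
    by (simp add: err_def surv_unif[OF m] surv_marginal sum_subtractf diff_divide_distrib)
qed

lemma step_pair_measurable:
  "(\<lambda>(x, t). step (ip d x v) t - step (ip d x w) t) \<in> borel_measurable (\<mu> \<Otimes>\<^sub>M wt R)"
  by measurable

lemma dev_measurable:
  assumes m: "m > 0" and R: "R \<ge> 0"
  shows "(\<lambda>x. dev m R x v w) \<in> borel_measurable (sample m)"
proof -
  interpret W: finite_measure "wt R" using R by (rule finite_measure_wt)
  note average_deviation_measurable[OF step_pair_measurable, of m v w R, measurable]
  show ?thesis
    unfolding dev_def err_diff_eq[OF m] by measurable
qed

lemma dev_bound:
  assumes m: "m > 0" and s: "s > 0" and R: "R \<ge> 0" and K: "K \<ge> 0"
    and v: "len v \<le> 1" "len w \<le> 1" and e: "e > 0" "len (\<lambda>i. v i - w i) \<le> e"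
    and weight: "(\<integral>\<^sup>+t. ennreal ((1 + \<bar>t\<bar>) powr (3 - q)) * indicator {-R..R} t \<partial>lborel) \<le> ennreal K"
  shows "measure (sample m) {x \<in> space (sample m).
      2 * (sqrt (s / real m) * (sqrt e * (K + (A + 3 powr q * (1 + 2 * A)))) + s / real m * (2 * R\<^sup>2)) < dev m R x v w}
    \<le> 2 * exp (- s)"
proof -
  interpret W: finite_measure "wt R" using R by (rule finite_measure_wt)
  interpret S: product_prob_space "\<lambda>_::nat. \<mu>" "{..<m}" by unfold_locales
  let ?X = "\<lambda>x. ip d x v" and ?Y = "\<lambda>x. ip d x w"
  let ?g = "\<lambda>x t. step (?X x) t - step (?Y x) t"
  have sq: "(\<integral>x. (?g x t)\<^sup>2 \<partial>\<mu>) = gap ?X ?Y t" for t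
    unfolding gap_def by (intro Bochner_Integration.integral_cong refl) (auto simp: step_def)
  have mom: "(\<integral>x. \<bar>ip d x u\<bar> powr q \<partial>\<mu>) \<le> A * r powr q" if "len u \<le> r" for u r
    using that q A by (intro order_trans[OF moment] mult_left_mono powr_mono2) auto
  have gap_int: "(\<integral>t. sqrt (gap ?X ?Y t) \<partial>wt R) \<le> sqrt e * (K + (A + 3 powr q * (1 + 2 * A)))"
  proof (rule integral_sqrt_gap_le[OF _ _ _ e(1) R K A])
    show "(\<integral>x. \<bar>?X x - ?Y x\<bar> powr q \<partial>\<mu>) \<le> A * e powr q"
      unfolding ip_diff by (rule mom[OF e(2)])
    show "integrable \<mu> (\<lambda>x. \<bar>?X x - ?Y x\<bar> powr q)"
      unfolding ip_diff by (rule moment_integrable)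
    show "(\<integral>x. \<bar>?X x\<bar> powr q \<partial>\<mu>) \<le> A" "(\<integral>x. \<bar>?Y x\<bar> powr q \<partial>\<mu>) \<le> A"
      using mom[OF v(1)] mom[OF v(2)] by simp_all
  qed (use q weight moment_integrable in auto)
  have sg: "integrable (wt R) (\<lambda>t. sqrt (gap ?X ?Y t))"
    by (rule integrable_wt_bounded[OF R, where B=1]) (auto simp: gap_bounds)
  have "(\<integral>t. (sqrt (s / real m * gap ?X ?Y t) + s / real m) \<partial>wt R)
      = sqrt (s / real m) * (\<integral>t. sqrt (gap ?X ?Y t) \<partial>wt R) + s / real m * (2 * R\<^sup>2)"
  proof -
    have "measure (wt R) UNIV = 2 * R\<^sup>2" using R by (simp add: measure_def emeasure_wt)
    then show ?thesis
      using sg integrable_wt_bounded[OF R, of "\<lambda>_. s / real m" "\<bar>s / real m\<bar>"]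
      by (simp add: real_sqrt_mult real_sqrt_divide)
  qed
  also have "\<dots> \<le> sqrt (s / real m) * (sqrt e * (K + (A + 3 powr q * (1 + 2 * A)))) + s / real m * (2 * R\<^sup>2)"
    using gap_int s m by (intro add_right_mono mult_left_mono) auto
  finally have C: "(\<integral>t. (sqrt (s / real m * gap ?X ?Y t) + s / real m) \<partial>wt R)
    \<le> sqrt (s / real m) * (sqrt e * (K + (A + 3 powr q * (1 + 2 * A)))) + s / real m * (2 * R\<^sup>2)" .
  note dev_measurable[OF m R, of v w, measurable]
  have "measure (sample m) {x \<in> space (sample m).
      2 * (sqrt (s / real m) * (sqrt e * (K + (A + 3 powr q * (1 + 2 * A)))) + s / real m * (2 * R\<^sup>2)) < dev m R x v w}
    \<le> measure (sample m) {x \<in> space (sample m).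
      2 * (\<integral>t. (sqrt (s / real m * gap ?X ?Y t) + s / real m) \<partial>wt R) < dev m R x v w}"
    using C by (intro S.finite_measure_mono) (auto, measurable)
  also have "\<dots> \<le> 2 * exp (- s)"
    using integrated_bernstein[OF W.finite_measure_axioms step_pair_measurable _ m s, of v w]
    unfolding dev_def err_diff_eq[OF m] sq by (simp add: abs_step_diff_le_1)
  finally show ?thesis .
qed

lemma bulk_eq_dev:
  assumes "m > 0"
  shows "bulk R (unif m (\<lambda>i. ip d (x i) v)) (marginal d \<mu> v) = dev m R x v (\<lambda>_. 0)"
proof -
  have "err m x (\<lambda>_. 0) t = 0" for t
    using assms by (simp add: err_def surv_unif surv_marginal ip_def prob_space)
  then show ?thesis by (simp add: bulk_def dev_def) (simp add: err_def)
qed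

lemma err_props:
  assumes m: "m > 0"
  shows "err m x v \<in> borel_measurable borel" "\<bar>err m x v t\<bar> \<le> 1"
proof -
  note [measurable] = surv_measurable[OF prob_space_unif[OF m] sets_unif]
    surv_measurable[OF prob_space_marginal[OF prob sets_mu] sets_marginal]
  show "err m x v \<in> borel_measurable borel" unfolding err_def[abs_def] by measurable
  show "\<bar>err m x v t\<bar> \<le> 1"
    using surv_bounds[OF prob_space_unif[OF m], of "\<lambda>i. ip d (x i) v" t]
      surv_bounds[OF prob_space_marginal[OF prob sets_mu], of v t]
    unfolding err_def by linarith
qed

lemma dev_triangle:
  assumes m: "m > 0" and R: "R \<ge> 0"
  shows "dev m R x u w \<le> dev m R x u v + dev m R x v w"
proof -
  note [measurable] = err_props(1)[OF m]
  have i: "integrable (wt R) (\<lambda>t. \<bar>err m x a t - err m x b t\<bar>)" for a b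
    by (rule integrable_wt_bounded[OF R, where B=2])
       (measurable, use err_props(2)[OF m, of x a] err_props(2)[OF m, of x b] in \<open>smt (verit)\<close>)
  have "dev m R x u w \<le> (\<integral>t. \<bar>err m x u t - err m x v t\<bar> + \<bar>err m x v t - err m x w t\<bar> \<partial>wt R)"
    unfolding dev_def by (intro integral_mono i Bochner_Integration.integrable_add) linarith
  then show ?thesis unfolding dev_def using i by simp
qed

text \<open>
  At the end of the chain no probability is used: second moments of both measures suffice.
\<close>

lemma dev_residual:
  assumes m: "m > 0" and R: "R \<ge> 0" and e: "e > 0"
    and v: "len v \<le> 1" "len w \<le> 1" "len (\<lambda>i. v i - w i) \<le> e"
    and emp: "\<And>u. (1 / real m) * (\<Sum>i<m. (ip d (x i) u)\<^sup>2) \<le> 2 * (len u)\<^sup>2"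
  shows "dev m R x v w \<le> 15 / 2 * e"
proof -
  let ?U = "uniform_count_measure {..<m}"
  interpret U: prob_space ?U using m by (rule uniform_index)
  note meas = uniform_index(2)[OF m] and int = uniform_index(3)[OF m]
  have sq: "(len u)\<^sup>2 \<le> r\<^sup>2" if "len u \<le> r" for u r
    using that by (intro power_mono) auto
  have avg: "(\<integral>i. (ip d (x i) u)\<^sup>2 \<partial>?U) \<le> 2 * r\<^sup>2" if "len u \<le> r" for u r
    using emp[of u] sq[OF that] by (simp add: integral_uniform_count_measure)
  have a: "(\<integral>t. \<bar>surv (unif m (\<lambda>i. ip d (x i) v)) t - surv (unif m (\<lambda>i. ip d (x i) w)) t\<bar> \<partial>wt R) \<le> 5 / 2 * 2 * e"
    unfolding unif_def
  proof (rule U.surv_diff_wt_le[OF meas meas int int int _ _ e _ R])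
    show "(\<integral>i. (ip d (x i) v)\<^sup>2 \<partial>?U) \<le> 2" "(\<integral>i. (ip d (x i) w)\<^sup>2 \<partial>?U) \<le> 2"
      using avg[OF v(1)] avg[OF v(2)] by simp_all
    show "(\<integral>i. (ip d (x i) v - ip d (x i) w)\<^sup>2 \<partial>?U) \<le> 2 * e\<^sup>2"
      unfolding ip_diff by (rule avg[OF v(3)])
  qed
  have b: "(\<integral>t. \<bar>surv (marginal d \<mu> v) t - surv (marginal d \<mu> w) t\<bar> \<partial>wt R) \<le> 5 / 2 * 1 * e"
    unfolding marginal_def
  proof (rule surv_diff_wt_le[OF _ _ _ _ _ _ _ e _ R])
    show "(\<integral>x. (ip d x v)\<^sup>2 \<partial>\<mu>) \<le> 1" "(\<integral>x. (ip d x w)\<^sup>2 \<partial>\<mu>) \<le> 1"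
      using sq[OF v(1)] sq[OF v(2)] by (simp_all add: second_moment)
    show "(\<integral>x. (ip d x v - ip d x w)\<^sup>2 \<partial>\<mu>) \<le> 1 * e\<^sup>2"
      unfolding ip_diff using sq[OF v(3)] by (simp add: second_moment)
    show "integrable \<mu> (\<lambda>x. (ip d x v - ip d x w)\<^sup>2)" unfolding ip_diff by (rule second_integrable)
  qed (use second_integrable in auto)
  note [measurable] = surv_measurable[OF prob_space_unif[OF m] sets_unif]
    surv_measurable[OF prob_space_marginal[OF prob sets_mu] sets_marginal]
  have i1: "integrable (wt R) (\<lambda>t. \<bar>surv P t - surv Q t\<bar>)"
    if P: "prob_space P" "sets P = sets borel" "prob_space Q" "sets Q = sets borel" for P Q
  proof (rule integrable_wt_bounded[OF R, where B=1])
    note [measurable] = surv_measurable[OF P(1,2)] surv_measurable[OF P(3,4)]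
    show "(\<lambda>t. \<bar>surv P t - surv Q t\<bar>) \<in> borel_measurable borel" by measurable
    show "\<bar>\<bar>surv P t - surv Q t\<bar>\<bar> \<le> 1" for t
      using surv_bounds[OF P(1), of t] surv_bounds[OF P(3), of t] by auto
  qed
  have i: "integrable (wt R) (\<lambda>t. \<bar>surv (unif m (\<lambda>i. ip d (x i) v)) t - surv (unif m (\<lambda>i. ip d (x i) w)) t\<bar>)"
     "integrable (wt R) (\<lambda>t. \<bar>surv (marginal d \<mu> v) t - surv (marginal d \<mu> w) t\<bar>)"
    by (intro i1 prob_space_unif m prob_space_marginal prob sets_mu sets_unif sets_marginal)+
  have "dev m R x v w \<le> (\<integral>t. \<bar>surv (unif m (\<lambda>i. ip d (x i) v)) t - surv (unif m (\<lambda>i. ip d (x i) w)) t\<bar>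
      + \<bar>surv (marginal d \<mu> v) t - surv (marginal d \<mu> w) t\<bar> \<partial>wt R)"
    unfolding dev_def
  proof (intro integral_mono Bochner_Integration.integrable_add i)
    show "integrable (wt R) (\<lambda>t. \<bar>err m x v t - err m x w t\<bar>)"
    proof (rule integrable_wt_bounded[OF R, where B=2])
      note [measurable] = err_props(1)[OF m]
      show "(\<lambda>t. \<bar>err m x v t - err m x w t\<bar>) \<in> borel_measurable borel" by measurable
      show "\<bar>\<bar>err m x v t - err m x w t\<bar>\<bar> \<le> 2" for t
        using err_props(2)[OF m, of x v t] err_props(2)[OF m, of x w t] by linarith
    qed
  qed (simp add: err_def)
  also have "\<dots> \<le> 5 / 2 * 2 * e + 5 / 2 * 1 * e" using a b i by simp
  finally show ?thesis by simp
qed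

end

section \<open>Chaining over the unit ball\<close>

context isotropic_law
begin

text \<open>
  The bound of \<open>dev_bound\<close> for a link of length \<open>2\<close> to the power \<open>1 - l\<close> with \<open>s = \<Delta> m (l + 1)\<close>.
\<close>

definition level_bound :: "real \<Rightarrow> real \<Rightarrow> real \<Rightarrow> nat \<Rightarrow> real" where
  "level_bound \<Delta> R K l = 2 * (sqrt (\<Delta> * real (l + 1)) * (sqrt (2 * (1/2) ^ l) * (K + (A + 3 powr q * (1 + 2 * A))))
     + \<Delta> * real (l + 1) * (2 * R\<^sup>2))"

lemma union_bound_sum:
  assumes a: "a \<ge> 7"
  shows "(\<Sum>l<n. 2 * exp (- (real (l + 1) * a))) \<le> exp (- a / 2)"
proof -
  have ea: "exp (- a) \<le> 1/2"
  proof -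
    have "2 \<le> exp a" using exp_ge_add_one_self[of a] a by linarith
    then show ?thesis by (simp add: exp_minus field_simps)
  qed
  have "(\<Sum>l<n. 2 * exp (- (real (l + 1) * a))) \<le> (\<Sum>l<n. 2 * (exp (- a) * (1/2) ^ l))"
  proof (intro sum_mono mult_left_mono)
    fix l
    have "exp (- (real (l + 1) * a)) = exp (- a) ^ (l + 1)"
      by (subst exp_of_nat_mult[symmetric]) simp
    also have "\<dots> = exp (- a) * exp (- a) ^ l" by simp
    also have "\<dots> \<le> exp (- a) * (1/2) ^ l" using ea by (intro mult_left_mono power_mono) auto
    finally show "exp (- (real (l + 1) * a)) \<le> exp (- a) * (1/2) ^ l" .
  qed simp
  also have "\<dots> = 2 * exp (- a) * (\<Sum>l<n. (1/2) ^ l)" by (simp add: sum_distrib_left mult.assoc)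
  also have "\<dots> \<le> 2 * exp (- a) * 2"
    by (intro mult_left_mono) (auto simp: sum_gp_strict)
  also have "\<dots> \<le> exp (a / 2) * exp (- a)"
  proof -
    have "1 + a / 2 \<le> exp (a / 2)" by (rule exp_ge_add_one_self)
    then have "4 \<le> exp (a / 2)" using a by linarith
    then have "4 * exp (- a) \<le> exp (a / 2) * exp (- a)" by (rule mult_right_mono) simp
    then show ?thesis by (simp only: mult_ac)
  qed
  also have "\<dots> = exp (- a / 2)" by (simp add: mult_exp_exp)
  finally show ?thesis .
qed

text \<open>
  At level \<open>l\<close> there are at most \<open>exp (7 d (l + 1))\<close> links, and each fails with probability at most
  \<open>2 exp (- \<Delta> m (l + 1))\<close>.  For \<open>\<Delta> m \<ge> 14 d\<close> half of the exponent pays for the number of links, and the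
  rest is summable over \<open>l\<close>.
\<close>

lemma chain_event:
  assumes m: "m > 0" and D: "\<Delta> > 0" "\<Delta> * real m \<ge> 14 * real d" and R: "R \<ge> 0" and K: "K \<ge> 0"
    and weight: "(\<integral>\<^sup>+t. ennreal ((1 + \<bar>t\<bar>) powr (3 - q)) * indicator {-R..R} t \<partial>lborel) \<le> ennreal K"
  shows "\<exists>\<Omega>\<in>sets (sample m). measure (sample m) \<Omega> \<ge> 1 - exp (- (1/4 * \<Delta> * real m)) \<and>
    (\<forall>x\<in>\<Omega>. (\<forall>u. (1 / real m) * (\<Sum>i<m. (ip d (x i) u)\<^sup>2) \<le> 2 * (len u)\<^sup>2) \<longrightarrow>
      (\<forall>v. len v \<le> 1 \<longrightarrow> dev m R x v (\<lambda>_. 0) \<le> (\<Sum>l<n. level_bound \<Delta> R K l) + 8 * (1/2) ^ n))"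
proof -
  interpret S: product_prob_space "\<lambda>_::nat. \<mu>" "{..<m}" by unfold_locales
  have "\<forall>l. \<exists>N. finite N \<and> real (card N) \<le> exp (real d * real (l + 3)) \<and>
     (\<forall>v\<in>N. len v \<le> 1) \<and> (\<forall>v. len v \<le> 1 \<longrightarrow> (\<exists>w\<in>N. len (\<lambda>i. v i - w i) \<le> (1/2) ^ l))"
    using ball_net[OF d] by (rule allI)
  from choice[OF this] obtain N where N: "\<And>l. finite (N l)" "\<And>l. real (card (N l)) \<le> exp (real d * real (l + 3))"
    "\<And>l v. v \<in> N l \<Longrightarrow> len v \<le> 1" "\<And>l v. len v \<le> 1 \<Longrightarrow> \<exists>w\<in>N l. len (\<lambda>i. v i - w i) \<le> (1/2) ^ l"
    by blast
  \<comment> \<open>the first net is replaced by the origin, where the deviation vanishes\<close>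
  define M where "M = (\<lambda>l. if l = 0 then {\<lambda>_. 0} else N l)"
  have len0: "len (\<lambda>_. 0) = 0" by (simp add: L2_set_def)
  have M: "finite (M l)" "real (card (M l)) \<le> exp (real d * real (l + 3))" "v \<in> M l \<Longrightarrow> len v \<le> 1"
    "len v \<le> 1 \<Longrightarrow> \<exists>w\<in>M l. len (\<lambda>i. v i - w i) \<le> (1/2) ^ l" for l v
    using N len0 by (cases "l = 0"; auto simp: M_def)+
  define I where "I = Sigma {..<n} (\<lambda>l. {p \<in> M l \<times> M (Suc l). len (\<lambda>i. snd p i - fst p i) \<le> 2 * (1/2) ^ l})"
  define bad where "bad = (\<lambda>(l, p). {x \<in> space (sample m). level_bound \<Delta> R K l < dev m R x (snd p) (fst p)})"
  note [measurable] = dev_measurable[OF m R]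
  have finI: "finite I" unfolding I_def using M(1) by auto
  have bad_sets: "bad j \<in> sets (sample m)" for j
    unfolding bad_def by (cases j) (simp, measurable)
  have bad_prob: "measure (sample m) (bad j) \<le> 2 * exp (- (\<Delta> * real m * real (fst j + 1)))" if j: "j \<in> I" for j
  proof -
    obtain l p where lp: "j = (l, p)" by (cases j)
    have p: "len (snd p) \<le> 1" "len (fst p) \<le> 1" "len (\<lambda>i. snd p i - fst p i) \<le> 2 * (1/2) ^ l"
      using j M(3) by (auto simp: I_def lp)
    have "0 < \<Delta> * real m * real (l + 1)" using D m by simp
    from dev_bound[OF m this R K p(1,2) _ p(3) weight] m show ?thesis
      by (simp add: lp bad_def level_bound_def)
  qed
  have "measure (sample m) (\<Union>j\<in>I. bad j) \<le> (\<Sum>j\<in>I. measure (sample m) (bad j))"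
    using finI bad_sets by (intro S.finite_measure_subadditive_finite) auto
  also have "\<dots> \<le> (\<Sum>j\<in>I. 2 * exp (- (\<Delta> * real m * real (fst j + 1))))"
    by (intro sum_mono bad_prob)
  also have "\<dots> = (\<Sum>l<n. \<Sum>p\<in>{p \<in> M l \<times> M (Suc l). len (\<lambda>i. snd p i - fst p i) \<le> 2 * (1/2) ^ l}. 2 * exp (- (\<Delta> * real m * real (l + 1))))"
    unfolding I_def using M(1) by (subst sum.Sigma) (auto simp: case_prod_unfold)
  also have "\<dots> \<le> (\<Sum>l<n. 2 * exp (- (real (l + 1) * (\<Delta> * real m / 2))))"
  proof (rule sum_mono)
    fix l
    let ?Q = "{p \<in> M l \<times> M (Suc l). len (\<lambda>i. snd p i - fst p i) \<le> 2 * (1/2) ^ l}"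
    have "card ?Q \<le> card (M l \<times> M (Suc l))" using M(1) by (intro card_mono) auto
    then have "real (card ?Q) \<le> real (card (M l)) * real (card (M (Suc l)))"
      by (simp add: card_cartesian_product flip: of_nat_mult)
    also have "\<dots> \<le> exp (real d * real (l + 3)) * exp (real d * real (Suc l + 3))"
      by (intro mult_mono M(2)) auto
    also have "\<dots> = exp (real d * real (2 * l + 7))"
      by (simp add: mult_exp_exp algebra_simps)
    also have "\<dots> \<le> exp (real (l + 1) * (\<Delta> * real m / 2))"
    proof -
      have "real d * real (2 * l + 7) \<le> real d * (7 * real (l + 1))" by (intro mult_left_mono) auto
      also have "\<dots> = real (l + 1) * (14 * real d / 2)" by simp
      also have "\<dots> \<le> real (l + 1) * (\<Delta> * real m / 2)" using D by (intro mult_left_mono divide_right_mono) auto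
      finally show ?thesis by simp
    qed
    finally have c: "real (card ?Q) \<le> exp (real (l + 1) * (\<Delta> * real m / 2))" .
    have "(\<Sum>p\<in>?Q. 2 * exp (- (\<Delta> * real m * real (l + 1)))) = real (card ?Q) * (2 * exp (- (\<Delta> * real m * real (l + 1))))"
      by simp
    also have "\<dots> \<le> exp (real (l + 1) * (\<Delta> * real m / 2)) * (2 * exp (- (\<Delta> * real m * real (l + 1))))"
      by (intro mult_right_mono c) simp
    also have "\<dots> = 2 * exp (- (real (l + 1) * (\<Delta> * real m / 2)))"
    proof -
      have "real (l + 1) * (\<Delta> * real m / 2) + - (\<Delta> * real m * real (l + 1)) = - (real (l + 1) * (\<Delta> * real m / 2))"
        by (simp add: field_simps)
      then show ?thesis by (simp only: mult.left_commute[of _ 2] mult_exp_exp)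
    qed
    finally show "(\<Sum>p\<in>?Q. 2 * exp (- (\<Delta> * real m * real (l + 1)))) \<le> 2 * exp (- (real (l + 1) * (\<Delta> * real m / 2)))" .
  qed
  also have "\<dots> \<le> exp (- (\<Delta> * real m / 2) / 2)"
    using D d by (intro union_bound_sum) linarith
  also have "- (\<Delta> * real m / 2) / 2 = - (1/4 * \<Delta> * real m)" by simp
  finally have bad_total: "measure (sample m) (\<Union>j\<in>I. bad j) \<le> exp (- (1/4 * \<Delta> * real m))" .
  define \<Omega> where "\<Omega> = space (sample m) - (\<Union>j\<in>I. bad j)"
  have U: "(\<Union>j\<in>I. bad j) \<in> sets (sample m)" using finI bad_sets by auto
  have meas: "\<Omega> \<in> sets (sample m)" using U by (auto simp: \<Omega>_def)
  have prob: "measure (sample m) \<Omega> \<ge> 1 - exp (- (1/4 * \<Delta> * real m))"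
    unfolding \<Omega>_def using S.prob_compl[OF U] bad_total by simp
  have "dev m R x v (\<lambda>_. 0) \<le> (\<Sum>l<n. level_bound \<Delta> R K l) + 8 * (1/2) ^ n"
    if x: "x \<in> \<Omega>" and emp: "\<And>u. (1 / real m) * (\<Sum>i<m. (ip d (x i) u)\<^sup>2) \<le> 2 * (len u)\<^sup>2" and v: "len v \<le> 1" for x v
  proof -
    obtain \<pi> where \<pi>: "\<And>l. \<pi> l \<in> M l" "\<And>l. len (\<lambda>i. v i - \<pi> l i) \<le> (1/2) ^ l"
      using M(4)[OF v] by metis
    have link: "dev m R x (\<pi> (Suc l)) (\<pi> l) \<le> level_bound \<Delta> R K l" if l: "l < n" for l
    proof -
      have "len (\<lambda>i. \<pi> (Suc l) i - \<pi> l i) \<le> len (\<lambda>i. \<pi> (Suc l) i - v i) + len (\<lambda>i. v i - \<pi> l i)"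
        by (rule L2_set_triangle3)
      also have "len (\<lambda>i. \<pi> (Suc l) i - v i) = len (\<lambda>i. v i - \<pi> (Suc l) i)"
        by (simp add: L2_set_def power2_commute)
      also have "len (\<lambda>i. v i - \<pi> (Suc l) i) + len (\<lambda>i. v i - \<pi> l i) \<le> (1/2) ^ Suc l + (1/2) ^ l"
        by (intro add_mono \<pi>)
      also have "\<dots> \<le> 2 * (1/2) ^ l" by simp
      finally have "(l, (\<pi> l, \<pi> (Suc l))) \<in> I" using l \<pi>(1) by (simp add: I_def)
      then have "x \<notin> bad (l, (\<pi> l, \<pi> (Suc l)))" "x \<in> space (sample m)" using x by (auto simp: \<Omega>_def)
      then show ?thesis by (simp add: bad_def)
    qed
    have chain: "dev m R x (\<pi> k) (\<lambda>_. 0) \<le> (\<Sum>l<k. level_bound \<Delta> R K l)" if "k \<le> n" for k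
      using that
    proof (induction k)
      case 0
      have "\<pi> 0 = (\<lambda>_. 0)" using \<pi>(1)[of 0] by (simp add: M_def)
      then show ?case by (simp add: dev_def)
    next
      case (Suc k)
      then show ?case
        using dev_triangle[OF m R, of x "\<pi> (Suc k)" "\<lambda>_. 0" "\<pi> k"] link[of k] by simp
    qed
    have "dev m R x v (\<pi> n) \<le> 15 / 2 * (1/2) ^ n"
      by (rule dev_residual[OF m R _ v _ \<pi>(2) emp]) (use M(3)[OF \<pi>(1)] in auto)
    also have "\<dots> \<le> 8 * (1/2) ^ n" by simp
    finally show ?thesis
      using dev_triangle[OF m R, of x v "\<lambda>_. 0" "\<pi> n"] chain[of n] by simp
  qed
  with meas prob show ?thesis by blast
qed

lemma level_bound_sum:
  assumes D: "\<Delta> > 0" and K: "K \<ge> 0"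
  shows "(\<Sum>l<n. level_bound \<Delta> R K l)
    \<le> 30 * sqrt \<Delta> * (K + (A + 3 powr q * (1 + 2 * A))) + 4 * R\<^sup>2 * \<Delta> * (real n)\<^sup>2"
proof -
  define B where "B = K + (A + 3 powr q * (1 + 2 * A))"
  have B: "B \<ge> 0" using K A by (simp add: B_def)
  have "(\<Sum>l<n. level_bound \<Delta> R K l)
    = (\<Sum>l<n. 2 * sqrt \<Delta> * B * sqrt (real (l + 1) * (2 * (1/2) ^ l)) + 4 * R\<^sup>2 * \<Delta> * real (l + 1))"
  proof (intro sum.cong refl)
    have "2 * (sqrt (\<Delta> * j) * (sqrt c * B) + \<Delta> * j * (2 * R\<^sup>2)) = 2 * sqrt \<Delta> * B * sqrt (j * c) + 4 * R\<^sup>2 * \<Delta> * j" for j c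
      by (simp add: real_sqrt_mult algebra_simps)
    then show "level_bound \<Delta> R K l = 2 * sqrt \<Delta> * B * sqrt (real (l + 1) * (2 * (1/2) ^ l)) + 4 * R\<^sup>2 * \<Delta> * real (l + 1)" for l
      unfolding level_bound_def B_def[symmetric] .
  qed
  also have "\<dots> = 2 * sqrt \<Delta> * B * (\<Sum>l<n. sqrt (real (l + 1) * (2 * (1/2) ^ l))) + 4 * R\<^sup>2 * \<Delta> * (\<Sum>l<n. real (l + 1))"
    by (simp only: sum.distrib sum_distrib_left)
  also have "\<dots> \<le> 2 * sqrt \<Delta> * B * 15 + 4 * R\<^sup>2 * \<Delta> * (real n)\<^sup>2"
    using D B by (intro add_mono mult_left_mono chain_weights_summable sum_succ_le_square) auto
  finally show ?thesis by (simp add: B_def)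
qed

text \<open>
  Chebyshev's bound with the moment of order \<open>q\<close>.
\<close>

lemma tail_le:
  assumes R: "R > 0"
  shows "(\<integral>y. max 0 (y\<^sup>2 - R\<^sup>2) \<partial>marginal d \<mu> v) \<le> A * len v powr q * R powr (2 - q)"
proof -
  have pt: "max 0 (y\<^sup>2 - R\<^sup>2) \<le> \<bar>y\<bar> powr q * R powr (2 - q)" for y :: real
  proof (cases "\<bar>y\<bar> \<le> R")
    case True
    then have "y\<^sup>2 \<le> R\<^sup>2" using R by (simp add: abs_le_square_iff[symmetric])
    then show ?thesis by simp
  next
    case False
    then have y: "\<bar>y\<bar> > R" "\<bar>y\<bar> > 0" using R by auto
    have "y\<^sup>2 = \<bar>y\<bar> powr 2" using y by (simp add: powr_numeral)
    also have "\<dots> = \<bar>y\<bar> powr q * \<bar>y\<bar> powr (2 - q)" by (simp add: powr_add[symmetric])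
    also have "\<dots> \<le> \<bar>y\<bar> powr q * R powr (2 - q)"
      using y R q by (intro mult_left_mono powr_mono2') auto
    finally have "y\<^sup>2 \<le> \<bar>y\<bar> powr q * R powr (2 - q)" .
    moreover have "0 \<le> R\<^sup>2" by simp
    moreover have "0 \<le> \<bar>y\<bar> powr q * R powr (2 - q)" by simp
    ultimately show ?thesis by linarith
  qed
  have "(\<integral>y. max 0 (y\<^sup>2 - R\<^sup>2) \<partial>marginal d \<mu> v) = (\<integral>x. max 0 ((ip d x v)\<^sup>2 - R\<^sup>2) \<partial>\<mu>)"
    unfolding marginal_def by (subst integral_distr) auto
  also have "\<dots> \<le> (\<integral>x. \<bar>ip d x v\<bar> powr q * R powr (2 - q) \<partial>\<mu>)"
  proof (rule integral_mono)
    show "integrable \<mu> (\<lambda>x. \<bar>ip d x v\<bar> powr q * R powr (2 - q))"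
      using moment_integrable by simp
    then show "integrable \<mu> (\<lambda>x. max 0 ((ip d x v)\<^sup>2 - R\<^sup>2))"
      by (rule Bochner_Integration.integrable_bound) (use pt in \<open>auto intro!: AE_I2\<close>)
  qed (rule pt)
  also have "\<dots> \<le> A * len v powr q * R powr (2 - q)"
    using moment[of v] by (simp add: mult_right_mono)
  finally show ?thesis .
qed

text \<open>
  The hypothesis on \<open>dev\<close> is conditional, because the residual of the chain is only controlled
  when \<open>\<rho> \<le> 1\<close>; in the other case \<open>\<rho>\<close> dominates the second moments of both measures.
\<close>

lemma SW2_le:
  assumes m: "m > 0" and x: "x \<in> space (sample m)" and H: "H \<ge> 0" and R: "R > 0"
    and dev: "(\<And>u. (1 / real m) * (\<Sum>i<m. (ip d (x i) u)\<^sup>2) \<le> 2 * (len u)\<^sup>2) \<Longrightarrow>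
      (\<And>v. len v \<le> 1 \<Longrightarrow> 4 * (dev m R x v (\<lambda>_. 0) + A * R powr (2 - q)) \<le> 2 * H\<^sup>2)"
  shows "SW2 d (empirical d m x) \<mu> \<le> ennreal (3 * (sqrt (rho d m x) + H))"
  unfolding SW2_def
proof (rule SUP_least)
  fix \<theta> assume t: "\<theta> \<in> unit_sphere d"
  let ?P = "unif m (\<lambda>i. ip d (x i) \<theta>)" and ?Q = "marginal d \<mu> \<theta>"
  let ?r = "rho d m x"
  have r0: "0 \<le> ?r" by (rule rho_nonneg[OF m d])
  have t1: "len \<theta> = 1" by (rule unit_sphere_L2[OF t])
  note pP = prob_space_unif[OF m] and pQ = prob_space_marginal[OF prob sets_mu]
  note meas = uniform_index(2)[OF m] and intU = uniform_index(3)[OF m]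
  have iP: "integrable ?P (\<lambda>y. y\<^sup>2)"
    unfolding unif_def using meas intU by (subst integrable_distr_eq) auto
  have iQ: "integrable ?Q (\<lambda>y. y\<^sup>2)"
    unfolding marginal_def using second_integrable by (subst integrable_distr_eq) auto
  have mP: "(\<integral>y. y\<^sup>2 \<partial>?P) = (1 / real m) * (\<Sum>i<m. (ip d (x i) \<theta>)\<^sup>2)"
    unfolding unif_def by (subst integral_distr[OF meas]) (auto simp: integral_uniform_count_measure)
  have mQ: "(\<integral>y. y\<^sup>2 \<partial>?Q) = 1"
    unfolding marginal_def by (subst integral_distr) (auto simp: second_moment t1)
  have diff: "\<bar>(\<integral>y. y\<^sup>2 \<partial>?P) - (\<integral>y. y\<^sup>2 \<partial>?Q)\<bar> \<le> ?r"
    unfolding mP mQ by (rule rho_upper[OF m t])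
  define T where "T = (\<integral>\<^sup>+t. ennreal (2 * \<bar>t\<bar> * \<bar>surv ?P t - surv ?Q t\<bar>) \<partial>lborel)"
  have T: "2 * T \<le> ennreal ((3 * (sqrt ?r + H))\<^sup>2)"
  proof (cases "?r > 1")
    case True
    have "T \<le> ennreal ((\<integral>y. y\<^sup>2 \<partial>?P) + (\<integral>y. y\<^sup>2 \<partial>?Q))"
      unfolding T_def by (rule transport_le_second_moments[OF pP sets_unif pQ sets_marginal iP iQ])
    also have "\<dots> \<le> ennreal (3 * ?r)" using diff mQ True by (intro ennreal_leI) linarith
    finally have "2 * T \<le> 2 * ennreal (3 * ?r)" by (intro mult_left_mono) auto
    also have "\<dots> = ennreal (2 * (3 * ?r))" using r0 by (simp add: ennreal_mult)
    also have "\<dots> \<le> ennreal ((3 * (sqrt ?r + H))\<^sup>2)"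
    proof (rule ennreal_leI)
      have "2 * (3 * ?r) \<le> (3 * sqrt ?r)\<^sup>2" using r0 by (simp add: power_mult_distrib)
      also have "\<dots> \<le> (3 * (sqrt ?r + H))\<^sup>2" using r0 H by (intro power_mono) auto
      finally show "2 * (3 * ?r) \<le> (3 * (sqrt ?r + H))\<^sup>2" .
    qed
    finally show ?thesis .
  next
    case False
    have emp: "(1 / real m) * (\<Sum>i<m. (ip d (x i) u)\<^sup>2) \<le> 2 * (len u)\<^sup>2" for u
    proof (cases "len u = 0")
      case True
      then have "ip d y u = 0" for y using abs_ip_le[of d y u] by simp
      then show ?thesis by simp
    next
      case F: False
      obtain w where w: "w \<in> unit_sphere d" and scale: "\<And>y. ip d y u = len u * ip d y w"
        using ip_eq_scaled_unit[OF F] by blast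
      from rho_upper[OF m w, of x] False
      have "(1 / real m) * (\<Sum>i<m. (ip d (x i) w)\<^sup>2) \<le> 2" by linarith
      then have "(len u)\<^sup>2 * ((1 / real m) * (\<Sum>i<m. (ip d (x i) w)\<^sup>2)) \<le> (len u)\<^sup>2 * 2"
        by (intro mult_left_mono) auto
      moreover have "(\<Sum>i<m. (ip d (x i) u)\<^sup>2) = (len u)\<^sup>2 * (\<Sum>i<m. (ip d (x i) w)\<^sup>2)"
        by (simp add: scale power_mult_distrib sum_distrib_left)
      ultimately show ?thesis by (simp add: mult_ac)
    qed
    have b: "4 * (bulk R ?P ?Q + A * R powr (2 - q)) \<le> 2 * H\<^sup>2"
      using dev[OF emp, of \<theta>] t1 by (simp add: bulk_eq_dev[OF m])
    have "T \<le> ennreal (2 * bulk R ?P ?Q + \<bar>(\<integral>y. y\<^sup>2 \<partial>?P) - (\<integral>y. y\<^sup>2 \<partial>?Q)\<bar> + 2 * (\<integral>y. max 0 (y\<^sup>2 - R\<^sup>2) \<partial>?Q))"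
      unfolding T_def using R by (intro transport_le_bulk pP sets_unif pQ sets_marginal iP iQ) simp
    also have "\<dots> \<le> ennreal (?r + H\<^sup>2)"
      using b diff tail_le[OF R, of \<theta>] t1 by (intro ennreal_leI) simp
    finally have "2 * T \<le> 2 * ennreal (?r + H\<^sup>2)" by (intro mult_left_mono) auto
    also have "\<dots> = ennreal (2 * (?r + H\<^sup>2))" using r0 by (simp add: ennreal_mult)
    also have "\<dots> \<le> ennreal ((3 * (sqrt ?r + H))\<^sup>2)"
    proof (rule ennreal_leI)
      have "0 \<le> sqrt ?r * H" using r0 H by simp
      then show "2 * (?r + H\<^sup>2) \<le> (3 * (sqrt ?r + H))\<^sup>2"
        using r0 by (simp add: power_mult_distrib power2_sum)
    qed
    finally show ?thesis .
  qed
  have "W2 ?P ?Q \<le> enn_powr (2 * T) (1 / 2)"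
    unfolding T_def by (rule W2_le_signed_square_transport[OF pP sets_unif pQ sets_marginal])
  also have "\<dots> \<le> enn_powr (ennreal ((3 * (sqrt ?r + H))\<^sup>2)) (1 / 2)"
    by (rule enn_powr_half_mono[OF T])
  also have "\<dots> = ennreal (3 * (sqrt ?r + H))"
    using r0 H by (intro enn_powr_half_square) simp
  finally show "W2 (marginal d (empirical d m x) \<theta>) ?Q \<le> ennreal (3 * (sqrt ?r + H))"
    by (simp only: marginal_empirical[OF sets_mu x])
qed

lemma SW2_probability:
  assumes D: "\<Delta> > 0" "\<Delta> * real m \<ge> 14 * real d" and R: "R > 0" and K: "K \<ge> 0"
    and weight: "(\<integral>\<^sup>+t. ennreal ((1 + \<bar>t\<bar>) powr (3 - q)) * indicator {-R..R} t \<partial>lborel) \<le> ennreal K"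
    and c: "c \<ge> 0" and H: "H \<ge> 0"
    and bound: "4 * (30 * sqrt \<Delta> * (K + (A + 3 powr q * (1 + 2 * A))) + 4 * R\<^sup>2 * \<Delta> * (real n)\<^sup>2
      + 8 * (1/2) ^ n + A * R powr (2 - q)) \<le> 2 * (c * H)\<^sup>2"
  shows "measure (sample m) {x \<in> space (sample m).
      SW2 d (empirical d m x) \<mu> \<le> ennreal (3 * (1 + c) * (sqrt (rho d m x) + H))}
    \<ge> 1 - exp (- (1/4 * \<Delta> * real m))" (is "measure _ ?S \<ge> _")
proof -
  have m: "m > 0"
  proof (rule ccontr)
    assume "\<not> m > 0"
    then show False using D d by simp
  qed
  interpret S: product_prob_space "\<lambda>_::nat. \<mu>" "{..<m}" by unfold_locales
  obtain \<Omega> where \<Omega>: "\<Omega> \<in> sets (sample m)" "measure (sample m) \<Omega> \<ge> 1 - exp (- (1/4 * \<Delta> * real m))"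
    and dev: "\<And>x v. x \<in> \<Omega> \<Longrightarrow> (\<And>u. (1 / real m) * (\<Sum>i<m. (ip d (x i) u)\<^sup>2) \<le> 2 * (len u)\<^sup>2) \<Longrightarrow> len v \<le> 1 \<Longrightarrow>
      dev m R x v (\<lambda>_. 0) \<le> (\<Sum>l<n. level_bound \<Delta> R K l) + 8 * (1/2) ^ n"
    using chain_event[OF m D less_imp_le[OF R] K weight, of n] by blast
  have "\<Omega> \<subseteq> ?S"
  proof
    fix x assume x: "x \<in> \<Omega>"
    then have xs: "x \<in> space (sample m)" using sets.sets_into_space[OF \<Omega>(1)] by blast
    have "SW2 d (empirical d m x) \<mu> \<le> ennreal (3 * (sqrt (rho d m x) + c * H))"
    proof (rule SW2_le[OF m xs _ R])
      show "0 \<le> c * H" using c H by simp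
      fix v assume emp: "\<And>u. (1 / real m) * (\<Sum>i<m. (ip d (x i) u)\<^sup>2) \<le> 2 * (len u)\<^sup>2" and v: "len v \<le> 1"
      have "dev m R x v (\<lambda>_. 0) + A * R powr (2 - q)
          \<le> 30 * sqrt \<Delta> * (K + (A + 3 powr q * (1 + 2 * A))) + 4 * R\<^sup>2 * \<Delta> * (real n)\<^sup>2 + 8 * (1/2) ^ n + A * R powr (2 - q)"
        by (intro add_right_mono order_trans[OF dev[OF x emp v]] level_bound_sum[OF D(1) K])
      from mult_left_mono[OF this, of 4] show "4 * (dev m R x v (\<lambda>_. 0) + A * R powr (2 - q)) \<le> 2 * (c * H)\<^sup>2"
        by (intro order_trans[OF _ bound]) simp
    qed
    also have "\<dots> \<le> ennreal (3 * (1 + c) * (sqrt (rho d m x) + H))"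
      using c H rho_nonneg[OF m d, of x] by (intro ennreal_leI) (simp add: algebra_simps)
    finally show "x \<in> ?S" using xs by simp
  qed
  moreover have "?S \<in> sets (sample m)"
  proof -
    note [measurable] = SW2_measurable[OF prob sets_mu m] rho_measurable[OF sets_mu m d]
    show ?thesis by measurable
  qed
  ultimately have "measure (sample m) \<Omega> \<le> measure (sample m) ?S"
    by (rule S.finite_measure_mono)
  with \<Omega>(2) show ?thesis by linarith
qed

end

section \<open>Isotropic laws with bounded directional moments\<close>

lemma isotropic_second_moment:
  assumes prob: "prob_space \<mu>" and mu: "sets \<mu> = sets (euc d)" and c: "centred d \<mu>" and iso: "isotropic d \<mu>"
  shows "integrable \<mu> (\<lambda>x. (ip d x v)\<^sup>2)" "(\<integral>x. (ip d x v)\<^sup>2 \<partial>\<mu>) = (L2_set v {..<d})\<^sup>2"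
proof -
  have coord [measurable]: "(\<lambda>x. x i) \<in> borel_measurable \<mu>" if "i < d" for i
    using that measurable_component_singleton[of i "{..<d}" "\<lambda>_. borel :: real measure"]
    by (simp add: measurable_cong_sets[OF mu refl])
  have int2: "integrable \<mu> (\<lambda>x. (x i)\<^sup>2)" if "i < d" for i
    using iso that by (simp add: isotropic_def)
  have int: "integrable \<mu> (\<lambda>x. x i * x j)" if "i < d" "j < d" for i j
  proof (rule Bochner_Integration.integrable_bound[OF Bochner_Integration.integrable_add[OF int2[OF that(1)] int2[OF that(2)]]])
    show "(\<lambda>x. x i * x j) \<in> borel_measurable \<mu>" using coord[OF that(1)] coord[OF that(2)] by measurable
    show "AE x in \<mu>. norm (x i * x j) \<le> norm ((x i)\<^sup>2 + (x j)\<^sup>2)"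
    proof (rule AE_I2)
      fix x :: "nat \<Rightarrow> real"
      have "2 * \<bar>x i\<bar> * \<bar>x j\<bar> \<le> \<bar>x i\<bar>\<^sup>2 + \<bar>x j\<bar>\<^sup>2" by (rule sum_squares_bound)
      moreover have "0 \<le> \<bar>x i\<bar> * \<bar>x j\<bar>" by simp
      ultimately have "\<bar>x i\<bar> * \<bar>x j\<bar> \<le> (x i)\<^sup>2 + (x j)\<^sup>2" unfolding power2_abs by linarith
      then show "norm (x i * x j) \<le> norm ((x i)\<^sup>2 + (x j)\<^sup>2)" by (simp add: abs_mult)
    qed
  qed
  have cov: "(\<integral>x. x i * x j \<partial>\<mu>) = (if i = j then 1 else 0)" if "i < d" "j < d" for i j
    using iso c that by (simp add: isotropic_def centred_def covariance_def)
  have sq: "(ip d x v)\<^sup>2 = (\<Sum>i<d. \<Sum>j<d. (v i * v j) * (x i * x j))" for x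
    unfolding ip_def power2_eq_square sum_product by (intro sum.cong refl) (simp add: mult_ac)
  have int': "integrable \<mu> (\<lambda>x. (v i * v j) * (x i * x j))" if "i \<in> {..<d}" "j \<in> {..<d}" for i j
    using int[of i j] that by simp
  show "integrable \<mu> (\<lambda>x. (ip d x v)\<^sup>2)"
    unfolding sq by (intro Bochner_Integration.integrable_sum int')
  have "(\<integral>x. (ip d x v)\<^sup>2 \<partial>\<mu>) = (\<Sum>i<d. \<Sum>j<d. (v i * v j) * (\<integral>x. x i * x j \<partial>\<mu>))"
  proof -
    have "(\<integral>x. (ip d x v)\<^sup>2 \<partial>\<mu>) = (\<Sum>i<d. (\<integral>x. (\<Sum>j<d. (v i * v j) * (x i * x j)) \<partial>\<mu>))"
      unfolding sq by (intro Bochner_Integration.integral_sum Bochner_Integration.integrable_sum int')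
    also have "\<dots> = (\<Sum>i<d. \<Sum>j<d. (\<integral>x. (v i * v j) * (x i * x j) \<partial>\<mu>))"
      by (intro sum.cong refl Bochner_Integration.integral_sum int')
    finally show ?thesis by simp
  qed
  also have "\<dots> = (\<Sum>i<d. \<Sum>j<d. if j = i then v i * v j else 0)"
    by (intro sum.cong refl) (auto simp: cov)
  also have "\<dots> = (\<Sum>i<d. v i * v i)" by (intro sum.cong refl) (subst sum.delta, auto)
  also have "\<dots> = (L2_set v {..<d})\<^sup>2" by (simp add: L2_set_def sum_nonneg power2_eq_square)
  finally show "(\<integral>x. (ip d x v)\<^sup>2 \<partial>\<mu>) = (L2_set v {..<d})\<^sup>2" .
qed

lemma Lnorm_le_imp:
  assumes [measurable]: "f \<in> borel_measurable M" and q: "q > 0" and le: "Lnorm M q f \<le> ennreal L"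
  shows "integrable M (\<lambda>x. \<bar>f x\<bar> powr q)" "(\<integral>x. \<bar>f x\<bar> powr q \<partial>M) \<le> max L 0 powr q"
proof -
  let ?I = "\<integral>\<^sup>+x. ennreal (\<bar>f x\<bar> powr q) \<partial>M"
  have "?I \<noteq> \<infinity>" using le by (auto simp: Lnorm_def enn_powr_def top_unique)
  then obtain r where r: "r \<ge> 0" "?I = ennreal r" by (cases ?I) auto
  then have "ennreal (r powr (1 / q)) \<le> ennreal L" using le by (simp add: Lnorm_def enn_powr_def)
  then have "r powr (1 / q) \<le> max L 0" by (cases "L \<ge> 0") (auto simp: ennreal_le_iff ennreal_neg)
  then have "(r powr (1 / q)) powr q \<le> max L 0 powr q" using q by (intro powr_mono2) auto
  then have rle: "r \<le> max L 0 powr q" using q r by (simp add: powr_powr)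
  show i: "integrable M (\<lambda>x. \<bar>f x\<bar> powr q)"
    by (rule integrableI_bounded) (simp_all add: r)
  show "(\<integral>x. \<bar>f x\<bar> powr q \<partial>M) \<le> max L 0 powr q"
    using rle r by (subst integral_eq_nn_integral) auto
qed

lemma isotropic_lawI:
  assumes d: "d \<ge> 1" and prob: "prob_space \<mu>" and mu: "sets \<mu> = sets (euc d)"
    and c: "centred d \<mu>" and iso: "isotropic d \<mu>" and q: "q \<ge> 4"
    and L: "(SUP \<theta>\<in>unit_sphere d. Lnorm \<mu> q (\<lambda>x. ip d x \<theta>)) \<le> ennreal L"
  shows "isotropic_law d \<mu> q (max L 0 powr q)"
proof (rule isotropic_law.intro)
  have [measurable]: "(\<lambda>x. ip d x v) \<in> borel_measurable \<mu>" for v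
    by (simp add: measurable_cong_sets[OF mu refl])
  have unit: "integrable \<mu> (\<lambda>x. \<bar>ip d x \<theta>\<bar> powr q) \<and> (\<integral>x. \<bar>ip d x \<theta>\<bar> powr q \<partial>\<mu>) \<le> max L 0 powr q"
    if t: "\<theta> \<in> unit_sphere d" for \<theta>
  proof -
    have "Lnorm \<mu> q (\<lambda>x. ip d x \<theta>) \<le> ennreal L" by (rule order_trans[OF SUP_upper[OF t] L])
    moreover have "0 < q" using q by simp
    ultimately show ?thesis by (intro conjI Lnorm_le_imp) simp_all
  qed
  have all: "integrable \<mu> (\<lambda>x. \<bar>ip d x v\<bar> powr q) \<and> (\<integral>x. \<bar>ip d x v\<bar> powr q \<partial>\<mu>) \<le> max L 0 powr q * L2_set v {..<d} powr q" for v
  proof (cases "L2_set v {..<d} = 0")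
    case True
    then have "ip d x v = 0" for x using abs_ip_le[of d x v] by simp
    then show ?thesis using q by simp
  next
    case False
    then have lv: "L2_set v {..<d} > 0" using L2_set_nonneg[of v "{..<d}"] by linarith
    obtain w where w: "w \<in> unit_sphere d" and scale: "\<And>x. ip d x v = L2_set v {..<d} * ip d x w"
      using ip_eq_scaled_unit[OF False] by blast
    have eq: "\<bar>ip d x v\<bar> powr q = L2_set v {..<d} powr q * \<bar>ip d x w\<bar> powr q" for x
      using lv by (simp add: scale abs_mult powr_mult)
    show ?thesis unfolding eq using unit[OF w] lv by (simp add: mult.commute mult_right_mono)
  qed
  show "integrable \<mu> (\<lambda>x. \<bar>ip d x v\<bar> powr q)" "(\<integral>x. \<bar>ip d x v\<bar> powr q \<partial>\<mu>) \<le> max L 0 powr q * L2_set v {..<d} powr q" for v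
    using all by auto
  show "integrable \<mu> (\<lambda>x. (ip d x v)\<^sup>2)" "(\<integral>x. (ip d x v)\<^sup>2 \<partial>\<mu>) = (L2_set v {..<d})\<^sup>2" for v
    by (rule isotropic_second_moment[OF prob mu c iso])+
  show "0 \<le> max L 0 powr q" by simp
qed (rule d prob mu q)+

section \<open>Choice of the truncation level\<close>

lemma half_power_le_sqrt:
  assumes D: "0 < \<Delta>" and n: "ln (1 / \<Delta>) \<le> real n"
  shows "(1/2) ^ n \<le> sqrt \<Delta>"
proof -
  have "(1/2::real) \<le> exp (- (1/2))"
  proof -
    have "(exp (1/2))\<^sup>2 = exp (1::real)" by (simp add: power2_eq_square mult_exp_exp)
    also have "\<dots> \<le> 2\<^sup>2" using exp_le by simp
    finally have "exp (1/2) \<le> (2::real)" by (rule power2_le_imp_le) simp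
    then show ?thesis by (simp add: exp_minus field_simps)
  qed
  then have "(1/2::real) ^ n \<le> exp (- (1/2)) ^ n" by (intro power_mono) auto
  also have "\<dots> = exp (real n * (- (1/2)))" by (rule exp_of_nat_mult[symmetric])
  also have "\<dots> \<le> exp (ln \<Delta> / 2)" using n D by (simp add: ln_div)
  also have "\<dots> = sqrt \<Delta>"
    using D by (simp add: powr_half_sqrt[symmetric] powr_def)
  finally show ?thesis .
qed

text \<open>
  The level \<open>R = \<Delta>\<close> to the power \<open>-1 / (2 (q - 2))\<close> is chosen so that the tail \<open>R\<close> to the power \<open>2 - q\<close> equals \<open>sqrt \<Delta>\<close>.  The term
  \<open>R\<^sup>2 \<Delta> n\<^sup>2\<close>, with \<open>n\<close> of order \<open>log (1/\<Delta>)\<close>, is then \<open>sqrt \<Delta>\<close> times \<open>\<Delta>\<^sup>k n\<^sup>2\<close> with \<open>k = 1/2 - 1/(q - 2)\<close>.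
  For \<open>q > 4\<close> the exponent \<open>k\<close> is positive and absorbs the logarithms; for
  \<open>q = 4\<close> it is \<open>0\<close>, and two logarithms remain under the square root.
\<close>

lemma truncation_constants:
  fixes q A :: real
  assumes q: "q \<ge> 4" and A: "A \<ge> 0"
  shows "\<exists>c\<ge>0. \<forall>\<Delta>. 0 < \<Delta> \<longrightarrow> \<Delta> \<le> exp (- 1) \<longrightarrow> (\<exists>R>0. \<exists>K\<ge>0. \<exists>n.
    (\<integral>\<^sup>+t. ennreal ((1 + \<bar>t\<bar>) powr (3 - q)) * indicator {-R..R} t \<partial>lborel) \<le> ennreal K \<and>
    4 * (30 * sqrt \<Delta> * (K + (A + 3 powr q * (1 + 2 * A))) + 4 * R\<^sup>2 * \<Delta> * (real n)\<^sup>2 + 8 * (1/2) ^ n + A * R powr (2 - q))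
      \<le> 2 * (c * (\<Delta> powr (1/4) * (if q > 4 then 1 else ln (1 / \<Delta>))))\<^sup>2)"
proof -
  define B where "B = A + 3 powr q * (1 + 2 * A)"
  have B: "B \<ge> 0" using A by (simp add: B_def)
  define k where "k = 1/2 - 1 / (q - 2)"
  define E where "E = (if q > 4 then 2 * (30 * (2 / (q - 4) + B) + 32 / k\<^sup>2 + 8 + A) else 2 * (120 + 30 * B + 16 + 8 + A))"
  have E: "E \<ge> 0" using A B by (simp add: E_def)
  show ?thesis
  proof (rule exI[of _ "sqrt E"], intro conjI allI impI)
    show "0 \<le> sqrt E" using E by simp
    fix \<Delta> :: real assume D: "0 < \<Delta>" "\<Delta> \<le> exp (- 1)"
    define l where "l = ln (1 / \<Delta>)"
    have "ln \<Delta> \<le> ln (exp (- 1))" using D by (subst ln_le_cancel_iff) auto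
    then have l: "l \<ge> 1" using D by (simp add: l_def ln_div)
    have Dl: "\<Delta> = exp (- l)" using D by (simp add: l_def ln_div)
    define R where "R = \<Delta> powr (- 1 / (2 * (q - 2)))"
    have R: "R > 0" using D by (simp add: R_def)
    define n where "n = nat \<lceil>l\<rceil>"
    have n: "l \<le> real n" "real n \<le> 2 * l" using l unfolding n_def by linarith+
    define K where "K = (if q > 4 then 2 / (q - 4) else 2 * ln (1 + R))"
    have K: "K \<ge> 0" using R by (simp add: K_def)
    have weight: "(\<integral>\<^sup>+t. ennreal ((1 + \<bar>t\<bar>) powr (3 - q)) * indicator {-R..R} t \<partial>lborel) \<le> ennreal K"
    proof (cases "q > 4")
      case True
      then show ?thesis using weight_integral_supercritical[of R q] R by (simp add: K_def)
    next
      case False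
      then have "q = 4" using q by simp
      then show ?thesis using weight_integral_critical[of R] R by (simp add: K_def)
    qed
    have R2: "R\<^sup>2 * \<Delta> = sqrt \<Delta> * \<Delta> powr k"
    proof -
      have "R\<^sup>2 = R powr 2" using R by (simp add: powr_numeral)
      also have "\<dots> = \<Delta> powr (- 1 / (2 * (q - 2)) * 2)" by (simp only: R_def powr_powr)
      also have "- 1 / (2 * (q - 2)) * 2 = - (1 / (q - 2))" using q by (simp add: field_simps)
      finally have "R\<^sup>2 * \<Delta> = \<Delta> powr (- (1 / (q - 2))) * \<Delta> powr 1" using D by simp
      also have "\<dots> = \<Delta> powr (1/2) * \<Delta> powr k" by (simp only: powr_add[symmetric]) (simp add: k_def)
      finally show ?thesis using D by (simp add: powr_half_sqrt)
    qed
    have Rq: "R powr (2 - q) = sqrt \<Delta>"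
    proof -
      have half: "- 1 / (2 * (q - 2)) * (2 - q) = 1/2" using q by (simp add: field_simps)
      show ?thesis unfolding R_def powr_powr half using D by (simp add: powr_half_sqrt)
    qed
    have "4 * (30 * sqrt \<Delta> * (K + B) + 4 * R\<^sup>2 * \<Delta> * (real n)\<^sup>2 + 8 * (1/2) ^ n + A * R powr (2 - q))
        \<le> 4 * (30 * sqrt \<Delta> * (K + B) + 4 * (sqrt \<Delta> * \<Delta> powr k) * (2 * l)\<^sup>2 + 8 * sqrt \<Delta> + A * sqrt \<Delta>)"
    proof -
      have "4 * (R\<^sup>2 * \<Delta>) * (real n)\<^sup>2 \<le> 4 * (sqrt \<Delta> * \<Delta> powr k) * (2 * l)\<^sup>2"
        unfolding R2 using n D by (intro mult_left_mono power_mono) auto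
      moreover have "(1/2) ^ n \<le> sqrt \<Delta>" using half_power_le_sqrt[OF D(1)] n(1) by (simp add: l_def)
      moreover have "4 * R\<^sup>2 * \<Delta> * (real n)\<^sup>2 = 4 * (R\<^sup>2 * \<Delta>) * (real n)\<^sup>2" by simp
      ultimately show ?thesis unfolding Rq using D A by (intro mult_left_mono add_mono) simp_all
    qed
    also have "\<dots> = 2 * sqrt \<Delta> * (2 * (30 * (K + B) + 16 * (\<Delta> powr k * l\<^sup>2) + 8 + A))"
      by (simp add: algebra_simps power_mult_distrib)
    also have "\<dots> \<le> 2 * sqrt \<Delta> * (E * (if q > 4 then 1 else l)\<^sup>2)"
    proof (intro mult_left_mono)
      show "2 * (30 * (K + B) + 16 * (\<Delta> powr k * l\<^sup>2) + 8 + A) \<le> E * (if q > 4 then 1 else l)\<^sup>2"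
      proof (cases "q > 4")
        case True
        have k: "k > 0" using True by (simp add: k_def field_simps)
        have taylor: "(k * l)\<^sup>2 / 2 \<le> exp (k * l)"
        proof -
          have "0 \<le> k * l" using k l by simp
          then show ?thesis using exp_lower_Taylor_quadratic[of "k * l"] by linarith
        qed
        have "\<Delta> powr k = 1 / exp (k * l)"
        proof -
          have "ln \<Delta> = - l" using D by (simp add: l_def ln_div)
          then show ?thesis using D by (simp add: powr_def exp_minus inverse_eq_divide)
        qed
        then have "\<Delta> powr k * l\<^sup>2 = 2 / k\<^sup>2 * (((k * l)\<^sup>2 / 2) / exp (k * l))"
          using k by (simp add: power_mult_distrib)
        also have "\<dots> \<le> 2 / k\<^sup>2 * 1"
          using taylor by (intro mult_left_mono) auto
        finally have "\<Delta> powr k * l\<^sup>2 \<le> 2 / k\<^sup>2" by simp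
        then show ?thesis using True by (simp add: E_def K_def)
      next
        case False
        then have q4: "q = 4" using q by simp
        have "ln (1 + R) \<le> 2 * l"
        proof -
          have "R = exp (l / 4)" using q4 by (simp add: R_def Dl powr_def)
          then have "1 + R \<le> 2 * exp (l / 4)" using l by simp
          also have "\<dots> \<le> exp 1 * exp (l / 4)" using exp_ge_add_one_self[of 1] by (intro mult_right_mono) auto
          also have "\<dots> \<le> exp (2 * l)" using l by (simp add: mult_exp_exp)
          finally have "ln (1 + R) \<le> ln (exp (2 * l))" using R by (subst ln_le_cancel_iff) auto
          then show ?thesis by simp
        qed
        then have "K \<le> 4 * l" using False by (simp add: K_def)
        also have "\<dots> \<le> 4 * l\<^sup>2" using l mult_left_mono[of 1 l l] by (simp add: power2_eq_square)
        finally have "K \<le> 4 * l\<^sup>2" .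
        moreover have "1 \<le> l\<^sup>2" using l by simp
        then have "(30 * B + 8 + A) * 1 \<le> (30 * B + 8 + A) * l\<^sup>2" using A B by (intro mult_left_mono) auto
        moreover have "\<Delta> powr k = 1" using q4 D by (simp add: k_def)
        ultimately show ?thesis using False by (simp add: E_def algebra_simps)
      qed
    qed (use D in simp)
    also have "\<dots> = 2 * (sqrt E * (\<Delta> powr (1/4) * (if q > 4 then 1 else ln (1 / \<Delta>))))\<^sup>2"
    proof -
      have "(\<Delta> powr (1/4))\<^sup>2 = sqrt \<Delta>"
        using D by (simp add: power2_eq_square powr_add[symmetric] powr_half_sqrt)
      then show ?thesis using E by (simp add: power_mult_distrib l_def)
    qed
    finally show "\<exists>R>0. \<exists>K\<ge>0. \<exists>n.
      (\<integral>\<^sup>+t. ennreal ((1 + \<bar>t\<bar>) powr (3 - q)) * indicator {-R..R} t \<partial>lborel) \<le> ennreal K \<and>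
      4 * (30 * sqrt \<Delta> * (K + (A + 3 powr q * (1 + 2 * A))) + 4 * R\<^sup>2 * \<Delta> * (real n)\<^sup>2 + 8 * (1/2) ^ n + A * R powr (2 - q))
        \<le> 2 * (sqrt E * (\<Delta> powr (1/4) * (if q > 4 then 1 else ln (1 / \<Delta>))))\<^sup>2"
      using R K weight unfolding B_def by blast
  qed
qed

section \<open>The max-sliced Wasserstein distance of the empirical measure\<close>

theorem theorem1p4:
  shows "\<exists>c0>(0::real). \<exists>c1>(0::real). \<exists>c2>(0::real).
    \<forall>q\<ge>(4::real). \<forall>L::real. \<exists>c3>(0::real).
      \<forall>(d::nat) (\<mu> :: (nat \<Rightarrow> real) measure) (\<Delta>::real) (m::nat).
        d \<ge> 1 \<longrightarrow>
        prob_space \<mu> \<longrightarrow> sets \<mu> = sets (euc d) \<longrightarrow>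
        centred d \<mu> \<longrightarrow> isotropic d \<mu> \<longrightarrow>
        (SUP \<theta>\<in>unit_sphere d. Lnorm \<mu> q (\<lambda>x. ip d x \<theta>)) \<le> ennreal L \<longrightarrow>
        0 < \<Delta> \<longrightarrow> \<Delta> \<le> c0 \<longrightarrow> real m \<ge> c1 * (real d / \<Delta>) \<longrightarrow>
        measure (PiM {..<m} (\<lambda>_. \<mu>))
          {x \<in> space (PiM {..<m} (\<lambda>_. \<mu>)).
             SW2 d (empirical d m x) \<mu> \<le>
               ennreal (c3 * (if q > 4 then sqrt (rho d m x) + \<Delta> powr (1 / 4)
                              else sqrt (rho d m x) + \<Delta> powr (1 / 4) * ln (1 / \<Delta>)))}
        \<ge> 1 - exp (- (c2 * \<Delta> * real m))"
proof -
  let "\<exists>c0>0. \<exists>c1>0. \<exists>c2>0. \<forall>q\<ge>4. \<forall>L. \<exists>c3>0. ?P c0 c1 c2 q L c3" = ?thesis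
  have main: "\<exists>c3>0. ?P (exp (- 1)) 14 (1/4) q L c3" if q: "q \<ge> 4" for q L :: real
  proof -
    define A where "A = max L 0 powr q"
    have A: "A \<ge> 0" by (simp add: A_def)
    from truncation_constants[OF q A] obtain c where c: "c \<ge> 0"
      and const: "\<And>\<Delta>. 0 < \<Delta> \<Longrightarrow> \<Delta> \<le> exp (- 1) \<Longrightarrow> \<exists>R>0. \<exists>K\<ge>0. \<exists>n.
      (\<integral>\<^sup>+t. ennreal ((1 + \<bar>t\<bar>) powr (3 - q)) * indicator {-R..R} t \<partial>lborel) \<le> ennreal K \<and>
      4 * (30 * sqrt \<Delta> * (K + (A + 3 powr q * (1 + 2 * A))) + 4 * R\<^sup>2 * \<Delta> * (real n)\<^sup>2 + 8 * (1/2) ^ n + A * R powr (2 - q))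
        \<le> 2 * (c * (\<Delta> powr (1/4) * (if q > 4 then 1 else ln (1 / \<Delta>))))\<^sup>2"
      by blast
    show ?thesis
    proof (rule exI[of _ "3 * (1 + c)"], intro conjI allI impI)
      show "0 < 3 * (1 + c)" using c by simp
      fix d :: nat and \<mu> :: "(nat \<Rightarrow> real) measure" and \<Delta> :: real and m :: nat
      assume d: "d \<ge> 1" and prob: "prob_space \<mu>" and mu: "sets \<mu> = sets (euc d)"
        and cen: "centred d \<mu>" and iso: "isotropic d \<mu>"
        and L: "(SUP \<theta>\<in>unit_sphere d. Lnorm \<mu> q (\<lambda>x. ip d x \<theta>)) \<le> ennreal L"
        and D: "0 < \<Delta>" "\<Delta> \<le> exp (- 1)" and m14: "real m \<ge> 14 * (real d / \<Delta>)"
      interpret isotropic_law d \<mu> q A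
        unfolding A_def by (rule isotropic_lawI[OF d prob mu cen iso q L])
      have Dm: "\<Delta> * real m \<ge> 14 * real d" using m14 D by (simp add: field_simps)
      define H where "H = \<Delta> powr (1/4) * (if q > 4 then 1 else ln (1 / \<Delta>))"
      have "ln \<Delta> \<le> ln (exp (- 1))" using D by (subst ln_le_cancel_iff) auto
      moreover have "ln (1 / \<Delta>) = - ln \<Delta>" using D by (simp add: ln_div)
      ultimately have "0 \<le> ln (1 / \<Delta>)" by simp
      then have H: "H \<ge> 0" by (simp add: H_def)
      have rate: "sqrt (rho d m x) + H = (if q > 4 then sqrt (rho d m x) + \<Delta> powr (1 / 4)
          else sqrt (rho d m x) + \<Delta> powr (1 / 4) * ln (1 / \<Delta>))" for x
        by (simp add: H_def)
      from const[OF D] SW2_probability[OF D(1) Dm _ _ _ c H]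
      show "1 - exp (- (1/4 * \<Delta> * real m)) \<le> measure (sample m)
          {x \<in> space (sample m). SW2 d (empirical d m x) \<mu> \<le> ennreal (3 * (1 + c) *
            (if q > 4 then sqrt (rho d m x) + \<Delta> powr (1 / 4)
             else sqrt (rho d m x) + \<Delta> powr (1 / 4) * ln (1 / \<Delta>)))}"
        unfolding rate[symmetric] H_def[symmetric] by blast
    qed
  qed
  show ?thesis
    by (rule exI[of _ "exp (- 1)"], rule conjI, simp, rule exI[of _ 14], rule conjI, simp,
        rule exI[of _ "1/4"], rule conjI, simp, intro allI impI, rule main)
qed

end
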